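(* Let $(T,\mathcal{A},\mu)$ be a complete finite measure space, let $\psi_i:T\times\mathbb{R}^n\to\overline{\mathbb{R}}$, $i=1,\ldots,s$, be normal integrands, and let $U$ be an open subset of $\mathbb{R}^n$ such that: (i) for $x\in U$ and $i=1,\ldots,s$ the functions $\psi_i(t,\cdot)$ are continuously differentiable around $x$ for a.e. $t\in T$; (ii) there exists $\ell\in L^1(T,\mathbb{R}_+)$ such that for all $i=1,\ldots,s$, all $u_1,u_2\in U$, and a.e. $t\in T$ $$|\psi_i(t,u_1)-\psi_i(t,u_2)|+\|\nabla_x\psi_i(t,u_1)-\nabla_x\psi_i(t,u_2)\|\le\ell(t)\|u_1-u_2\|.$$ Let $\varphi(t,x):=\max\{\psi_i(t,x):i=1,\ldots,s\}$, and assume that for some $\bar x\in U$ and $\bar y\in\partial E_\varphi(\bar x)$ the multifunction $\mathcal{S}_\varphi$ is inner semicompact at $(\bar x,\bar y)$ and that $\varphi$ enjoys the second-order integrable quasi-Lipschitzian property around $(\bar x,\bar{\mathsf y})$ for all $\bar{\mathsf y}\in\mathcal{S}_\varphi(\bar x,\bar y)$. Then for all $y^*\in\mathbb{R}^n$ $$\partial^2E_\varphi(\bar x,\bar y)(y^* )\subset\bigcup_{\bar{\mathsf y}\in\mathcal{S}_\varphi(\bar x,\bar y)}\int_T\partial^2\varphi_t(\bar x,\bar{\mathsf y}(t))(y^* )\,d\mu.$$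
   Context: $\overline{\mathbb{R}}=[-\infty,\infty]$, $\mathbb{R}_+:=\{\alpha\in\mathbb{R}:\alpha>0\}$; $L^p(T,\cdot)$ are the usual Lebesgue spaces; vectors are identified with constant functions. $\varphi_t:=\varphi(t,\cdot)$; a function is a normal integrand if it is $\mathcal{A}\otimes\mathcal{B}(\mathbb{R}^n)$-measurable and lower semicontinuous in $x$ for every $t$; all extended-real-valued functions are assumed proper. $E_\varphi(x):=\int_T\varphi_t(x)d\mu$ (with the convention $\infty-\infty=\infty$). The (Aumann) integral of $A:T\rightrightarrows\mathbb{R}^d$ is $\int_TA(t)d\mu=\{\int_T\mathsf{v}\,d\mu:\mathsf{v}\in L^1(T,\mathbb{R}^d),\ \mathsf{v}(t)\in A(t)\text{ a.e.}\}$. $\mathcal{S}_\varphi(x,y):=\{\mathsf{y}\in L^1(T,\mathbb{R}^n):\int_T\mathsf{y}\,d\mu=y,\ \mathsf{y}(t)\in\partial\varphi_t(x)\text{ for a.e. }t\in T\}$. $\mathcal{S}_\varphi$ is inner semicompact at $(\bar x,\bar y)$ if for every sequence $(x_k,y_k)\to(\bar x,\bar y)$ with $\mathcal{S}_\varphi(x_k,y_k)\neq\emptyset$ there is a sequence $\mathsf{y}_k\in\mathcal{S}_\varphi(x_k,y_k)$ containing an $L^1(T,\mathbb{R}^n)$-norm convergent subsequence. Regular normal cone: $\hat N(\bar z;\Omega)=\{z^*:\limsup_{z\to\bar z,z\in\Omega}\langle z^*,z-\bar z\rangle/\|z-\bar z\|\le0\}$ for $\bar z\in\Omega$, $\emptyset$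 otherwise. Limiting normal cone: $N(\bar z;\Omega)=\{z^*:\exists z_k\to\bar z,\ z_k^*\to z^*,\ z_k^*\in\hat N(z_k;\Omega)\}$. For $\psi:\mathbb{R}^n\to\overline{\mathbb{R}}$ finite at $x$: $\partial\psi(x)=\{x^*:(x^*,-1)\in N((x,\psi(x));\operatorname{epi}\psi)\}$ (empty if $\psi(x)$ is not finite). Limiting coderivative at $(x,y)\in\operatorname{gph}G$: $D^*G(x,y)(y^* )=\{x^*:(x^*,-y^* )\in N((x,y);\operatorname{gph}G)\}$. For $x^*\in\partial\psi(x)$ the basic second-order subdifferential is $\partial^2\psi(x,x^* )(v^* ):=(D^*\partial\psi)(x,x^* )(v^* )$. $\varphi$ enjoys the second-order integrable quasi-Lipschitzian property around $(\bar x,\bar{\mathsf y})$ if there exist $\eta>0$ and $\ell\in L^1(T,\mathbb{R}_+)$ such that $\sup\{\|x^*\|:x^*\in\partial^2\varphi_t(\mathsf{x}(t),\mathsf{y}(t))(\mathsf{y}^*(t))\}\le\ell(t)\|\mathsf{y}^*(t)\|$ for a.e. $t\in T$ whenever $\mathsf{x}\in L^\infty(T,\mathbb{R}^n)$ with $\|\mathsf{x}-\bar x\|_\infty\le\eta$, $\mathsf{y}\in L^1(T,\mathbb{R}^n)$ with $\|\mathsf{y}-\bar{\mathsf y}\|_1\le\eta$ and $\mathsf{y}(t)\in\partial\varphi_t(\mathsf{x}(t))$ a.e., and $\mathsf{y}^*\in L^\infty(T,\mathbb{R}^n)$ (the inequality being regarded as satisfied when the set is empty). *)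

theory Defs
  imports "HOL-Analysis.Analysis" "HOL-Probability.Essential_Supremum"
begin

section \<open>Normal cones, subdifferentials and coderivatives\<close>

text \<open>At an isolated point of \<open>\<Omega>\<close> the filter is trivial and the upper limit is \<open>-\<infinity>\<close>, so that
  every vector is a regular normal there.\<close>

definition regular_normal_cone :: "'a::real_inner \<Rightarrow> 'a set \<Rightarrow> 'a set" where
  "regular_normal_cone z0 \<Omega> =
     (if z0 \<in> \<Omega>
      then {z'. Limsup (at z0 within \<Omega>) (\<lambda>z. ereal (z' \<bullet> (z - z0) / norm (z - z0))) \<le> 0}
      else {})"

definition limiting_normal_cone :: "'a::real_inner \<Rightarrow> 'a set \<Rightarrow> 'a set" where
  "limiting_normal_cone z0 \<Omega> =
     {z'. \<exists>z z'k. z \<longlonglongrightarrow> z0 \<and> z'k \<longlonglongrightarrow> z' \<and>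
          (\<forall>k::nat. z'k k \<in> regular_normal_cone (z k) \<Omega>)}"

definition epi :: "('a \<Rightarrow> ereal) \<Rightarrow> ('a \<times> real) set" where
  "epi f = {(x, \<alpha>). f x \<le> ereal \<alpha>}"

definition subdifferential :: "('a::real_inner \<Rightarrow> ereal) \<Rightarrow> 'a \<Rightarrow> 'a set" where
  "subdifferential f x =
     (if \<bar>f x\<bar> \<noteq> \<infinity>
      then {x'. (x', -1) \<in> limiting_normal_cone (x, real_of_ereal (f x)) (epi f)}
      else {})"

definition gph :: "('a \<Rightarrow> 'b set) \<Rightarrow> ('a \<times> 'b) set" where
  "gph G = {(x, y). y \<in> G x}"

definition coderivative ::
    "('a::real_inner \<Rightarrow> 'b::real_inner set) \<Rightarrow> 'a \<Rightarrow> 'b \<Rightarrow> 'b \<Rightarrow> 'a set" where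
  "coderivative G x y y' = {x'. (x', - y') \<in> limiting_normal_cone (x, y) (gph G)}"

definition second_subdifferential ::
    "('a::real_inner \<Rightarrow> ereal) \<Rightarrow> 'a \<Rightarrow> 'a \<Rightarrow> 'a \<Rightarrow> 'a set" where
  "second_subdifferential f x x' v' = coderivative (subdifferential f) x x' v'"

section \<open>Extended-real-valued functions and normal integrands\<close>

definition proper_fun :: "('a \<Rightarrow> ereal) \<Rightarrow> bool" where
  "proper_fun f \<longleftrightarrow> (\<forall>x. f x \<noteq> -\<infinity>) \<and> (\<exists>x. f x \<noteq> \<infinity>)"

definition lsc :: "('a::topological_space \<Rightarrow> ereal) \<Rightarrow> bool" where
  "lsc f \<longleftrightarrow> (\<forall>x. f x \<le> Liminf (at x) f)"

definition normal_integrand ::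
    "'t measure \<Rightarrow> ('t \<Rightarrow> 'a::topological_space \<Rightarrow> ereal) \<Rightarrow> bool" where
  "normal_integrand M \<phi> \<longleftrightarrow>
     (\<lambda>(t, x). \<phi> t x) \<in> borel_measurable (M \<Otimes>\<^sub>M borel) \<and> (\<forall>t\<in>space M. lsc (\<phi> t))"

text \<open>Differentiability at \<open>x\<close> includes finiteness in a neighbourhood of \<open>x\<close>; without it,
  \<open>real_of_ereal\<close> would turn infinite values into \<open>0\<close>.\<close>

definition has_gradient :: "('a::real_inner \<Rightarrow> ereal) \<Rightarrow> 'a \<Rightarrow> 'a \<Rightarrow> bool" where
  "has_gradient f x g \<longleftrightarrow>
     (\<forall>\<^sub>F u in nhds x. \<bar>f u\<bar> \<noteq> \<infinity>) \<and> GDERIV (\<lambda>u. real_of_ereal (f u)) x :> g"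

definition continuously_differentiable_around :: "('a::real_inner \<Rightarrow> ereal) \<Rightarrow> 'a \<Rightarrow> bool" where
  "continuously_differentiable_around f x \<longleftrightarrow>
     (\<exists>V g. open V \<and> x \<in> V \<and> (\<forall>u\<in>V. has_gradient f u (g u)) \<and> continuous_on V g)"

section \<open>Integral functionals, Aumann integrals and selections\<close>

text \<open>The integral is the difference of the integrals of the positive and the negative part.
  Subtraction on \<open>ereal\<close> satisfies \<open>\<infinity> - \<infinity> = \<infinity>\<close>.\<close>

definition integral_functional :: "'t measure \<Rightarrow> ('t \<Rightarrow> 'a \<Rightarrow> ereal) \<Rightarrow> 'a \<Rightarrow> ereal" where
  "integral_functional M \<phi> x =
     enn2ereal (\<integral>\<^sup>+ t. e2ennreal (\<phi> t x) \<partial>M) - enn2ereal (\<integral>\<^sup>+ t. e2ennreal (- \<phi> t x) \<partial>M)"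

definition aumann_integral ::
    "'t measure \<Rightarrow> ('t \<Rightarrow> 'a::{banach, second_countable_topology} set) \<Rightarrow> 'a set" where
  "aumann_integral M A =
     {integral\<^sup>L M v | v. integrable M v \<and> (AE t in M. v t \<in> A t)}"

text \<open>Elements of \<open>L\<^sup>1\<close> and \<open>L\<^sup>\<infinity>\<close> are represented by functions; every notion below is
  invariant under changes on null sets.\<close>

definition L1_norm :: "'t measure \<Rightarrow> ('t \<Rightarrow> 'a::real_normed_vector) \<Rightarrow> real" where
  "L1_norm M f = (\<integral>t. norm (f t) \<partial>M)"

definition Linf_norm :: "'t measure \<Rightarrow> ('t \<Rightarrow> 'a::real_normed_vector) \<Rightarrow> ereal" where
  "Linf_norm M f = esssup M (\<lambda>t. ereal (norm (f t)))"

definition in_Linf :: "'t measure \<Rightarrow> ('t \<Rightarrow> 'a::real_normed_vector) \<Rightarrow> bool" where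
  "in_Linf M f \<longleftrightarrow> f \<in> borel_measurable M \<and> Linf_norm M f < \<infinity>"

definition selections ::
    "'t measure \<Rightarrow> ('t \<Rightarrow> 'a::euclidean_space \<Rightarrow> ereal) \<Rightarrow> 'a \<Rightarrow> 'a \<Rightarrow> ('t \<Rightarrow> 'a) set" where
  "selections M \<phi> x y =
     {v. integrable M v \<and> integral\<^sup>L M v = y \<and> (AE t in M. v t \<in> subdifferential (\<phi> t) x)}"

definition inner_semicompact ::
    "'t measure \<Rightarrow> ('a::topological_space \<Rightarrow> 'b::topological_space
       \<Rightarrow> ('t \<Rightarrow> 'c::{banach, second_countable_topology}) set) \<Rightarrow> 'a \<Rightarrow> 'b \<Rightarrow> bool" where
  "inner_semicompact M S x0 y0 \<longleftrightarrow>
     (\<forall>x y. x \<longlonglongrightarrow> x0 \<longrightarrow> y \<longlonglongrightarrow> y0 \<longrightarrow> (\<forall>k::nat. S (x k) (y k) \<noteq> {}) \<longrightarrow>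
        (\<exists>v. (\<forall>k. v k \<in> S (x k) (y k)) \<and>
             (\<exists>r w. strict_mono (r :: nat \<Rightarrow> nat) \<and> integrable M w \<and>
                (\<lambda>k. L1_norm M (\<lambda>t. v (r k) t - w t)) \<longlonglongrightarrow> 0)))"

text \<open>The supremum is taken in \<open>ereal\<close>, where it is \<open>-\<infinity>\<close> over the empty set, so that the
  inequality holds in this case.\<close>

definition second_order_quasi_Lipschitzian ::
    "'t measure \<Rightarrow> ('t \<Rightarrow> 'a::euclidean_space \<Rightarrow> ereal) \<Rightarrow> 'a \<Rightarrow> ('t \<Rightarrow> 'a) \<Rightarrow> bool" where
  "second_order_quasi_Lipschitzian M \<phi> x0 y0 \<longleftrightarrow>
     (\<exists>\<eta>>0. \<exists>l :: 't \<Rightarrow> real. integrable M l \<and> (\<forall>t\<in>space M. l t > 0) \<and>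
        (\<forall>x y y'. in_Linf M x \<longrightarrow> Linf_norm M (\<lambda>t. x t - x0) \<le> ereal \<eta> \<longrightarrow>
           integrable M y \<longrightarrow> L1_norm M (\<lambda>t. y t - y0 t) \<le> \<eta> \<longrightarrow>
           (AE t in M. y t \<in> subdifferential (\<phi> t) (x t)) \<longrightarrow>
           in_Linf M y' \<longrightarrow>
           (AE t in M. (SUP x'\<in>second_subdifferential (\<phi> t) (x t) (y t) (y' t). ereal (norm x'))
                         \<le> ereal (l t * norm (y' t)))))"

end

theory Submission
  imports Defs "HOL-Library.Diagonal_Subsequence"
begin

text \<open>Near \<open>x0\<close> the integrand \<open>\<phi> t\<close> is Lipschitz and weakly convex, with an integrable modulus
  \<open>L t\<close>. The Leibniz rule for limiting subgradients gives a selection \<open>w\<close> of \<open>\<partial>\<phi> t (x0)\<close> with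
  integral \<open>y0\<close>. Minty's parametrization describes the graph of \<open>\<partial>\<phi> t\<close> by the proximal map \<open>P\<close>;
  in these coordinates the quasi-Lipschitzian property along \<open>w\<close> says that \<open>P\<close> is metrically regular.
  A monotone map that is metrically regular has a single-valued Lipschitz inverse, so \<open>\<phi> t\<close> has a
  Lipschitz gradient \<open>f t\<close> on a ball that does not depend on \<open>t\<close>, the functional \<open>E\<close> has the
  gradient \<open>F = \<integral> f t\<close>, and the coderivative of \<open>F\<close> is computed from the functions
  \<open>y' \<bullet> f t\<close> by the same Leibniz rule.

  The Leibniz rule for a Lipschitz integrand comes from minimizing the integral of its Moreau
  envelopes plus a quadratic: at the minimizer a measurable selection of proximal points yields
  proximal subgradients with nearly the prescribed integral. The limit is taken by Fatou's lemma in
  several dimensions.\<close>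

section \<open>Atomless measures\<close>

text \<open>Two obstacles shape the argument. The hypothesis on \<open>\<phi>\<close> is an almost
  everywhere statement about pairs (x, y) of functions, with x near \<open>x0\<close> in the sup
  norm but y near a selection only in the L1 norm, while regularity is wanted at single points t.
  Hence violations are collected by measurable argmins into one pair. The uniform radius comes from
  Minty's coordinates: moving the parameter by \<rho> moves the subgradient by a multiple of \<rho>
  L t, which is integrable, so \<rho> can be fixed before t. The graph normals produced there have
  the form (m - e, m / (2 L)) with a unit vector e, and the assumed bound, with modulus at most L,
  gives |m - e| \<le> |m| / 2. So 1 \<le> 3/2 |m|, which is the coderivative criterion for metric
  regularity of the proximal map.

  The second obstacle is that the fuzzy rule controls only the integrals of the subgradients in the
  limit, and the measure may have atoms. On the atomless part, switching between indices on
  measurable sets makes the attainable limits convex; on an atom the functions are constant, so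
  compactness suffices.\<close>

lemma (in finite_measure) exhaustion:
  assumes S: "\<S> \<subseteq> sets M" "A0 \<in> \<S>"
    and lim: "\<And>F. (\<And>n::nat. F n \<in> \<S>) \<Longrightarrow> incseq F \<Longrightarrow> (\<Union>n. F n) \<in> \<S>"
  obtains A where "A \<in> \<S>" "A0 \<subseteq> A" "\<And>B. B \<in> \<S> \<Longrightarrow> A \<subseteq> B \<Longrightarrow> measure M B = measure M A"
proof -
  \<comment> \<open>\<open>\<sigma> A\<close> is the largest measure still reachable above A inside
    \<S>. Each member of the chain F reaches it up to 1 / (n + 1), so nothing above the union can
    have larger measure; this replaces Zorn's lemma.\<close>
  define \<sigma> where "\<sigma> A = (SUP B\<in>{B\<in>\<S>. A \<subseteq> B}. measure M B)" for A
  have bdd: "bdd_above (measure M ` {B\<in>\<S>. A \<subseteq> B})" for A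
    by (rule bdd_aboveI2[of _ _ "measure M (space M)"]) (simp add: bounded_measure)
  have "\<exists>F. \<forall>n. (F n \<in> \<S> \<and> A0 \<subseteq> F n) \<and>
      (F n \<subseteq> F (Suc n) \<and> \<sigma> (F n) - 1 / Suc n < measure M (F (Suc n)))"
  proof (rule dependent_nat_choice)
    show "\<exists>x. x \<in> \<S> \<and> A0 \<subseteq> x" using S by auto
  next
    fix x n assume x: "x \<in> \<S> \<and> A0 \<subseteq> x"
    have "\<sigma> x - 1 / Suc n < \<sigma> x" by simp
    moreover have "{B \<in> \<S>. x \<subseteq> B} \<noteq> {}" using x by auto
    ultimately have "\<exists>B\<in>{B\<in>\<S>. x \<subseteq> B}. \<sigma> x - 1 / Suc n < measure M B"
      unfolding \<sigma>_def by (subst (asm) less_cSUP_iff[OF _ bdd[of x]])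
    then obtain B where "B \<in> \<S>" "x \<subseteq> B" "\<sigma> x - 1 / Suc n < measure M B" by auto
    then show "\<exists>y. (y \<in> \<S> \<and> A0 \<subseteq> y) \<and> x \<subseteq> y \<and> \<sigma> x - 1 / Suc n < measure M y"
      using x by auto
  qed
  then obtain F where F: "\<And>n. F n \<in> \<S>" "\<And>n. A0 \<subseteq> F n" "\<And>n. F n \<subseteq> F (Suc n)"
    and F': "\<And>n. \<sigma> (F n) - 1 / Suc n < measure M (F (Suc n))" by auto
  have inc: "incseq F" using F(3) by (simp add: incseq_Suc_iff)
  let ?A = "\<Union>n. F n"
  have A: "?A \<in> \<S>" using lim[OF F(1) inc] .
  show ?thesis
  proof (rule that[OF A])
    show "A0 \<subseteq> ?A" using F(2) by auto
    fix B assume B: "B \<in> \<S>" "?A \<subseteq> B"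
    have meas: "B \<in> sets M" "?A \<in> sets M" "\<And>n. F n \<in> sets M" using B A S F(1) by auto
    have 1: "measure M B \<le> measure M ?A + 1 / Suc n" for n
    proof -
      have "measure M B \<le> \<sigma> (F n)" unfolding \<sigma>_def
        by (rule cSUP_upper[OF _ bdd]) (use B in auto)
      also have "\<dots> \<le> measure M (F (Suc n)) + 1 / Suc n" using F'[of n] by simp
      also have "measure M (F (Suc n)) \<le> measure M ?A"
        by (rule finite_measure_mono) (use meas in auto)
      finally show ?thesis by simp
    qed
    have "measure M B \<le> measure M ?A + e" if "e > 0" for e
    proof -
      obtain n where "1 / real (Suc n) < e" using nat_approx_posE \<open>0 < e\<close> by blast
      then show ?thesis using 1[of n] by linarith
    qed
    then have "measure M B \<le> measure M ?A" by (rule field_le_epsilon)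
    then show "measure M B = measure M ?A"
      using finite_measure_mono[OF B(2) meas(1)] by simp
  qed
qed

definition atomless :: "'a measure \<Rightarrow> bool" where
  "atomless M \<longleftrightarrow> (\<forall>A\<in>sets M. 0 < measure M A \<longrightarrow>
     (\<exists>B\<in>sets M. B \<subseteq> A \<and> 0 < measure M B \<and> measure M B < measure M A))"

text \<open>When a set is split into two pieces of positive measure, one of them has at most half
  the measure; iterating this halving goes below e.\<close>

lemma (in finite_measure) atomless_small_subset:
  assumes M: "atomless M" and A: "A \<in> sets M" "0 < measure M A" and "0 < e"
  obtains B where "B \<in> sets M" "B \<subseteq> A" "0 < measure M B" "measure M B < e"
proof -
  have half: "\<exists>C. (C \<in> sets M \<and> C \<subseteq> A \<and> 0 < measure M C) \<and> measure M C \<le> measure M B / 2"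
    if B: "B \<in> sets M \<and> B \<subseteq> A \<and> 0 < measure M B" for B
  proof -
    obtain C where C: "C \<in> sets M" "C \<subseteq> B" "0 < measure M C" "measure M C < measure M B"
      using M B unfolding atomless_def by blast
    have "measure M (B - C) = measure M B - measure M C"
      by (rule finite_measure_Diff) (use B C in auto)
    then have "measure M C \<le> measure M B / 2 \<or> 0 < measure M (B - C) \<and> measure M (B - C) \<le> measure M B / 2"
      using C by linarith
    moreover have "C \<subseteq> A" "B - C \<in> sets M" "B - C \<subseteq> A" using B C by auto
    ultimately show ?thesis using C by blast
  qed
  have "\<exists>F. \<forall>n::nat. (F n \<in> sets M \<and> F n \<subseteq> A \<and> 0 < measure M (F n)) \<and>
      measure M (F (Suc n)) \<le> measure M (F n) / 2"
  proof (rule dependent_nat_choice)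
    show "\<exists>C. C \<in> sets M \<and> C \<subseteq> A \<and> 0 < measure M C" using A by blast
  qed (use half in blast)
  then obtain F where F: "\<And>n. F n \<in> sets M" "\<And>n. F n \<subseteq> A" "\<And>n. 0 < measure M (F n)"
    and F': "\<And>n::nat. measure M (F (Suc n)) \<le> measure M (F n) / 2" by auto
  have le: "measure M (F n) \<le> measure M (F 0) * (1/2)^n" for n
  proof (induction n)
    case (Suc n) then show ?case using F'[of n] by simp
  qed simp
  have "(\<lambda>n. measure M (F 0) * (1/2)^n) \<longlonglongrightarrow> measure M (F 0) * 0"
    by (intro tendsto_intros LIMSEQ_power_zero) simp
  then have "\<forall>\<^sub>F n in sequentially. measure M (F 0) * (1/2)^n < e"
    by (rule order_tendstoD) (simp add: \<open>0 < e\<close>)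
  then obtain n where "measure M (F 0) * (1/2)^n < e"
    by (auto simp: eventually_sequentially)
  then show ?thesis using that[OF F(1,2,3), of n] le[of n] by simp
qed

text \<open>Exhaustion among the subsets of measure at most c gives one that is maximal up to null
  sets. If its measure were below c, a small piece of the remainder could still be added.\<close>

lemma (in finite_measure) Sierpinski:
  assumes M: "atomless M" and A: "A \<in> sets M" and c: "0 \<le> c" "c \<le> measure M A"
  obtains B where "B \<in> sets M" "B \<subseteq> A" "measure M B = c"
proof -
  let ?S = "{B \<in> sets M. B \<subseteq> A \<and> measure M B \<le> c}"
  obtain B where B: "B \<in> ?S" "\<And>C. C \<in> ?S \<Longrightarrow> B \<subseteq> C \<Longrightarrow> measure M C = measure M B"
  proof (rule exhaustion[of ?S "{}"])
    show "{} \<in> ?S" using c by simp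
    fix F :: "nat \<Rightarrow> _" assume F: "\<And>n. F n \<in> ?S" "incseq F"
    have "(\<lambda>n. measure M (F n)) \<longlonglongrightarrow> measure M (\<Union>n. F n)"
      by (rule finite_Lim_measure_incseq) (use F in auto)
    then have "measure M (\<Union>n. F n) \<le> c"
      by (rule LIMSEQ_le_const2) (use F in auto)
    then show "(\<Union>n. F n) \<in> ?S" using F by auto
  next
    fix B assume "B \<in> ?S" "\<And>C. C \<in> ?S \<Longrightarrow> B \<subseteq> C \<Longrightarrow> measure M C = measure M B"
    then show thesis by (rule that)
  qed blast
  have "measure M B = c"
  proof (rule ccontr)
    assume "measure M B \<noteq> c"
    then have less: "measure M B < c" using B(1) by auto
    have d: "measure M (A - B) = measure M A - measure M B"
      by (rule finite_measure_Diff) (use A B(1) in auto)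
    obtain C where C: "C \<in> sets M" "C \<subseteq> A - B" "0 < measure M C" "measure M C < c - measure M B"
      by (rule atomless_small_subset[OF M, of "A - B" "c - measure M B"]) (use A B(1) less c d in auto)
    have "measure M (B \<union> C) = measure M B + measure M C"
      by (rule finite_measure_Union) (use B(1) C in auto)
    with C B(1) show False using B(2)[of "B \<union> C"] by force
  qed
  with B(1) that show ?thesis by auto
qed

text \<open>Taking the fraction \<theta> of each of the finitely many level sets scales every term
  of the integral exactly.\<close>

lemma (in finite_measure) atomless_mixing_simple:
  fixes f :: "'a \<Rightarrow> 'b::euclidean_space"
  assumes M: "atomless M" and f: "simple_function M f" and \<theta>: "0 \<le> \<theta>" "\<theta> \<le> 1"
  obtains S where "S \<in> sets M" "(\<integral>t. indicator S t *\<^sub>R f t \<partial>M) = \<theta> *\<^sub>R (\<integral>t. f t \<partial>M)"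
proof -
  define A where "A v = f -` {v} \<inter> space M" for v
  have A: "A v \<in> sets M" for v unfolding A_def using simple_functionD(2)[OF f] by auto
  have "\<exists>S\<in>sets M. S \<subseteq> A v \<and> measure M S = \<theta> * measure M (A v)" for v
  proof -
    have *: "0 \<le> \<theta> * measure M (A v)" "\<theta> * measure M (A v) \<le> measure M (A v)"
      using \<theta> by (auto simp: mult_left_le_one_le)
    show ?thesis by (rule Sierpinski[OF M A[of v] *]) blast
  qed
  then obtain S where S: "\<And>v. S v \<in> sets M" "\<And>v. S v \<subseteq> A v" "\<And>v. measure M (S v) = \<theta> * measure M (A v)"
    by metis
  define T where "T = (\<Union>v\<in>f ` space M. S v)"
  have fin: "finite (f ` space M)" using simple_functionD(1)[OF f] .
  have T: "T \<in> sets M" unfolding T_def using fin S(1) by (intro sets.finite_UN) auto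
  have eq: "f t = (\<Sum>v\<in>f ` space M. indicator (A v) t *\<^sub>R v)" if "t \<in> space M" for t
  proof -
    have "(\<Sum>v\<in>f ` space M. indicator (A v) t *\<^sub>R v) = (\<Sum>v\<in>f ` space M. if v = f t then v else 0)"
      by (rule sum.cong) (use that in \<open>auto simp: A_def indicator_def\<close>)
    also have "\<dots> = f t" using fin that by simp
    finally show ?thesis by simp
  qed
  have eq': "indicator T t *\<^sub>R f t = (\<Sum>v\<in>f ` space M. indicator (S v) t *\<^sub>R v)" if "t \<in> space M" for t
  proof -
    have "(\<Sum>v\<in>f ` space M. indicator (S v) t *\<^sub>R v) = (\<Sum>v\<in>f ` space M. if v = f t then indicator T t *\<^sub>R v else 0)"
    proof (rule sum.cong)
      fix v assume "v \<in> f ` space M"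
      show "indicator (S v) t *\<^sub>R v = (if v = f t then indicator T t *\<^sub>R v else 0)"
      proof (cases "v = f t")
        case True
        have "t \<in> S v \<longleftrightarrow> t \<in> T"
        proof
          assume "t \<in> T"
          then obtain x where x: "x \<in> space M" "t \<in> S (f x)" by (auto simp: T_def)
          then have "f t = f x" using S(2)[of "f x"] by (auto simp: A_def)
          then show "t \<in> S v" using x True by simp
        qed (use that True in \<open>auto simp: T_def\<close>)
        then show ?thesis using True by (simp add: indicator_def)
      next
        case False
        then have "t \<notin> S v" using S(2)[of v] by (auto simp: A_def)
        then show ?thesis using False by simp
      qed
    qed simp
    also have "\<dots> = indicator T t *\<^sub>R f t" using fin that by simp
    finally show ?thesis by simp
  qed
  have "(\<integral>t. indicator T t *\<^sub>R f t \<partial>M) = (\<integral>t. (\<Sum>v\<in>f ` space M. indicator (S v) t *\<^sub>R v) \<partial>M)"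
    by (rule Bochner_Integration.integral_cong) (simp_all add: eq')
  also have "\<dots> = (\<Sum>v\<in>f ` space M. measure M (S v) *\<^sub>R v)"
    using S(1) by (subst Bochner_Integration.integral_sum) (auto simp: emeasure_finite less_top[symmetric])
  also have "\<dots> = \<theta> *\<^sub>R (\<Sum>v\<in>f ` space M. measure M (A v) *\<^sub>R v)"
    by (simp add: S(3) scaleR_sum_right)
  also have "(\<Sum>v\<in>f ` space M. measure M (A v) *\<^sub>R v) = (\<integral>t. (\<Sum>v\<in>f ` space M. indicator (A v) t *\<^sub>R v) \<partial>M)"
    using A by (subst Bochner_Integration.integral_sum) (auto simp: emeasure_finite less_top[symmetric])
  also have "\<dots> = (\<integral>t. f t \<partial>M)"
    by (rule Bochner_Integration.integral_cong) (simp_all add: eq[symmetric])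
  finally show ?thesis using that T by blast
qed

text \<open>An approximate form of Lyapunov's convexity theorem. For an L1-approximation by a simple
  function the error of the integral is below e / 2 on every measurable set at once, so it can be
  estimated before S is known.\<close>

lemma (in finite_measure) atomless_mixing:
  fixes f :: "'a \<Rightarrow> 'b::euclidean_space"
  assumes M: "atomless M" and f: "integrable M f" and \<theta>: "0 \<le> \<theta>" "\<theta> \<le> 1" and e: "0 < e"
  obtains S where "S \<in> sets M" "norm ((\<integral>t. indicator S t *\<^sub>R f t \<partial>M) - \<theta> *\<^sub>R (\<integral>t. f t \<partial>M)) < e"
proof -
  have [measurable]: "f \<in> borel_measurable M" using f by auto
  obtain F where F: "\<And>i. simple_function M (F i)" "\<And>x. x \<in> space M \<Longrightarrow> (\<lambda>i. F i x) \<longlonglongrightarrow> f x"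
    "\<And>i x. x \<in> space M \<Longrightarrow> dist (F i x) 0 \<le> 2 * dist (f x) 0"
    using borel_measurable_implies_sequence_metric[OF \<open>f \<in> borel_measurable M\<close>, of 0] by metis
  have [measurable]: "F i \<in> borel_measurable M" for i using F(1) by (rule borel_measurable_simple_function)
  have "(\<lambda>i. \<integral>t. norm (F i t - f t) \<partial>M) \<longlonglongrightarrow> (\<integral>t. 0 \<partial>M)"
  proof (rule integral_dominated_convergence)
    show "integrable M (\<lambda>t. 3 * norm (f t))" using f by auto
    show "AE x in M. (\<lambda>i. norm (F i x - f x)) \<longlonglongrightarrow> 0"
      using F(2) by (auto intro!: AE_I2 tendsto_norm_zero LIM_zero)
    show "AE x in M. norm (norm (F i x - f x)) \<le> 3 * norm (f x)" for i
    proof (rule AE_I2)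
      fix x assume "x \<in> space M"
      from F(3)[OF this, of i] show "norm (norm (F i x - f x)) \<le> 3 * norm (f x)"
        using norm_triangle_ineq4[of "F i x" "f x"] by simp
    qed
  qed auto
  then have "\<forall>\<^sub>F i in sequentially. (\<integral>t. norm (F i t - f t) \<partial>M) < e / 2"
    by (rule order_tendstoD) (use e in auto)
  then obtain i where i: "(\<integral>t. norm (F i t - f t) \<partial>M) < e / 2" by (auto simp: eventually_sequentially)
  let ?g = "F i"
  have g: "integrable M ?g"
  proof (rule Bochner_Integration.integrable_bound[of _ "\<lambda>t. 2 * norm (f t)"])
    show "AE x in M. norm (F i x) \<le> norm (2 * norm (f x))"
      using F(3)[of _ i] by (auto intro!: AE_I2)
  qed (use f in auto)
  obtain S where S: "S \<in> sets M" "(\<integral>t. indicator S t *\<^sub>R ?g t \<partial>M) = \<theta> *\<^sub>R (\<integral>t. ?g t \<partial>M)"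
    using atomless_mixing_simple[OF M F(1) \<theta>] by metis
  have le: "norm ((\<integral>t. indicator T t *\<^sub>R f t \<partial>M) - (\<integral>t. indicator T t *\<^sub>R ?g t \<partial>M)) < e / 2"
    if [measurable]: "T \<in> sets M" for T
  proof -
    have int: "integrable M (\<lambda>t. indicator T t *\<^sub>R f t)" "integrable M (\<lambda>t. indicator T t *\<^sub>R ?g t)"
      using f g by (auto intro: integrable_mult_indicator[OF that])
    have "norm ((\<integral>t. indicator T t *\<^sub>R f t \<partial>M) - (\<integral>t. indicator T t *\<^sub>R ?g t \<partial>M))
        = norm (\<integral>t. indicator T t *\<^sub>R f t - indicator T t *\<^sub>R ?g t \<partial>M)"
      using int by simp
    also have "\<dots> \<le> (\<integral>t. norm (indicator T t *\<^sub>R f t - indicator T t *\<^sub>R ?g t) \<partial>M)"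
      by (rule integral_norm_bound)
    also have "\<dots> \<le> (\<integral>t. norm (?g t - f t) \<partial>M)"
      by (rule integral_mono) (use int f g in \<open>auto simp: indicator_def norm_minus_commute\<close>)
    finally show ?thesis using i by simp
  qed
  have 1: "norm (\<theta> *\<^sub>R ((\<integral>t. f t \<partial>M) - (\<integral>t. ?g t \<partial>M))) < e / 2"
  proof -
    have "(\<integral>t. indicator (space M) t *\<^sub>R f t \<partial>M) = (\<integral>t. f t \<partial>M)"
      "(\<integral>t. indicator (space M) t *\<^sub>R ?g t \<partial>M) = (\<integral>t. ?g t \<partial>M)"
      by (auto intro!: Bochner_Integration.integral_cong)
    then have "norm ((\<integral>t. f t \<partial>M) - (\<integral>t. ?g t \<partial>M)) < e / 2" using le[of "space M"] by simp
    moreover have "norm (\<theta> *\<^sub>R ((\<integral>t. f t \<partial>M) - (\<integral>t. ?g t \<partial>M))) \<le> norm ((\<integral>t. f t \<partial>M) - (\<integral>t. ?g t \<partial>M))"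
      using \<theta> by (simp add: mult_left_le_one_le)
    ultimately show ?thesis by linarith
  qed
  have "norm ((\<integral>t. indicator S t *\<^sub>R f t \<partial>M) - \<theta> *\<^sub>R (\<integral>t. f t \<partial>M))
     = norm (((\<integral>t. indicator S t *\<^sub>R f t \<partial>M) - (\<integral>t. indicator S t *\<^sub>R ?g t \<partial>M)) - \<theta> *\<^sub>R ((\<integral>t. f t \<partial>M) - (\<integral>t. ?g t \<partial>M)))"
    by (simp add: S(2) algebra_simps)
  also have "\<dots> < e" using norm_triangle_ineq4 le[OF S(1)] 1 by (smt (verit) field_sum_of_halves)
  finally show ?thesis using that S(1) by blast
qed

section \<open>Measurable selections\<close>

lemma inverse_Suc_tendsto_zero: "(\<lambda>k. 1 / real (Suc k)) \<longlonglongrightarrow> 0"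
  using LIMSEQ_inverse_real_of_nat by (simp add: inverse_eq_divide)

text \<open>The subsequence may depend on t and follows the pointwise upper limit. Always taking the
  least admissible index keeps it measurable in t. The last conclusion records that h is the upper
  limit, as is required in \<open>supported_direction_converges\<close>.\<close>

lemma random_subsequence_real:
  fixes g :: "nat \<Rightarrow> 't \<Rightarrow> real"
  assumes g[measurable]: "\<And>k. g k \<in> borel_measurable M"
    and bdd: "\<And>t. t \<in> space M \<Longrightarrow> bounded (range (\<lambda>k. g k t))"
  obtains \<kappa> h where "\<And>j::nat. \<kappa> j \<in> measurable M (count_space UNIV)"
    "\<And>t. t \<in> space M \<Longrightarrow> strict_mono (\<lambda>j. \<kappa> j t)"
    "h \<in> borel_measurable M"
    "\<And>t. t \<in> space M \<Longrightarrow> (\<lambda>j. g (\<kappa> j t) t) \<longlonglongrightarrow> h t"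
    "\<And>t e. t \<in> space M \<Longrightarrow> 0 < e \<Longrightarrow> \<forall>\<^sub>F k in sequentially. g k t < h t + e"
proof -
  define L where "L t = real_of_ereal (limsup (\<lambda>k. ereal (g k t)))" for t
  have [measurable]: "L \<in> borel_measurable M" unfolding L_def by measurable
  define \<kappa> where "\<kappa> = rec_nat (\<lambda>t. LEAST i. \<bar>g i t - L t\<bar> < 1)
      (\<lambda>j \<kappa>j t. LEAST i. \<kappa>j t < i \<and> \<bar>g i t - L t\<bar> < 1 / Suc (Suc j))"
  have k0: "\<kappa> 0 = (\<lambda>t. LEAST i. \<bar>g i t - L t\<bar> < 1)"
    and kS: "\<kappa> (Suc j) = (\<lambda>t. LEAST i. \<kappa> j t < i \<and> \<bar>g i t - L t\<bar> < 1 / Suc (Suc j))" for j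
    by (simp_all add: \<kappa>_def)
  have meas: "\<kappa> j \<in> measurable M (count_space UNIV)" for j
  proof (induction j)
    case 0 show ?case unfolding k0 by measurable
  next
    case (Suc j)
    note Suc[measurable]
    show ?case unfolding kS by measurable
  qed
  have L: "limsup (\<lambda>k. ereal (g k t)) = ereal (L t)" if t: "t \<in> space M" for t
  proof -
    obtain B where B: "\<And>k. \<bar>g k t\<bar> \<le> B" using bdd[OF t] by (auto simp: bounded_iff)
    have "limsup (\<lambda>k. ereal (g k t)) \<le> ereal B"
      by (rule Limsup_bounded) (use B in \<open>auto simp: abs_le_iff\<close>)
    moreover have "ereal (- B) \<le> limsup (\<lambda>k. ereal (g k t))"
    proof (rule order_trans[OF Liminf_bounded Liminf_le_Limsup])
      show "\<forall>\<^sub>F k in sequentially. ereal (- B) \<le> ereal (g k t)"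
        using B by (intro always_eventually allI) (simp add: abs_le_iff minus_le_iff)
    qed auto
    ultimately show ?thesis
      unfolding L_def by (cases "limsup (\<lambda>k. ereal (g k t))") auto
  qed
  have ex: "\<exists>i>n. \<bar>g i t - L t\<bar> < e" if t: "t \<in> space M" and e: "e > 0" for t n e
  proof -
    obtain r where r: "strict_mono r" "((\<lambda>k. ereal (g k t)) \<circ> r) \<longlonglongrightarrow> limsup (\<lambda>k. ereal (g k t))"
      using limsup_subseq_lim by blast
    from r(2) have "(\<lambda>k. g (r k) t) \<longlonglongrightarrow> L t" by (simp add: o_def L[OF t])
    then have "\<forall>\<^sub>F k in sequentially. dist (g (r k) t) (L t) < e" using e by (rule tendstoD)
    then obtain N where N: "\<And>k. k \<ge> N \<Longrightarrow> \<bar>g (r k) t - L t\<bar> < e"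
      by (auto simp: eventually_sequentially dist_real_def)
    have "r (max N (Suc n)) > n"
      using seq_suble[OF r(1), of "max N (Suc n)"] by linarith
    with N[of "max N (Suc n)"] show ?thesis by auto
  qed
  have step: "\<kappa> j t < \<kappa> (Suc j) t \<and> \<bar>g (\<kappa> (Suc j) t) t - L t\<bar> < 1 / Suc (Suc j)"
    if t: "t \<in> space M" for j t
    unfolding kS using ex[OF t, of "1 / Suc (Suc j)" "\<kappa> j t"] by - (rule LeastI_ex, simp)
  show ?thesis
  proof (rule that[of \<kappa> L, OF meas])
    show "L \<in> borel_measurable M" by measurable
  next
    fix t assume t: "t \<in> space M"
    show "strict_mono (\<lambda>j. \<kappa> j t)" using step[OF t] by (simp add: strict_mono_Suc_iff)
    have "(\<lambda>j. g (\<kappa> (Suc j) t) t) \<longlonglongrightarrow> L t"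
    proof (rule Lim_null_comparison[THEN Lim_null[THEN iffD2]])
      show "\<forall>\<^sub>F j in sequentially. norm (g (\<kappa> (Suc j) t) t - L t) \<le> 1 / Suc (Suc j)"
        using step[OF t] by (intro always_eventually allI) (simp add: less_imp_le)
      show "(\<lambda>j. 1 / real (Suc (Suc j))) \<longlonglongrightarrow> 0"
        by (rule LIMSEQ_Suc[OF inverse_Suc_tendsto_zero])
    qed
    then show "(\<lambda>j. g (\<kappa> j t) t) \<longlonglongrightarrow> L t" by (rule LIMSEQ_imp_Suc)
    fix e :: real assume "0 < e"
    then have "limsup (\<lambda>k. ereal (g k t)) < ereal (L t + e)" by (simp add: L[OF t])
    from Limsup_lessD[OF this] show "\<forall>\<^sub>F k in sequentially. g k t < L t + e" by simp
  qed
qed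

text \<open>The coordinates are treated one at a time. Composing with a further index function
  preserves convergence in the coordinates already settled, and a measurable index inserted into a
  countable family stays measurable.\<close>

lemma random_subsequence:
  fixes f :: "nat \<Rightarrow> 't \<Rightarrow> 'a::euclidean_space"
  assumes f[measurable]: "\<And>k. f k \<in> borel_measurable M"
    and bdd: "\<And>t. t \<in> space M \<Longrightarrow> bounded (range (\<lambda>k. f k t))"
  obtains \<kappa> where "\<And>j::nat. \<kappa> j \<in> measurable M (count_space UNIV)"
    "\<And>t. t \<in> space M \<Longrightarrow> strict_mono (\<lambda>j. \<kappa> j t)"
    "\<And>t. t \<in> space M \<Longrightarrow> convergent (\<lambda>j. f (\<kappa> j t) t)"
proof -
  have "\<exists>\<kappa>. (\<forall>j::nat. \<kappa> j \<in> measurable M (count_space UNIV)) \<and>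
      (\<forall>t\<in>space M. strict_mono (\<lambda>j. \<kappa> j t) \<and> (\<forall>b\<in>B. convergent (\<lambda>j. f (\<kappa> j t) t \<bullet> b)))"
    if "finite B" for B :: "'a set"
    using that
  proof (induction B rule: finite_induct)
    case empty
    show ?case by (rule exI[of _ "\<lambda>j t. j"]) (auto simp: strict_mono_def)
  next
    case (insert b B)
    then obtain \<kappa> where \<kappa>[measurable]: "\<And>j::nat. \<kappa> j \<in> measurable M (count_space UNIV)"
      and mono: "\<And>t. t \<in> space M \<Longrightarrow> strict_mono (\<lambda>j. \<kappa> j t)"
      and conv: "\<And>t b. t \<in> space M \<Longrightarrow> b \<in> B \<Longrightarrow> convergent (\<lambda>j. f (\<kappa> j t) t \<bullet> b)"
      by blast
    have m: "(\<lambda>t. f (\<kappa> j t) t) \<in> borel_measurable M" for j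
      by (rule measurable_compose_countable[of f, OF f \<kappa>])
    have "(\<lambda>t. f (\<kappa> j t) t \<bullet> b) \<in> borel_measurable M" for j
      using m[of j] by measurable
    moreover have "bounded (range (\<lambda>j. f (\<kappa> j t) t \<bullet> b))" if t: "t \<in> space M" for t
    proof -
      obtain C where C: "\<And>k. norm (f k t) \<le> C" using bdd[OF t] by (auto simp: bounded_iff)
      have "\<bar>f (\<kappa> j t) t \<bullet> b\<bar> \<le> C * norm b" for j
        using Cauchy_Schwarz_ineq2[of "f (\<kappa> j t) t" b] mult_right_mono[OF C[of "\<kappa> j t"], of "norm b"] by simp
      then show ?thesis by (auto simp: bounded_iff)
    qed
    ultimately obtain \<tau> h where \<tau>: "\<And>j::nat. \<tau> j \<in> measurable M (count_space UNIV)"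
      "\<And>t. t \<in> space M \<Longrightarrow> strict_mono (\<lambda>j. \<tau> j t)"
      "h \<in> borel_measurable M"
      "\<And>t. t \<in> space M \<Longrightarrow> (\<lambda>j. f (\<kappa> (\<tau> j t) t) t \<bullet> b) \<longlonglongrightarrow> h t"
      "\<And>t e. t \<in> space M \<Longrightarrow> 0 < e \<Longrightarrow> \<forall>\<^sub>F j in sequentially. f (\<kappa> j t) t \<bullet> b < h t + e"
      by (rule random_subsequence_real[of "\<lambda>j t. f (\<kappa> j t) t \<bullet> b" M]) (assumption, rule that)
    show ?case
    proof (intro exI[of _ "\<lambda>j t. \<kappa> (\<tau> j t) t"] conjI allI ballI)
      show "(\<lambda>t. \<kappa> (\<tau> j t) t) \<in> measurable M (count_space UNIV)" for j
        by (rule measurable_compose_countable[of \<kappa>, OF \<kappa> \<tau>(1)])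
      fix t assume t: "t \<in> space M"
      show "strict_mono (\<lambda>j. \<kappa> (\<tau> j t) t)"
        using mono[OF t] \<tau>(2)[OF t] by (auto simp: strict_mono_def)
      fix b' assume "b' \<in> insert b B"
      then show "convergent (\<lambda>j. f (\<kappa> (\<tau> j t) t) t \<bullet> b')"
      proof
        assume "b' \<in> B"
        from convergent_subseq_convergent[OF conv[OF t this] \<tau>(2)[OF t]] show ?thesis by (simp add: o_def)
      qed (use convergentI[OF \<tau>(4)[OF t]] in simp)
    qed
  qed
  from this[OF finite_Basis] obtain \<kappa> where \<kappa>: "\<And>j::nat. \<kappa> j \<in> measurable M (count_space UNIV)"
    "\<And>t. t \<in> space M \<Longrightarrow> strict_mono (\<lambda>j. \<kappa> j t)"
    "\<And>t b. t \<in> space M \<Longrightarrow> b \<in> Basis \<Longrightarrow> convergent (\<lambda>j. f (\<kappa> j t) t \<bullet> b)" by blast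
  have "convergent (\<lambda>j. f (\<kappa> j t) t)" if t: "t \<in> space M" for t
  proof -
    define l where "l b = lim (\<lambda>j. f (\<kappa> j t) t \<bullet> b)" for b
    have "(\<lambda>j. f (\<kappa> j t) t) \<longlonglongrightarrow> (\<Sum>b\<in>Basis. l b *\<^sub>R b)"
    proof (subst tendsto_componentwise_iff, rule ballI)
      fix b :: 'a assume b: "b \<in> Basis"
      then show "(\<lambda>j. f (\<kappa> j t) t \<bullet> b) \<longlonglongrightarrow> (\<Sum>b\<in>Basis. l b *\<^sub>R b) \<bullet> b"
        using \<kappa>(3)[OF t b] by (simp add: convergent_LIMSEQ_iff l_def)
    qed
    then show ?thesis by (rule convergentI)
  qed
  with \<kappa>(1,2) that show ?thesis by blast
qed

lemma dense_sequence:
  fixes K :: "'a::euclidean_space set"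
  assumes "K \<noteq> {}"
  obtains d :: "nat \<Rightarrow> 'a" where "range d \<subseteq> K" "K \<subseteq> closure (range d)"
proof -
  obtain D where D: "countable D" "D \<subseteq> K" "K \<subseteq> closure D" by (rule separable)
  then have "D \<noteq> {}" using assms by auto
  with D have "range (from_nat_into D) = D" by simp
  with D that[of "from_nat_into D"] show ?thesis by simp
qed

text \<open>Near-minimizers are picked by least index from a countable dense subset of K, hence
  measurably. A random subsequence of them converges at every t, and by continuity its limit is a
  minimizer.\<close>

lemma measurable_argmin:
  fixes F :: "'t \<Rightarrow> 'a::euclidean_space \<Rightarrow> real"
  assumes K: "compact K" "K \<noteq> {}"
    and F: "\<And>x. x \<in> K \<Longrightarrow> (\<lambda>t. F t x) \<in> borel_measurable M"
    and cont: "\<And>t. t \<in> space M \<Longrightarrow> continuous_on K (F t)"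
  obtains u where "u \<in> borel_measurable M" "\<And>t. t \<in> space M \<Longrightarrow> u t \<in> K"
    "\<And>t x. t \<in> space M \<Longrightarrow> x \<in> K \<Longrightarrow> F t (u t) \<le> F t x"
proof -
  obtain d :: "nat \<Rightarrow> 'a" where "range d \<subseteq> K" and dense: "K \<subseteq> closure (range d)" by (rule dense_sequence[OF K(2)])
  then have d: "d i \<in> K" for i by auto
  have [measurable]: "(\<lambda>t. F t (d i)) \<in> borel_measurable M" for i using F d by auto
  \<comment> \<open>An infimum over the countable dense set is measurable, and by continuity of
    \<open>F t\<close> it is a lower bound on all of K.\<close>
  define m where "m t = (INF i. F t (d i))" for t
  have bdd: "bdd_below (range (\<lambda>i. F t (d i)))" if "t \<in> space M" for t
  proof -
    have "bounded (F t ` K)" using compact_continuous_image[OF cont[OF that] K(1)] compact_imp_bounded by blast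
    then have "bdd_below (F t ` K)" by (rule bounded_imp_bdd_below)
    then show ?thesis by (rule bdd_below_mono) (use d in auto)
  qed
  have [measurable]: "m \<in> borel_measurable M"
    unfolding m_def by (rule borel_measurable_cINF) (use bdd in auto)
  have m: "m t \<le> F t x" if t: "t \<in> space M" and x: "x \<in> K" for t x
  proof -
    have "closedin (top_of_set K) {y\<in>K. m t \<le> F t y}"
      using continuous_closedin_preimage[OF cont[OF t], of "{m t..}"] by (simp add: vimage_def Int_def)
    then have "closed {y\<in>K. m t \<le> F t y}"
      using K(1) closedin_closed_trans compact_imp_closed by blast
    moreover have "range d \<subseteq> {y\<in>K. m t \<le> F t y}"
      using d cINF_lower[OF bdd[OF t]] unfolding m_def by auto
    ultimately have "closure (range d) \<subseteq> {y\<in>K. m t \<le> F t y}" by (rule closure_minimal[rotated])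
    with dense x show ?thesis by auto
  qed
  define \<kappa> where "\<kappa> j t = (LEAST i. F t (d i) < m t + 1 / Suc j)" for j t
  have \<kappa>m[measurable]: "\<kappa> j \<in> measurable M (count_space UNIV)" for j
    unfolding \<kappa>_def by measurable
  have \<kappa>: "F t (d (\<kappa> j t)) < m t + 1 / Suc j" if t: "t \<in> space M" for j t
  proof -
    have "(INF i. F t (d i)) < m t + 1 / Suc j" by (simp add: m_def)
    then have "\<exists>i. F t (d i) < m t + 1 / Suc j"
      using cINF_less_iff[OF _ bdd[OF t]] by auto
    then show ?thesis unfolding \<kappa>_def by (rule LeastI_ex)
  qed
  define f where "f j t = d (\<kappa> j t)" for j t
  have f[measurable]: "f j \<in> borel_measurable M" for j
    unfolding f_def by (rule measurable_compose[OF \<kappa>m]) simp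
  have fK: "f j t \<in> K" for j t unfolding f_def by (rule d)
  obtain \<tau> where \<tau>[measurable]: "\<And>j::nat. \<tau> j \<in> measurable M (count_space UNIV)"
    and mono: "\<And>t. t \<in> space M \<Longrightarrow> strict_mono (\<lambda>j. \<tau> j t)"
    and conv: "\<And>t. t \<in> space M \<Longrightarrow> convergent (\<lambda>j. f (\<tau> j t) t)"
  proof (rule random_subsequence[of f M])
    show "bounded (range (\<lambda>k. f k t))" for t
      using compact_imp_bounded[OF K(1)] by (rule bounded_subset) (use fK in auto)
  qed auto
  define u where "u t = lim (\<lambda>j. f (\<tau> j t) t)" for t
  have lim: "(\<lambda>j. f (\<tau> j t) t) \<longlonglongrightarrow> u t" if "t \<in> space M" for t
    using conv[OF that] by (simp add: u_def convergent_LIMSEQ_iff)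
  have m1: "(\<lambda>t. f (\<tau> j t) t) \<in> borel_measurable M" for j
    by (rule measurable_compose_countable[of f, OF f \<tau>])
  have uK: "u t \<in> K" if "t \<in> space M" for t
    using closed_sequentially[OF compact_imp_closed[OF K(1)] _ lim[OF that]] fK by blast
  show ?thesis
  proof (rule that[of u])
    show "u \<in> borel_measurable M"
      using m1 lim by (rule borel_measurable_LIMSEQ_metric)
    show "u t \<in> K" if "t \<in> space M" for t by (rule uK[OF that])
    fix t x assume t: "t \<in> space M" and x: "x \<in> K"
    have "(\<lambda>j. F t (f (\<tau> j t) t)) \<longlonglongrightarrow> F t (u t)"
      by (rule continuous_on_tendsto_compose[OF cont[OF t] lim[OF t] uK[OF t]]) (use fK in auto)
    moreover have "(\<lambda>j. m t + 1 / Suc (\<tau> j t)) \<longlonglongrightarrow> m t + 0"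
    proof (intro tendsto_intros)
      from LIMSEQ_subseq_LIMSEQ[OF inverse_Suc_tendsto_zero mono[OF t]] show "(\<lambda>j. 1 / real (Suc (\<tau> j t))) \<longlonglongrightarrow> 0"
        by (simp add: o_def)
    qed
    ultimately have "F t (u t) \<le> m t + 0"
      by (rule LIMSEQ_le) (use \<kappa>[OF t] in \<open>auto simp: f_def intro: less_imp_le\<close>)
    then show "F t (u t) \<le> F t x" using m[OF t x] by simp
  qed
qed

section \<open>Fatou's lemma in several dimensions\<close>

locale dominated_sequence = finite_measure M for M :: "'t measure" +
  fixes \<zeta> :: "nat \<Rightarrow> 't \<Rightarrow> 'a::euclidean_space" and L :: "'t \<Rightarrow> real"
  assumes \<zeta>_measurable[measurable]: "\<And>k. \<zeta> k \<in> borel_measurable M"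
    and \<zeta>_bound: "\<And>k t. t \<in> space M \<Longrightarrow> norm (\<zeta> k t) \<le> L t"
    and L_integrable: "integrable M L"
begin

definition late :: "nat \<Rightarrow> ('t \<Rightarrow> nat) set" where
  "late N = {\<kappa> \<in> measurable M (count_space UNIV). \<forall>t\<in>space M. N \<le> \<kappa> t}"

definition at_index :: "('t \<Rightarrow> nat) \<Rightarrow> 't \<Rightarrow> 'a" where
  "at_index \<kappa> t = \<zeta> (\<kappa> t) t"

text \<open>The limits of integrals along measurable choices of ever later indices. This set stands
  in for the integral of the pointwise cluster sets; in this form closedness is immediate and
  convexity follows from mixing.\<close>

definition limit_integrals :: "'a set" where
  "limit_integrals = (\<Inter>N. closure ((\<lambda>\<kappa>. integral\<^sup>L M (at_index \<kappa>)) ` late N))"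

lemma late_mono: "N \<le> N' \<Longrightarrow> late N' \<subseteq> late N"
  unfolding late_def by (auto intro: order_trans)

lemma L_measurable[measurable]: "L \<in> borel_measurable M"
  using L_integrable by auto

lemma L_nonneg: "t \<in> space M \<Longrightarrow> 0 \<le> L t"
  using \<zeta>_bound[of t 0] norm_ge_zero order_trans by blast

lemma at_index_measurable:
  "\<kappa> \<in> measurable M (count_space UNIV) \<Longrightarrow> at_index \<kappa> \<in> borel_measurable M"
  unfolding at_index_def by (rule measurable_compose_countable[of \<zeta>, OF \<zeta>_measurable])

lemma late_measurable[measurable_dest]: "\<kappa> \<in> late N \<Longrightarrow> \<kappa> \<in> measurable M (count_space UNIV)"
  by (simp add: late_def)

lemma at_index_bound: "t \<in> space M \<Longrightarrow> norm (at_index \<kappa> t) \<le> L t"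
  unfolding at_index_def by (rule \<zeta>_bound)

lemma at_index_diff_bound: "t \<in> space M \<Longrightarrow> norm (at_index \<kappa> t - at_index \<kappa>' t) \<le> 2 * L t"
  using norm_triangle_ineq4[of "at_index \<kappa> t" "at_index \<kappa>' t"]
    at_index_bound[of t \<kappa>] at_index_bound[of t \<kappa>'] by linarith

lemma at_index_integrable:
  assumes "\<kappa> \<in> late N" shows "integrable M (at_index \<kappa>)"
  by (rule Bochner_Integration.integrable_bound[OF L_integrable])
    (use at_index_measurable[OF late_measurable[OF assms]] at_index_bound L_nonneg in \<open>auto intro!: AE_I2\<close>)

lemma integral_at_index_bound: "\<kappa> \<in> late N \<Longrightarrow> norm (integral\<^sup>L M (at_index \<kappa>)) \<le> integral\<^sup>L M L"
  using at_index_bound L_integrable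
  by (intro order_trans[OF integral_norm_bound] integral_mono) (auto intro: at_index_integrable)

lemma late_mixing:
  assumes M: "atomless M" and \<kappa>: "\<kappa>1 \<in> late N" "\<kappa>2 \<in> late N" and \<theta>: "0 \<le> \<theta>" "\<theta> \<le> 1" and e: "0 < e"
  obtains \<kappa> where "\<kappa> \<in> late N"
    "norm (integral\<^sup>L M (at_index \<kappa>)
       - ((1 - \<theta>) *\<^sub>R integral\<^sup>L M (at_index \<kappa>1) + \<theta> *\<^sub>R integral\<^sup>L M (at_index \<kappa>2))) < e"
    "(\<integral>t. norm (at_index \<kappa> t - at_index \<kappa>1 t) \<partial>M) \<le> 2 * \<theta> * integral\<^sup>L M L + e"
proof -
  note [measurable] = late_measurable[OF \<kappa>(1)] late_measurable[OF \<kappa>(2)]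
    at_index_measurable[OF late_measurable[OF \<kappa>(1)]] at_index_measurable[OF late_measurable[OF \<kappa>(2)]]
  note int = at_index_integrable[OF \<kappa>(1)] at_index_integrable[OF \<kappa>(2)]
  \<comment> \<open>The second component dominates the norm of the first, so a single set S controls
    both the integral and the L1 distance to \<open>at_index \<kappa>1\<close>.\<close>
  define f where "f t = (at_index \<kappa>2 t - at_index \<kappa>1 t, 2 * L t)" for t
  have f: "integrable M f"
  proof (rule Bochner_Integration.integrable_bound[of _ "\<lambda>t. 4 * L t"])
    show "integrable M (\<lambda>t. 4 * L t)" using L_integrable by simp
    show "f \<in> borel_measurable M" unfolding f_def by measurable
    show "AE t in M. norm (f t) \<le> norm (4 * L t)"
    proof (rule AE_I2)
      fix t assume t: "t \<in> space M"
      have "norm (f t) \<le> norm (at_index \<kappa>2 t - at_index \<kappa>1 t) + norm (2 * L t)"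
        unfolding f_def by (rule norm_Pair_le)
      also have "norm (at_index \<kappa>2 t - at_index \<kappa>1 t) \<le> L t + L t"
        using at_index_diff_bound[OF t, of \<kappa>2 \<kappa>1] by simp
      finally show "norm (f t) \<le> norm (4 * L t)" using L_nonneg[OF t] by simp
    qed
  qed
  obtain S where S[measurable]: "S \<in> sets M"
    and less: "norm ((\<integral>t. indicator S t *\<^sub>R f t \<partial>M) - \<theta> *\<^sub>R (\<integral>t. f t \<partial>M)) < e"
    by (rule atomless_mixing[OF M f \<theta> e])
  have fS: "integrable M (\<lambda>t. indicator S t *\<^sub>R f t)"
    using f by (rule integrable_mult_indicator[OF S])
  define \<kappa> where "\<kappa> t = (if t \<in> S then \<kappa>2 t else \<kappa>1 t)" for t
  have k: "\<kappa> \<in> late N"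
    using \<kappa> unfolding late_def \<kappa>_def by auto
  note [measurable] = at_index_measurable[OF late_measurable[OF k]]
  have diff: "at_index \<kappa> t - at_index \<kappa>1 t = indicator S t *\<^sub>R fst (f t)" for t
    by (auto simp: at_index_def \<kappa>_def f_def)
  have fst: "(\<integral>t. fst (f t) \<partial>M) = fst (\<integral>t. f t \<partial>M)" "(\<integral>t. snd (f t) \<partial>M) = snd (\<integral>t. f t \<partial>M)"
    "(\<integral>t. indicator S t *\<^sub>R fst (f t) \<partial>M) = fst (\<integral>t. indicator S t *\<^sub>R f t \<partial>M)"
    "(\<integral>t. indicator S t *\<^sub>R snd (f t) \<partial>M) = snd (\<integral>t. indicator S t *\<^sub>R f t \<partial>M)"
    using integral_bounded_linear[OF bounded_linear_fst f] integral_bounded_linear[OF bounded_linear_snd f]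
     integral_bounded_linear[OF bounded_linear_fst fS] integral_bounded_linear[OF bounded_linear_snd fS] by simp_all
  have norm_le: "norm (fst v) \<le> norm v" "norm (snd v) \<le> norm v" for v :: "'a \<times> real"
    using norm_fst_le[of "fst v" "snd v"] norm_snd_le[of "snd v" "fst v"] by simp_all
  have "norm ((\<integral>t. indicator S t *\<^sub>R fst (f t) \<partial>M) - \<theta> *\<^sub>R (\<integral>t. fst (f t) \<partial>M)) < e"
    unfolding fst using order_le_less_trans[OF norm_le(1) less] by simp
  moreover have "(\<integral>t. indicator S t *\<^sub>R fst (f t) \<partial>M) = integral\<^sup>L M (at_index \<kappa>) - integral\<^sup>L M (at_index \<kappa>1)"
    unfolding diff[symmetric] using int(1) at_index_integrable[OF k] by simp
  moreover have "(\<integral>t. fst (f t) \<partial>M) = integral\<^sup>L M (at_index \<kappa>2) - integral\<^sup>L M (at_index \<kappa>1)"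
    unfolding f_def using int by simp
  ultimately have 1: "norm (integral\<^sup>L M (at_index \<kappa>)
       - ((1 - \<theta>) *\<^sub>R integral\<^sup>L M (at_index \<kappa>1) + \<theta> *\<^sub>R integral\<^sup>L M (at_index \<kappa>2))) < e"
    by (simp add: algebra_simps)
  have "norm ((\<integral>t. indicator S t *\<^sub>R snd (f t) \<partial>M) - \<theta> *\<^sub>R (\<integral>t. snd (f t) \<partial>M)) < e"
    unfolding fst using order_le_less_trans[OF norm_le(2) less] by simp
  then have "(\<integral>t. indicator S t *\<^sub>R snd (f t) \<partial>M) \<le> \<theta> * (\<integral>t. snd (f t) \<partial>M) + e"
    by (simp add: abs_less_iff)
  also have "(\<integral>t. snd (f t) \<partial>M) = 2 * integral\<^sup>L M L" by (simp add: f_def)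
  finally have 2: "(\<integral>t. indicator S t *\<^sub>R snd (f t) \<partial>M) \<le> 2 * \<theta> * integral\<^sup>L M L + e" by simp
  have "(\<integral>t. norm (at_index \<kappa> t - at_index \<kappa>1 t) \<partial>M) \<le> (\<integral>t. indicator S t *\<^sub>R snd (f t) \<partial>M)"
  proof (rule integral_mono)
    show "integrable M (\<lambda>t. norm (at_index \<kappa> t - at_index \<kappa>1 t))"
      using int(1) at_index_integrable[OF k] by simp
    show "integrable M (\<lambda>t. indicator S t *\<^sub>R snd (f t))"
      using integrable_bounded_linear[OF bounded_linear_snd fS] by simp
    fix t assume t: "t \<in> space M"
    have "norm (at_index \<kappa>2 t - at_index \<kappa>1 t) \<le> L t + L t"
      using at_index_diff_bound[OF t, of \<kappa>2 \<kappa>1] by simp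
    then show "norm (at_index \<kappa> t - at_index \<kappa>1 t) \<le> indicator S t *\<^sub>R snd (f t)"
      unfolding diff by (auto simp: f_def indicator_def)
  qed
  from k 1 order_trans[OF this 2] show ?thesis by (rule that)
qed

text \<open>Switching between two late index functions on a suitable set yields another late one.
  The mixing is only approximate, which the closure absorbs.\<close>

lemma convex_limit_integrals:
  assumes M: "atomless M" shows "convex limit_integrals"
  unfolding limit_integrals_def
proof (rule convex_INT, rule convexI)
  fix N x y and u v :: real
  let ?I = "\<lambda>\<kappa>. integral\<^sup>L M (at_index \<kappa>)"
  assume xy: "x \<in> closure (?I ` late N)" "y \<in> closure (?I ` late N)" and uv: "0 \<le> u" "0 \<le> v" "u + v = 1"
  show "u *\<^sub>R x + v *\<^sub>R y \<in> closure (?I ` late N)"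
  proof (subst closure_approachable, intro allI impI)
    fix e :: real assume e: "0 < e"
    obtain \<kappa>1 where k1: "\<kappa>1 \<in> late N" "norm (?I \<kappa>1 - x) < e / 2"
      using xy(1) e unfolding closure_approachable by (auto simp: dist_norm dest!: spec[of _ "e/2"])
    obtain \<kappa>2 where k2: "\<kappa>2 \<in> late N" "norm (?I \<kappa>2 - y) < e / 2"
      using xy(2) e unfolding closure_approachable by (auto simp: dist_norm dest!: spec[of _ "e/2"])
    obtain \<kappa> where k: "\<kappa> \<in> late N" "norm (?I \<kappa> - ((1 - v) *\<^sub>R ?I \<kappa>1 + v *\<^sub>R ?I \<kappa>2)) < e / 2"
      by (rule late_mixing[OF M k1(1) k2(1), of v "e/2"]) (use uv e in auto)
    have u: "1 - v = u" using uv by simp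
    have "norm (u *\<^sub>R (?I \<kappa>1 - x) + v *\<^sub>R (?I \<kappa>2 - y)) \<le> u * norm (?I \<kappa>1 - x) + v * norm (?I \<kappa>2 - y)"
      using norm_triangle_ineq[of "u *\<^sub>R (?I \<kappa>1 - x)" "v *\<^sub>R (?I \<kappa>2 - y)"] uv by simp
    also have "\<dots> \<le> u * (e/2) + v * (e/2)"
      using k1(2) k2(2) uv by (intro add_mono mult_left_mono) auto
    also have "\<dots> = e / 2" using uv by (simp flip: distrib_right)
    finally have "norm (u *\<^sub>R (?I \<kappa>1 - x) + v *\<^sub>R (?I \<kappa>2 - y)) \<le> e / 2" .
    moreover have "norm (?I \<kappa> - (u *\<^sub>R x + v *\<^sub>R y)) = norm ((?I \<kappa> - (u *\<^sub>R ?I \<kappa>1 + v *\<^sub>R ?I \<kappa>2)) + (u *\<^sub>R (?I \<kappa>1 - x) + v *\<^sub>R (?I \<kappa>2 - y)))"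
      by (simp add: algebra_simps)
    ultimately have "norm (?I \<kappa> - (u *\<^sub>R x + v *\<^sub>R y)) < e"
      using k(2)[unfolded u] norm_triangle_ineq[of "?I \<kappa> - (u *\<^sub>R ?I \<kappa>1 + v *\<^sub>R ?I \<kappa>2)" "u *\<^sub>R (?I \<kappa>1 - x) + v *\<^sub>R (?I \<kappa>2 - y)"]
      by linarith
    with k(1) show "\<exists>y'\<in>?I ` late N. dist y' (u *\<^sub>R x + v *\<^sub>R y) < e"
      by (auto simp: dist_norm)
  qed
qed

lemma integral_at_index_late_convergent:
  assumes "\<And>j. \<kappa> j \<in> late j"
  obtains r x where "strict_mono r" "(\<lambda>j. integral\<^sup>L M (at_index (\<kappa> (r j)))) \<longlonglongrightarrow> x" "x \<in> limit_integrals"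
proof -
  let ?I = "\<lambda>\<kappa>. integral\<^sup>L M (at_index \<kappa>)"
  have "bounded (range (\<lambda>j. ?I (\<kappa> j)))"
    using integral_at_index_bound[OF assms] by (auto simp: bounded_iff)
  then obtain x r where r: "strict_mono r" "((\<lambda>j. ?I (\<kappa> j)) \<circ> r) \<longlonglongrightarrow> x"
    using bounded_imp_convergent_subsequence by blast
  have "x \<in> closure (?I ` late N)" for N
  proof (rule Lim_in_closed_set[OF closed_closure _ _ r(2)])
    show "\<forall>\<^sub>F j in sequentially. ((\<lambda>j. ?I (\<kappa> j)) \<circ> r) j \<in> closure (?I ` late N)"
      using eventually_ge_at_top[of N]
    proof eventually_elim
      case (elim j)
      have "\<kappa> (r j) \<in> late N" using assms[of "r j"] late_mono[of N "r j"] elim seq_suble[OF r(1), of j] by auto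
      then have "?I (\<kappa> (r j)) \<in> ?I ` late N" by blast
      then show ?case unfolding o_def by (rule subsetD[OF closure_subset])
    qed
  qed simp
  with r that show ?thesis by (auto simp: limit_integrals_def o_def)
qed

lemma limit_in_limit_integrals:
  assumes "(\<lambda>k. integral\<^sup>L M (\<zeta> k)) \<longlonglongrightarrow> z" shows "z \<in> limit_integrals"
proof -
  have k: "(\<lambda>t. j) \<in> late j" for j :: nat by (simp add: late_def)
  obtain r x where rx: "strict_mono r" "(\<lambda>j. integral\<^sup>L M (at_index (\<lambda>t. r j))) \<longlonglongrightarrow> x" "x \<in> limit_integrals"
    using integral_at_index_late_convergent[of "\<lambda>j t. j", OF k] by blast
  have "(\<lambda>j. integral\<^sup>L M (at_index (\<lambda>t. r j))) \<longlonglongrightarrow> z"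
    using LIMSEQ_subseq_LIMSEQ[OF assms rx(1)] by (simp add: at_index_def[abs_def] o_def)
  with rx show ?thesis using LIMSEQ_unique by metis
qed

text \<open>In a direction in which \<open>limit_integrals\<close> is supported at \<open>z\<close>, the sequence converges to its
  pointwise upper limit, because the integral of the upper limit is attained on \<open>limit_integrals\<close>.\<close>

lemma supported_direction_converges:
  assumes z: "(\<lambda>k. integral\<^sup>L M (\<zeta> k)) \<longlonglongrightarrow> z"
    and p: "\<And>r. r \<in> limit_integrals \<Longrightarrow> p \<bullet> r \<le> p \<bullet> z"
  obtains s where "strict_mono (s :: nat \<Rightarrow> nat)" "AE t in M. convergent (\<lambda>k. p \<bullet> \<zeta> (s k) t)"
proof -
  define g where "g k t = p \<bullet> \<zeta> k t" for k t
  have g[measurable]: "g k \<in> borel_measurable M" for k unfolding g_def by measurable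
  define B where "B t = norm p * L t" for t
  have B: "\<bar>g k t\<bar> \<le> B t" if "t \<in> space M" for k t
    unfolding g_def B_def
    using Cauchy_Schwarz_ineq2[of p "\<zeta> k t"] mult_left_mono[OF \<zeta>_bound[OF that, of k], of "norm p"] by simp
  have Bi: "integrable M B" unfolding B_def using L_integrable by simp
  have bdd: "bounded (range (\<lambda>k. g k t))" if "t \<in> space M" for t
    using B[OF that] by (auto simp: bounded_iff)
  obtain \<kappa> h where \<kappa>: "\<And>j::nat. \<kappa> j \<in> measurable M (count_space UNIV)"
    "\<And>t. t \<in> space M \<Longrightarrow> strict_mono (\<lambda>j. \<kappa> j t)"
    and h[measurable]: "h \<in> borel_measurable M"
    and lim: "\<And>t. t \<in> space M \<Longrightarrow> (\<lambda>j. g (\<kappa> j t) t) \<longlonglongrightarrow> h t"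
    and ub: "\<And>t e. t \<in> space M \<Longrightarrow> 0 < e \<Longrightarrow> \<forall>\<^sub>F k in sequentially. g k t < h t + e"
    by (rule random_subsequence_real[of g M, OF g bdd]) (assumption, rule that)
  have late: "\<kappa> j \<in> late j" for j
    unfolding late_def using \<kappa> seq_suble by blast
  have hB: "\<bar>h t\<bar> \<le> B t" if "t \<in> space M" for t
    by (rule LIMSEQ_le_const2[OF tendsto_rabs[OF lim[OF that]]]) (use B[OF that] in auto)
  have hi: "integrable M h"
    by (rule Bochner_Integration.integrable_bound[OF Bi h AE_I2]) (use order_trans[OF hB abs_ge_self] in simp)
  have gi: "integrable M (g k)" for k
    by (rule Bochner_Integration.integrable_bound[OF Bi g AE_I2]) (use order_trans[OF B abs_ge_self] in simp)
  have "(\<lambda>j. \<integral>t. p \<bullet> at_index (\<kappa> j) t \<partial>M) \<longlonglongrightarrow> (\<integral>t. h t \<partial>M)"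
  proof (rule integral_dominated_convergence[OF _ _ Bi])
    show "(\<lambda>t. p \<bullet> at_index (\<kappa> j) t) \<in> borel_measurable M" for j
      using at_index_measurable[OF \<kappa>(1)[of j]] by measurable
    show "AE t in M. (\<lambda>j. p \<bullet> at_index (\<kappa> j) t) \<longlonglongrightarrow> h t"
      using lim by (intro AE_I2) (simp add: g_def at_index_def)
    show "AE t in M. norm (p \<bullet> at_index (\<kappa> j) t) \<le> B t" for j
      using B by (intro AE_I2) (simp add: g_def at_index_def)
  qed simp
  then have lim1: "(\<lambda>j. p \<bullet> integral\<^sup>L M (at_index (\<kappa> j))) \<longlonglongrightarrow> integral\<^sup>L M h"
    using at_index_integrable[OF late] by simp
  obtain r x where rx: "strict_mono r" "(\<lambda>j. integral\<^sup>L M (at_index (\<kappa> (r j)))) \<longlonglongrightarrow> x" "x \<in> limit_integrals"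
    by (rule integral_at_index_late_convergent[of \<kappa>, OF late])
  have "(\<lambda>j. p \<bullet> integral\<^sup>L M (at_index (\<kappa> (r j)))) \<longlonglongrightarrow> p \<bullet> x"
    by (intro tendsto_intros rx(2))
  moreover have "(\<lambda>j. p \<bullet> integral\<^sup>L M (at_index (\<kappa> (r j)))) \<longlonglongrightarrow> integral\<^sup>L M h"
    using LIMSEQ_subseq_LIMSEQ[OF lim1 rx(1)] by (simp add: o_def)
  \<comment> \<open>The integral of the upper limit h equals p \<bullet> x for some x in
    \<open>limit_integrals\<close>. By the support assumption it does not exceed p \<bullet> z, the
    limit of the integrals of g.\<close>
  ultimately have hz: "integral\<^sup>L M h \<le> p \<bullet> z" using p[OF rx(3)] LIMSEQ_unique by metis
  have lim2: "(\<lambda>k. integral\<^sup>L M (g k)) \<longlonglongrightarrow> p \<bullet> z"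
  proof -
    have "integrable M (\<zeta> k)" for k
      using at_index_integrable[of "\<lambda>_. k" 0] by (simp add: late_def at_index_def[abs_def])
    then have "integral\<^sup>L M (g k) = p \<bullet> integral\<^sup>L M (\<zeta> k)" for k by (simp add: g_def[abs_def])
    then show ?thesis using tendsto_inner[OF tendsto_const z] by simp
  qed
  have lim3: "(\<lambda>k. \<integral>t. max 0 (g k t - h t) \<partial>M) \<longlonglongrightarrow> (\<integral>t. 0 \<partial>M)"
  proof (rule integral_dominated_convergence)
    show "integrable M (\<lambda>t. 2 * B t)" using Bi by simp
    show "AE t in M. (\<lambda>k. max 0 (g k t - h t)) \<longlonglongrightarrow> 0"
    proof (rule AE_I2, rule tendstoI)
      fix t e assume "t \<in> space M" "0 < (e::real)"
      from ub[OF this] show "\<forall>\<^sub>F k in sequentially. dist (max 0 (g k t - h t)) 0 < e"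
        by eventually_elim (use \<open>0 < e\<close> in \<open>auto simp: dist_real_def\<close>)
    qed
    show "AE t in M. norm (max 0 (g k t - h t)) \<le> 2 * B t" for k
      using B[of _ k] hB by (intro AE_I2) (smt (verit) real_norm_def)
  qed auto
  have int3: "integrable M (\<lambda>t. max 0 (g k t - h t))" for k
    using gi hi by (intro integrable_max) auto
  have "(\<lambda>k. \<integral>t. norm (g k t - h t) \<partial>M) \<longlonglongrightarrow> 0"
  proof (rule tendsto_sandwich[OF _ _ tendsto_const])
    show "\<forall>\<^sub>F k in sequentially. 0 \<le> (\<integral>t. norm (g k t - h t) \<partial>M)"
      by (intro always_eventually allI integral_nonneg_AE) simp
    have "(\<lambda>k. (p \<bullet> z - integral\<^sup>L M (g k)) + 2 * (\<integral>t. max 0 (g k t - h t) \<partial>M)) \<longlonglongrightarrow> (p \<bullet> z - p \<bullet> z) + 2 * 0"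
      using lim2 lim3 by (intro tendsto_intros) simp_all
    then show "(\<lambda>k. (p \<bullet> z - integral\<^sup>L M (g k)) + 2 * (\<integral>t. max 0 (g k t - h t) \<partial>M)) \<longlonglongrightarrow> 0" by simp
    show "\<forall>\<^sub>F k in sequentially. (\<integral>t. norm (g k t - h t) \<partial>M)
        \<le> (p \<bullet> z - integral\<^sup>L M (g k)) + 2 * (\<integral>t. max 0 (g k t - h t) \<partial>M)"
    proof (intro always_eventually allI)
      fix k
      \<comment> \<open>For real x, |x| = - x + 2 max 0 x. The excess of g over h tends to 0 in L1
        since h is the upper limit, and the remaining signed part is controlled by the integrals
        alone.\<close>
      have "(\<integral>t. norm (g k t - h t) \<partial>M) = (\<integral>t. (h t - g k t) + 2 * max 0 (g k t - h t) \<partial>M)"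
        by (rule Bochner_Integration.integral_cong) (auto simp: max_def abs_if)
      also have "\<dots> = (integral\<^sup>L M h - integral\<^sup>L M (g k)) + 2 * (\<integral>t. max 0 (g k t - h t) \<partial>M)"
        using gi hi int3 by simp
      finally show "(\<integral>t. norm (g k t - h t) \<partial>M)
        \<le> (p \<bullet> z - integral\<^sup>L M (g k)) + 2 * (\<integral>t. max 0 (g k t - h t) \<partial>M)" using hz by simp
    qed
  qed
  then obtain s where s: "strict_mono s" "AE t in M. (\<lambda>k. g (s k) t - h t) \<longlonglongrightarrow> 0"
    using tendsto_L1_AE_subseq[of M "\<lambda>k t. g k t - h t"] gi hi by auto
  from s(2) have "AE t in M. convergent (\<lambda>k. p \<bullet> \<zeta> (s k) t)"
  proof eventually_elim
    case (elim t)
    then show ?case unfolding g_def by (intro convergentI[OF LIM_zero_cancel])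
  qed
  with s(1) that show ?thesis by blast
qed

text \<open>At a settled point every value with index at least N can be replaced, within e, by a
  value of arbitrarily late index. This is what allows indices to be pushed to infinity at a small
  L1 cost.\<close>

definition settled :: "real \<Rightarrow> nat \<Rightarrow> 't set" where
  "settled e N = {t\<in>space M. \<forall>k\<ge>N. \<forall>m. \<exists>k'\<ge>m. norm (\<zeta> k t - \<zeta> k' t) \<le> e}"

lemma settled_measurable[measurable]: "settled e N \<in> sets M"
  unfolding settled_def by measurable

text \<open>If infinitely many indices failed, their values would have a convergent subsequence. Its
  late members are close to each other, although each failing value stays farther than e from all
  sufficiently late ones.\<close>

lemma eventually_settled:
  assumes t: "t \<in> space M" and e: "0 < e"
  shows "\<forall>\<^sub>F N in sequentially. t \<in> settled e N"
proof -
  define Bad where "Bad = {k. \<exists>m. \<forall>k'\<ge>m. e < norm (\<zeta> k t - \<zeta> k' t)}"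
  have "finite Bad"
  proof (rule ccontr)
    assume "infinite Bad"
    define r where "r = enumerate Bad"
    have r: "strict_mono r" "\<And>j. r j \<in> Bad"
      using \<open>infinite Bad\<close> by (auto simp: r_def strict_mono_enumerate enumerate_in_set)
    have "bounded (range (\<lambda>j. \<zeta> (r j) t))" using \<zeta>_bound[OF t] by (auto simp: bounded_iff)
    then obtain l s where s: "strict_mono s" "((\<lambda>j. \<zeta> (r j) t) \<circ> s) \<longlonglongrightarrow> l"
      using bounded_imp_convergent_subsequence by blast
    have "\<forall>\<^sub>F j in sequentially. dist (((\<lambda>j. \<zeta> (r j) t) \<circ> s) j) l < e / 2"
      using s(2) by (rule tendstoD) (use e in simp)
    then obtain J where J: "\<And>j. j \<ge> J \<Longrightarrow> norm (\<zeta> (r (s j)) t - l) < e / 2"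
      by (auto simp: eventually_sequentially dist_norm)
    obtain m where m: "\<And>k'. k' \<ge> m \<Longrightarrow> e < norm (\<zeta> (r (s J)) t - \<zeta> k' t)"
      using r(2)[of "s J"] by (auto simp: Bad_def)
    let ?j = "max J m"
    have "m \<le> r (s ?j)"
      using seq_suble[OF s(1), of ?j] seq_suble[OF r(1), of "s ?j"] by linarith
    from m[OF this] have "e < norm ((\<zeta> (r (s J)) t - l) - (\<zeta> (r (s ?j)) t - l))" by simp
    also have "\<dots> \<le> norm (\<zeta> (r (s J)) t - l) + norm (\<zeta> (r (s ?j)) t - l)" by (rule norm_triangle_ineq4)
    also have "\<dots> < e" using J[of J] J[of ?j] by simp
    finally show False .
  qed
  then obtain N where N: "\<And>k. k \<in> Bad \<Longrightarrow> k < N"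
    by (auto simp: finite_nat_set_iff_bounded)
  show ?thesis
    using eventually_ge_at_top[of N]
  proof eventually_elim
    case (elim n)
    have "k \<notin> Bad" if "k \<ge> n" for k using N[of k] elim that by auto
    then show ?case using t by (auto simp: settled_def Bad_def not_less)
  qed
qed

lemma small_integral_unsettled:
  assumes e: "0 < e"
  obtains N where "(\<integral>t. indicator (space M - settled e N) t *\<^sub>R (2 * L t) \<partial>M) \<le> e"
proof -
  have "(\<lambda>N. \<integral>t. indicator (space M - settled e N) t *\<^sub>R (2 * L t) \<partial>M) \<longlonglongrightarrow> (\<integral>t. 0 \<partial>M)"
  proof (rule integral_dominated_convergence)
    show "integrable M (\<lambda>t. 2 * L t)" using L_integrable by simp
    show "AE t in M. (\<lambda>N. indicator (space M - settled e N) t *\<^sub>R (2 * L t)) \<longlonglongrightarrow> 0"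
    proof (rule AE_I2, rule tendsto_eventually)
      fix t assume "t \<in> space M"
      from eventually_settled[OF this e]
      show "\<forall>\<^sub>F N in sequentially. indicator (space M - settled e N) t *\<^sub>R (2 * L t) = 0"
        by eventually_elim simp
    qed
    show "AE t in M. norm (indicator (space M - settled e N) t *\<^sub>R (2 * L t)) \<le> 2 * L t" for N
      using L_nonneg by (intro AE_I2) (auto simp: indicator_def)
  qed measurable
  then have "\<forall>\<^sub>F N in sequentially. (\<integral>t. indicator (space M - settled e N) t *\<^sub>R (2 * L t) \<partial>M) < e"
    by (rule order_tendstoD) (use e in simp)
  then obtain N where "(\<integral>t. indicator (space M - settled e N) t *\<^sub>R (2 * L t) \<partial>M) < e"
    by (auto simp: eventually_sequentially)
  with that show ?thesis by (meson less_imp_le)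
qed

lemma late_shift:
  assumes e: "0 < e" and N: "(\<integral>t. indicator (space M - settled e N) t *\<^sub>R (2 * L t) \<partial>M) \<le> e"
    and \<kappa>: "\<kappa> \<in> late N"
  obtains \<kappa>' where "\<kappa>' \<in> late N'"
    "(\<integral>t. norm (at_index \<kappa>' t - at_index \<kappa> t) \<partial>M) \<le> e * (measure M (space M) + 1)"
proof -
  note [measurable] = late_measurable[OF \<kappa>] at_index_measurable[OF late_measurable[OF \<kappa>]]
  define P where "P t k' \<longleftrightarrow> N' \<le> k' \<and> norm (at_index \<kappa> t - \<zeta> k' t) \<le> e" for t k'
  \<comment> \<open>The default N' keeps \<kappa>' late where no replacement exists. That happens
    only at unsettled points, where the change is at most 2 L t and the total cost is at most e by
    the choice of N.\<close>
  define \<kappa>' where "\<kappa>' t = (if \<exists>k'. P t k' then LEAST k'. P t k' else N')" for t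
  have [measurable]: "\<kappa>' \<in> measurable M (count_space UNIV)" unfolding \<kappa>'_def P_def by measurable
  have P: "P t (\<kappa>' t)" if "\<exists>k'. P t k'" for t
    using that LeastI_ex[OF that] by (simp add: \<kappa>'_def)
  have late: "\<kappa>' \<in> late N'"
    unfolding late_def
  proof safe
    fix t show "N' \<le> \<kappa>' t" using P[of t] by (cases "\<exists>k'. P t k'") (auto simp: P_def \<kappa>'_def)
  qed measurable
  note [measurable] = at_index_measurable[OF late_measurable[OF late]]
  have iL: "integrable M (\<lambda>t. indicator (space M - settled e N) t *\<^sub>R (2 * L t))"
    by (rule integrable_mult_indicator) (use L_integrable in auto)
  have "(\<integral>t. norm (at_index \<kappa>' t - at_index \<kappa> t) \<partial>M) \<le> (\<integral>t. e + indicator (space M - settled e N) t *\<^sub>R (2 * L t) \<partial>M)"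
  proof (rule integral_mono)
    fix t assume t: "t \<in> space M"
    show "norm (at_index \<kappa>' t - at_index \<kappa> t) \<le> e + indicator (space M - settled e N) t *\<^sub>R (2 * L t)"
    proof (cases "t \<in> settled e N")
      case True
      have "N \<le> \<kappa> t" using \<kappa> t by (auto simp: late_def)
      with True have "\<exists>k'. P t k'" by (auto simp: settled_def P_def at_index_def)
      from P[OF this] have "norm (at_index \<kappa> t - \<zeta> (\<kappa>' t) t) \<le> e" by (simp add: P_def)
      then show ?thesis using True by (simp add: at_index_def norm_minus_commute)
    next
      case False
      then show ?thesis using at_index_diff_bound[OF t, of \<kappa>' \<kappa>] e t by simp
    qed
  qed (use iL at_index_integrable[OF late] at_index_integrable[OF \<kappa>] in auto)
  also have "\<dots> = e * measure M (space M) + (\<integral>t. indicator (space M - settled e N) t *\<^sub>R (2 * L t) \<partial>M)"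
    using iL by (subst Bochner_Integration.integral_add) (auto simp: mult.commute)
  also have "\<dots> \<le> e * (measure M (space M) + 1)" using N by (simp add: algebra_simps)
  finally show ?thesis using that late by blast
qed

text \<open>One step of an iterative correction. The index function is first made later, which
  leaves an error -v; then a small fraction of a late index function is mixed in, whose integral
  lies by \<rho> in the direction of v, up to W. The new error modulo W is as small as desired, and
  the L1 cost is proportional to the old error bound e. The constant C adds up the cost e (\<mu> +
  1) of the shift and the cost 2 \<theta> \<integral> L + e of the mixing, where \<mu> is the total
  mass and \<theta> \<le> e (\<mu> + 2) / \<rho>.\<close>

lemma correction_step:
  assumes M: "atomless M" and W: "subspace W" and \<rho>: "0 < \<rho>"
    and ball: "\<And>v. norm v \<le> \<rho> \<Longrightarrow> \<exists>r\<in>limit_integrals. r - z - v \<in> W"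
    and C: "C = measure M (space M) + 2 + 2 * (measure M (space M) + 2) * integral\<^sup>L M L / \<rho>"
    and e: "0 < e" "0 < e'" and N: "(\<integral>t. indicator (space M - settled e N) t *\<^sub>R (2 * L t) \<partial>M) \<le> e"
    and \<kappa>: "\<kappa> \<in> late N" "q \<in> W" "norm (integral\<^sup>L M (at_index \<kappa>) - z - q) \<le> e"
  obtains \<kappa>' q' where "\<kappa>' \<in> late N'" "q' \<in> W" "norm (integral\<^sup>L M (at_index \<kappa>') - z - q') \<le> e'"
    "(\<integral>t. norm (at_index \<kappa>' t - at_index \<kappa> t) \<partial>M) \<le> C * e"
proof -
  let ?I = "\<lambda>\<kappa>. integral\<^sup>L M (at_index \<kappa>)"
  let ?\<mu> = "measure M (space M)"
  obtain \<kappa>1 where k1: "\<kappa>1 \<in> late N'"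
    and d1: "(\<integral>t. norm (at_index \<kappa>1 t - at_index \<kappa> t) \<partial>M) \<le> e * (?\<mu> + 1)"
    using late_shift[OF e(1) N \<kappa>(1)] by metis
  note int = at_index_integrable[OF \<kappa>(1)] at_index_integrable[OF k1]
  define v where "v = - (?I \<kappa>1 - z - q)"
  define d where "d = norm v"
  have "norm (?I \<kappa>1 - ?I \<kappa>) \<le> e * (?\<mu> + 1)"
  proof -
    have "norm (?I \<kappa>1 - ?I \<kappa>) = norm (\<integral>t. at_index \<kappa>1 t - at_index \<kappa> t \<partial>M)" using int by simp
    also have "\<dots> \<le> (\<integral>t. norm (at_index \<kappa>1 t - at_index \<kappa> t) \<partial>M)" by (rule integral_norm_bound)
    finally show ?thesis using d1 by simp
  qed
  moreover have "d = norm ((?I \<kappa>1 - ?I \<kappa>) + (?I \<kappa> - z - q))"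
    unfolding d_def v_def norm_minus_cancel by (simp add: algebra_simps)
  ultimately have "d \<le> e * (?\<mu> + 1) + e"
    using norm_triangle_ineq[of "?I \<kappa>1 - ?I \<kappa>" "?I \<kappa> - z - q"] \<kappa>(3) by linarith
  then have d: "d \<le> e * (?\<mu> + 2)" by (simp add: algebra_simps)
  have d0: "0 \<le> d" by (simp add: d_def)
  \<comment> \<open>This is the weight at which the fraction 1 - \<theta> of the error v is balanced
    by the fraction \<theta> of the overshoot of length \<rho>.\<close>
  define \<theta> where "\<theta> = d / (d + \<rho>)"
  have \<theta>: "0 \<le> \<theta>" "\<theta> \<le> 1" "\<theta> \<le> d / \<rho>"
    using d0 \<rho> by (auto simp: \<theta>_def divide_simps mult_left_mono)
  \<comment> \<open>If d = 0 then v = 0, and the quotient \<rho> / d has the default value 0, so no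
    separate construction is required.\<close>
  have "norm ((\<rho> / d) *\<^sub>R v) \<le> \<rho>"
    using \<rho> by (cases "d = 0") (auto simp: d_def)
  from ball[OF this] obtain r where r: "r \<in> limit_integrals" "r - z - (\<rho> / d) *\<^sub>R v \<in> W" by blast
  have "r \<in> closure (?I ` late N')" using r(1) by (auto simp: limit_integrals_def)
  then obtain \<kappa>2 where k2: "\<kappa>2 \<in> late N'" "norm (?I \<kappa>2 - r) < e' / 2"
    using e(2) unfolding closure_approachable by (auto simp: dist_norm dest!: spec[of _ "e'/2"])
  define e'' where "e'' = min (e'/2) e"
  have e'': "0 < e''" "e'' \<le> e' / 2" "e'' \<le> e" using e by (auto simp: e''_def)
  obtain \<kappa>' where k': "\<kappa>' \<in> late N'" "norm (?I \<kappa>' - ((1 - \<theta>) *\<^sub>R ?I \<kappa>1 + \<theta> *\<^sub>R ?I \<kappa>2)) < e''"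
    "(\<integral>t. norm (at_index \<kappa>' t - at_index \<kappa>1 t) \<partial>M) \<le> 2 * \<theta> * integral\<^sup>L M L + e''"
    by (rule late_mixing[OF M k1 k2(1) \<theta>(1,2) e''(1)])
  define q' where "q' = (1 - \<theta>) *\<^sub>R q + \<theta> *\<^sub>R (r - z - (\<rho> / d) *\<^sub>R v)"
  have q': "q' \<in> W" unfolding q'_def using W \<kappa>(2) r(2) by (intro subspace_add subspace_scale)
  have cancel: "(1 - \<theta>) *\<^sub>R v = (\<theta> * (\<rho> / d)) *\<^sub>R v"
  proof (cases "d = 0")
    case False
    then have "1 - \<theta> = \<theta> * (\<rho> / d)" using d0 \<rho> by (simp add: \<theta>_def field_simps)
    then show ?thesis by simp
  qed (simp add: d_def)
  have "(1 - \<theta>) *\<^sub>R ?I \<kappa>1 + \<theta> *\<^sub>R r = z + q' + ((\<theta> * (\<rho> / d)) *\<^sub>R v - (1 - \<theta>) *\<^sub>R v)"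
    unfolding q'_def v_def by (simp add: algebra_simps)
  then have eq: "(1 - \<theta>) *\<^sub>R ?I \<kappa>1 + \<theta> *\<^sub>R r = z + q'" unfolding cancel by simp
  have "?I \<kappa>' - z - q' = (?I \<kappa>' - ((1 - \<theta>) *\<^sub>R ?I \<kappa>1 + \<theta> *\<^sub>R ?I \<kappa>2)) + \<theta> *\<^sub>R (?I \<kappa>2 - r)"
    using eq by (simp add: algebra_simps)
  then have "norm (?I \<kappa>' - z - q') \<le> norm (?I \<kappa>' - ((1 - \<theta>) *\<^sub>R ?I \<kappa>1 + \<theta> *\<^sub>R ?I \<kappa>2)) + norm (\<theta> *\<^sub>R (?I \<kappa>2 - r))"
    by (metis norm_triangle_ineq)
  also have "norm (\<theta> *\<^sub>R (?I \<kappa>2 - r)) \<le> e' / 2"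
  proof -
    have "\<theta> * norm (?I \<kappa>2 - r) \<le> 1 * (e' / 2)" using \<theta> k2(2) by (intro mult_mono) auto
    then show ?thesis using \<theta> by simp
  qed
  finally have 1: "norm (?I \<kappa>' - z - q') \<le> e'" using k'(2) e'' by simp
  have "(\<integral>t. norm (at_index \<kappa>' t - at_index \<kappa> t) \<partial>M)
     \<le> (\<integral>t. norm (at_index \<kappa>' t - at_index \<kappa>1 t) + norm (at_index \<kappa>1 t - at_index \<kappa> t) \<partial>M)"
  proof (rule integral_mono)
    show "norm (at_index \<kappa>' t - at_index \<kappa> t) \<le> norm (at_index \<kappa>' t - at_index \<kappa>1 t) + norm (at_index \<kappa>1 t - at_index \<kappa> t)" for t
      using norm_triangle_ineq[of "at_index \<kappa>' t - at_index \<kappa>1 t" "at_index \<kappa>1 t - at_index \<kappa> t"] by simp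
  qed (use int at_index_integrable[OF k'(1)] in auto)
  also have "\<dots> = (\<integral>t. norm (at_index \<kappa>' t - at_index \<kappa>1 t) \<partial>M) + (\<integral>t. norm (at_index \<kappa>1 t - at_index \<kappa> t) \<partial>M)"
    using int at_index_integrable[OF k'(1)] by simp
  also have "\<dots> \<le> (2 * \<theta> * integral\<^sup>L M L + e) + e * (?\<mu> + 1)" using k'(3) d1 e'' by simp
  finally have 2: "(\<integral>t. norm (at_index \<kappa>' t - at_index \<kappa> t) \<partial>M) \<le> (2 * \<theta> * integral\<^sup>L M L + e) + e * (?\<mu> + 1)" .
  have "\<theta> * integral\<^sup>L M L \<le> (e * (?\<mu> + 2) / \<rho>) * integral\<^sup>L M L"
  proof (rule mult_right_mono)
    show "\<theta> \<le> e * (?\<mu> + 2) / \<rho>" using \<theta>(3) divide_right_mono[OF d, of \<rho>] \<rho> by simp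
    show "0 \<le> integral\<^sup>L M L" using L_nonneg by (intro integral_nonneg_AE) auto
  qed
  moreover have "C * e = (2 * (e * (?\<mu> + 2) / \<rho> * integral\<^sup>L M L) + e) + e * (?\<mu> + 1)"
    using \<rho> unfolding C by (simp add: field_simps)
  moreover have "2 * \<theta> * integral\<^sup>L M L = 2 * (\<theta> * integral\<^sup>L M L)" by simp
  ultimately have "(\<integral>t. norm (at_index \<kappa>' t - at_index \<kappa> t) \<partial>M) \<le> C * e"
    using 2 by linarith
  with k'(1) q' 1 that show ?thesis by blast
qed

end

text \<open>The sum of the norms of the increments has finite integral, so it is finite almost
  everywhere, and the sequence telescopes.\<close>

lemma AE_convergent_of_summable_L1:
  fixes f :: "nat \<Rightarrow> 't \<Rightarrow> 'a::banach"
  assumes f[measurable]: "\<And>n. (\<lambda>t. norm (f (Suc n) t - f n t)) \<in> borel_measurable M"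
    and int: "\<And>n. integrable M (\<lambda>t. norm (f (Suc n) t - f n t))"
    and le: "\<And>n. (\<integral>t. norm (f (Suc n) t - f n t) \<partial>M) \<le> c n" and c: "summable c"
  shows "AE t in M. convergent (\<lambda>n. f n t)"
proof -
  define g where "g n t = norm (f (Suc n) t - f n t)" for n t
  have c0: "0 \<le> c n" for n
    by (rule order_trans[OF integral_nonneg_AE le[of n]]) simp
  have "(\<integral>\<^sup>+t. (\<Sum>n. ennreal (g n t)) \<partial>M) = (\<Sum>n. \<integral>\<^sup>+t. ennreal (g n t) \<partial>M)"
    by (rule nn_integral_suminf) (simp add: g_def)
  also have "\<dots> \<le> (\<Sum>n. ennreal (c n))"
  proof (rule suminf_le)
    show "(\<integral>\<^sup>+t. ennreal (g n t) \<partial>M) \<le> ennreal (c n)" for n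
      using le[of n] int[of n] by (subst nn_integral_eq_integral) (auto simp: g_def[abs_def] intro!: ennreal_leI)
  qed auto
  also have "\<dots> = ennreal (suminf c)" using c0 c by (rule suminf_ennreal2)
  finally have "(\<integral>\<^sup>+t. (\<Sum>n. ennreal (g n t)) \<partial>M) < \<infinity>"
    using ennreal_less_top by (simp add: order_le_less_trans)
  then have "(\<integral>\<^sup>+t. (\<Sum>n. ennreal (g n t)) \<partial>M) \<noteq> \<infinity>" by simp
  then have "AE t in M. (\<Sum>n. ennreal (g n t)) \<noteq> \<infinity>"
    by (intro nn_integral_noteq_infinite) (simp_all add: g_def)
  then show ?thesis
  proof eventually_elim
    case (elim t)
    have "summable (\<lambda>n. g n t)"
      by (rule summable_suminf_not_top) (use elim in \<open>auto simp: g_def\<close>)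
    then have "summable (\<lambda>n. f (Suc n) t - f n t)" unfolding g_def by (rule summable_norm_cancel)
    then have "convergent (\<lambda>n. \<Sum>i<n. f (Suc i) t - f i t)" by (simp add: summable_iff_convergent)
    then have "convergent (\<lambda>n. f n t - f 0 t)" by (simp add: sum_lessThan_telescope[of "\<lambda>i. f i t"])
    then show ?case by (simp add: convergent_diff_const_right_iff)
  qed
qed

context dominated_sequence
begin

definition cluster_selection :: "('t \<Rightarrow> 'a) \<Rightarrow> bool" where
  "cluster_selection \<eta> \<longleftrightarrow> \<eta> \<in> borel_measurable M \<and>
     (AE t in M. \<forall>e>0. \<forall>N. \<exists>k\<ge>N. norm (\<zeta> k t - \<eta> t) < e)"

text \<open>The nondegenerate case: modulo W, the point z is interior to
  \<open>limit_integrals\<close>, so corrections can be repeated forever. The errors 2^-j make the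
  costs summable, so the chosen functions converge almost everywhere, and lateness makes the limit a
  cluster point. What is left of the error lies in W; there the given sequence converges by itself
  and fixes the integral.\<close>

lemma Fatou_interior:
  assumes M: "atomless M" and W: "subspace W" and \<rho>: "0 < \<rho>"
    and ball: "\<And>v. norm v \<le> \<rho> \<Longrightarrow> \<exists>r\<in>limit_integrals. r - z - v \<in> W"
    and conv: "AE t in M. \<forall>q\<in>W. convergent (\<lambda>k. q \<bullet> \<zeta> k t)"
    and z: "(\<lambda>k. integral\<^sup>L M (\<zeta> k)) \<longlonglongrightarrow> z"
  shows "\<exists>\<eta>. cluster_selection \<eta> \<and> integral\<^sup>L M \<eta> = z"
proof -
  let ?I = "\<lambda>\<kappa>. integral\<^sup>L M (at_index \<kappa>)"
  define C where "C = measure M (space M) + 2 + 2 * (measure M (space M) + 2) * integral\<^sup>L M L / \<rho>"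
  define e :: "nat \<Rightarrow> real" where "e j = (1/2)^j" for j
  have e: "0 < e j" for j by (simp add: e_def)
  have "\<exists>N. (\<integral>t. indicator (space M - settled (e j) N) t *\<^sub>R (2 * L t) \<partial>M) \<le> e j" for j
    using small_integral_unsettled[OF e] by blast
  then obtain N where N: "\<And>j. (\<integral>t. indicator (space M - settled (e j) (N j)) t *\<^sub>R (2 * L t) \<partial>M) \<le> e j"
    by metis
  \<comment> \<open>\<open>K j\<close> pairs an index function with an element of W that absorbs the
    tolerated part of its error. Lateness \<open>N j\<close> makes the next shift cheap; lateness j
    drives the indices to infinity.\<close>
  have "\<exists>K. \<forall>j. (fst (K j) \<in> late (max j (N j)) \<and> snd (K j) \<in> W \<and> norm (?I (fst (K j)) - z - snd (K j)) \<le> e j)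
     \<and> (\<integral>t. norm (at_index (fst (K (Suc j))) t - at_index (fst (K j)) t) \<partial>M) \<le> C * e j"
  proof (rule dependent_nat_choice)
    have "z \<in> closure (?I ` late (max 0 (N 0)))"
      using limit_in_limit_integrals[OF z] unfolding limit_integrals_def by blast
    then obtain \<kappa> where "\<kappa> \<in> late (max 0 (N 0))" "norm (?I \<kappa> - z) < e 0"
      using e[of 0] unfolding closure_approachable by (auto simp: dist_norm)
    then show "\<exists>x. fst x \<in> late (max 0 (N 0)) \<and> snd x \<in> W \<and> norm (?I (fst x) - z - snd x) \<le> e 0"
      using subspace_0[OF W] by (intro exI[of _ "(\<kappa>, 0)"]) simp
  next
    fix x j assume x: "fst x \<in> late (max j (N j)) \<and> snd x \<in> W \<and> norm (?I (fst x) - z - snd x) \<le> e j"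
    then have late: "fst x \<in> late (N j)" using late_mono[of "N j" "max j (N j)"] by auto
    have x': "snd x \<in> W" "norm (?I (fst x) - z - snd x) \<le> e j" using x by auto
    obtain \<kappa>' q' where "\<kappa>' \<in> late (max (Suc j) (N (Suc j)))" "q' \<in> W" "norm (?I \<kappa>' - z - q') \<le> e (Suc j)"
      "(\<integral>t. norm (at_index \<kappa>' t - at_index (fst x) t) \<partial>M) \<le> C * e j"
      by (rule correction_step[OF M W \<rho> ball C_def e e N late x']) (assumption, rule that)
    then show "\<exists>y. (fst y \<in> late (max (Suc j) (N (Suc j))) \<and> snd y \<in> W \<and> norm (?I (fst y) - z - snd y) \<le> e (Suc j)) \<and>
        (\<integral>t. norm (at_index (fst y) t - at_index (fst x) t) \<partial>M) \<le> C * e j"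
      by (intro exI[of _ "(\<kappa>', q')"]) simp
  qed
  then obtain K where K: "\<And>j. fst (K j) \<in> late (max j (N j))" "\<And>j. snd (K j) \<in> W"
      "\<And>j. norm (?I (fst (K j)) - z - snd (K j)) \<le> e j"
      "\<And>j. (\<integral>t. norm (at_index (fst (K (Suc j))) t - at_index (fst (K j)) t) \<partial>M) \<le> C * e j" by blast
  define f where "f j = at_index (fst (K j))" for j
  have late: "fst (K j) \<in> late j" for j using K(1)[of j] late_mono[of j "max j (N j)"] by auto
  have fi: "integrable M (f j)" for j unfolding f_def by (rule at_index_integrable[OF late])
  have [measurable]: "f j \<in> borel_measurable M" for j using fi[of j] by simp
  have fB: "norm (f j t) \<le> L t" if "t \<in> space M" for j t unfolding f_def by (rule at_index_bound[OF that])
  define \<eta> where "\<eta> t = lim (\<lambda>j. f j t)" for t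
  have [measurable]: "\<eta> \<in> borel_measurable M" unfolding \<eta>_def by measurable
  have "AE t in M. convergent (\<lambda>j. f j t)"
  proof (rule AE_convergent_of_summable_L1)
    show "summable (\<lambda>j. C * e j)" unfolding e_def by (intro summable_mult summable_geometric) simp
  qed (use fi K(4) in \<open>auto simp: f_def\<close>)
  then have lim: "AE t in M. (\<lambda>j. f j t) \<longlonglongrightarrow> \<eta> t" by (simp add: \<eta>_def convergent_LIMSEQ_iff)
  have I: "(\<lambda>j. integral\<^sup>L M (f j)) \<longlonglongrightarrow> integral\<^sup>L M \<eta>"
    by (rule integral_dominated_convergence[OF _ _ L_integrable lim]) (use fB in auto)
  have i\<eta>: "integrable M \<eta>"
    by (rule integrable_dominated_convergence[OF _ _ L_integrable lim]) (use fB in auto)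
  have "(\<lambda>j. integral\<^sup>L M (f j) - z - snd (K j)) \<longlonglongrightarrow> 0"
  proof (rule Lim_null_comparison[of _ e])
    show "\<forall>\<^sub>F j in sequentially. norm (integral\<^sup>L M (f j) - z - snd (K j)) \<le> e j"
      unfolding f_def using K(3) by simp
    show "e \<longlonglongrightarrow> 0" unfolding e_def[abs_def] by (rule LIMSEQ_power_zero) simp
  qed
  from tendsto_diff[OF tendsto_diff[OF I tendsto_const[of z]] this]
  have "(\<lambda>j. snd (K j)) \<longlonglongrightarrow> integral\<^sup>L M \<eta> - z" by simp
  then have inW: "integral\<^sup>L M \<eta> - z \<in> W"
    by (rule closed_sequentially[OF closed_subspace[OF W] K(2)])
  \<comment> \<open>In a direction q of W all index functions tending to infinity have the same
    limit c, so the integrals of \<eta> and of the original sequence agree there. Applied to q =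
    \<integral> \<eta> - z this forces equality.\<close>
  have "q \<bullet> (integral\<^sup>L M \<eta> - z) = 0" if q: "q \<in> W" for q
  proof -
    have \<zeta>i: "integrable M (\<zeta> k)" for k
      using at_index_integrable[of "\<lambda>_. k" 0] by (simp add: late_def at_index_def[abs_def])
    define c where "c t = lim (\<lambda>k. q \<bullet> \<zeta> k t)" for t
    have [measurable]: "c \<in> borel_measurable M" unfolding c_def by measurable
    have c: "AE t in M. (\<lambda>k. q \<bullet> \<zeta> k t) \<longlonglongrightarrow> c t"
      using conv by eventually_elim (use q in \<open>auto simp: c_def convergent_LIMSEQ_iff\<close>)
    have bound: "norm (q \<bullet> x) \<le> norm q * L t" if "norm x \<le> L t" for x t
      using Cauchy_Schwarz_ineq2[of q x] mult_left_mono[OF that, of "norm q"] by simp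
    have "(\<lambda>k. \<integral>t. q \<bullet> \<zeta> k t \<partial>M) \<longlonglongrightarrow> integral\<^sup>L M c"
      by (rule integral_dominated_convergence[where w="\<lambda>t. norm q * L t"])
        (use c L_integrable bound \<zeta>_bound in auto)
    moreover have "(\<lambda>k. \<integral>t. q \<bullet> \<zeta> k t \<partial>M) \<longlonglongrightarrow> q \<bullet> z"
      using tendsto_inner[OF tendsto_const z, of q] \<zeta>i by simp
    ultimately have qz: "integral\<^sup>L M c = q \<bullet> z" by (rule LIMSEQ_unique)
    have "(\<lambda>j. \<integral>t. q \<bullet> f j t \<partial>M) \<longlonglongrightarrow> integral\<^sup>L M c"
    proof (rule integral_dominated_convergence[where w="\<lambda>t. norm q * L t"])
      show "AE t in M. (\<lambda>j. q \<bullet> f j t) \<longlonglongrightarrow> c t"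
        using c AE_space
      proof eventually_elim
        case (elim t)
        have "filterlim (\<lambda>j. fst (K j) t) at_top sequentially"
          by (rule filterlim_at_top_mono[OF filterlim_ident])
            (use late elim(2) in \<open>auto simp: late_def\<close>)
        from filterlim_compose[OF elim(1) this] show ?case by (simp add: f_def at_index_def)
      qed
    qed (use L_integrable bound fB in auto)
    moreover have "(\<lambda>j. \<integral>t. q \<bullet> f j t \<partial>M) \<longlonglongrightarrow> q \<bullet> integral\<^sup>L M \<eta>"
      using tendsto_inner[OF tendsto_const I, of q] fi by simp
    ultimately have "integral\<^sup>L M c = q \<bullet> integral\<^sup>L M \<eta>" by (rule LIMSEQ_unique)
    with qz show ?thesis by (simp add: inner_diff_right)
  qed
  from this[OF inW] have "integral\<^sup>L M \<eta> = z" by simp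
  moreover have "cluster_selection \<eta>"
    unfolding cluster_selection_def
  proof
    show "AE t in M. \<forall>e>0. \<forall>N. \<exists>k\<ge>N. norm (\<zeta> k t - \<eta> t) < e"
      using lim AE_space
    proof eventually_elim
      case (elim t)
      show ?case
      proof (intro allI impI)
        fix e :: real and N assume "0 < e"
        from tendstoD[OF elim(1) this] obtain J where "\<And>j. j \<ge> J \<Longrightarrow> norm (f j t - \<eta> t) < e"
          by (auto simp: eventually_sequentially dist_norm)
        from this[of "max J N"] have "norm (\<zeta> (fst (K (max J N)) t) t - \<eta> t) < e"
          by (simp add: f_def at_index_def)
        moreover have "N \<le> fst (K (max J N)) t"
          using late[of "max J N"] elim(2) unfolding late_def by fastforce
        ultimately show "\<exists>k\<ge>N. norm (\<zeta> k t - \<eta> t) < e" by blast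
      qed
    qed
  qed measurable
  ultimately show ?thesis by blast
qed

end

text \<open>Induction on the codimension of W, a space of directions in which the sequence converges
  almost everywhere. Either z is interior modulo W, or a hyperplane supports
  \<open>limit_integrals\<close> at z with a normal orthogonal to W. In the second case a
  subsequence converges in this normal direction too, and W grows.\<close>

lemma Fatou_atomless_directions:
  fixes \<zeta> :: "nat \<Rightarrow> 't \<Rightarrow> 'a::euclidean_space"
  assumes "dominated_sequence M \<zeta> L" "atomless M" "subspace W" "DIM('a) - dim W = n"
    and "AE t in M. \<forall>q\<in>W. convergent (\<lambda>k. q \<bullet> \<zeta> k t)"
    and "(\<lambda>k. integral\<^sup>L M (\<zeta> k)) \<longlonglongrightarrow> z"
  shows "\<exists>\<eta>. dominated_sequence.cluster_selection M \<zeta> \<eta> \<and> integral\<^sup>L M \<eta> = z"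
  using assms
proof (induction n arbitrary: \<zeta> W rule: less_induct)
  case (less n)
  interpret dominated_sequence M \<zeta> L by fact
  note M = \<open>atomless M\<close> and W = \<open>subspace W\<close>
    and conv = less.prems(5) and z = less.prems(6)
  \<comment> \<open>\<open>limit_integrals\<close> recentred at z and enlarged by W: a ball around 0
    inside S is what \<open>Fatou_interior\<close> asks for, and otherwise S can be separated from
    0.\<close>
  define S where "S = {r - z + q | r q. r \<in> limit_integrals \<and> q \<in> W}"
  have S: "S = (\<Union>x\<in>(\<lambda>r. r - z) ` limit_integrals. \<Union>y\<in>W. {x + y})"
    by (auto simp: S_def)
  have "convex ((\<lambda>r. r - z) ` limit_integrals)"
    by (intro convex_translation_subtract convex_limit_integrals M)
  then have conS: "convex S"
    unfolding S by (rule convex_sums) (rule subspace_imp_convex[OF W])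
  show ?case
  proof (cases "0 \<in> interior S")
    case True
    then obtain \<rho> where \<rho>: "0 < \<rho>" "cball 0 \<rho> \<subseteq> S" by (auto simp: mem_interior_cball)
    show ?thesis
    proof (rule Fatou_interior[OF M W \<rho>(1) _ conv z])
      fix v :: 'a assume "norm v \<le> \<rho>"
      then have "v \<in> S" using \<rho>(2) by auto
      then obtain r q where rq: "r \<in> limit_integrals" "q \<in> W" "v = r - z + q" by (auto simp: S_def)
      then have "r - z - v = - q" by simp
      with rq W show "\<exists>r\<in>limit_integrals. r - z - v \<in> W" by (metis subspace_neg)
    qed
  next
    case False
    have "0 \<in> S" unfolding S_def using limit_in_limit_integrals[OF z] subspace_0[OF W] by force
    obtain a where a: "a \<noteq> 0" "\<And>y. y \<in> S \<Longrightarrow> a \<bullet> y \<le> 0"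
    proof (cases "interior S = {}")
      case True
      obtain a b where ab: "a \<noteq> 0" "S \<subseteq> {x. a \<bullet> x = b}"
        using empty_interior_subset_hyperplane[OF conS True] by blast
      then have "b = 0" using \<open>0 \<in> S\<close> by auto
      with ab have "\<And>y. y \<in> S \<Longrightarrow> a \<bullet> y \<le> 0" by auto
      with ab(1) that show ?thesis by blast
    next
      case False
      have "interior S \<inter> {0} = {}" using \<open>0 \<notin> interior S\<close> by auto
      from separating_hyperplane_sets[OF convex_interior[OF conS] convex_singleton False _ this]
      obtain a b where ab: "a \<noteq> 0" "\<forall>x\<in>interior S. a \<bullet> x \<le> b" "b \<le> 0" by auto
      have "a \<bullet> y \<le> 0" if "y \<in> S" for y
      proof -
        have "y \<in> closure (interior S)"
          using that closure_subset convex_closure_interior[OF conS False] by auto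
        moreover have "closure (interior S) \<subseteq> {x. a \<bullet> x \<le> 0}"
          by (rule closure_minimal) (use ab in \<open>auto simp: closed_halfspace_le\<close>)
        ultimately show ?thesis by auto
      qed
      with ab(1) that show ?thesis by blast
    qed
    \<comment> \<open>S contains the whole subspace W, and a linear functional bounded above on a
      subspace vanishes on it. Hence a is a genuinely new direction.\<close>
    have perp: "a \<bullet> q = 0" if q: "q \<in> W" for q
    proof -
      have "z \<in> limit_integrals" by (rule limit_in_limit_integrals[OF z])
      then have "q \<in> S" "- q \<in> S"
        unfolding S_def using q subspace_neg[OF W q] by force+
      from a(2)[OF this(1)] a(2)[OF this(2)] show ?thesis by simp
    qed
    have "a \<bullet> r \<le> a \<bullet> z" if "r \<in> limit_integrals" for r
    proof -
      have "r - z + 0 \<in> S" unfolding S_def using that subspace_0[OF W] by blast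
      from a(2)[OF this] show ?thesis by (simp add: inner_diff_right)
    qed
    from supported_direction_converges[OF z this] obtain s :: "nat \<Rightarrow> nat"
      where s: "strict_mono s" "AE t in M. convergent (\<lambda>k. a \<bullet> \<zeta> (s k) t)" by blast
    define W' where "W' = span (insert a W)"
    have "a \<notin> W" using perp[of a] a(1) by auto
    then have "a \<notin> span W" using span_eq_iff W by blast
    then have "dim (insert a W) = Suc (dim W)" by (simp add: dim_insert)
    then have dim: "dim W' = Suc (dim W)" by (simp add: W'_def)
    have le: "dim W' \<le> DIM('a)" by (rule dim_subset_UNIV)
    interpret s: dominated_sequence M "\<lambda>k. \<zeta> (s k)" L
      by unfold_locales (auto simp: \<zeta>_bound L_integrable)
    have "AE t in M. \<forall>q\<in>W'. convergent (\<lambda>k. q \<bullet> \<zeta> (s k) t)"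
      using conv s(2)
    proof eventually_elim
      case (elim t)
      show ?case unfolding W'_def
      proof
        fix q assume "q \<in> span (insert a W)"
        then show "convergent (\<lambda>k. q \<bullet> \<zeta> (s k) t)"
        proof (induction rule: span_induct)
          case base
          show ?case
            unfolding subspace_def mem_Collect_eq
            by (auto simp: inner_add_left convergent_const intro: convergent_add convergent_mult[OF convergent_const])
        next
          case (step x)
          then consider "x = a" | "x \<in> W" by blast
          then show ?case
          proof cases
            case 2
            then have "convergent (\<lambda>k. x \<bullet> \<zeta> k t)" using elim(1) by blast
            from convergent_subseq_convergent[OF this s(1)] show ?thesis by (simp add: o_def)
          qed (use elim(2) in simp)
        qed
      qed
    qed
    moreover have "(\<lambda>k. integral\<^sup>L M (\<zeta> (s k))) \<longlonglongrightarrow> z"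
      using LIMSEQ_subseq_LIMSEQ[OF z s(1)] by (simp add: o_def)
    ultimately obtain \<eta> where \<eta>: "s.cluster_selection \<eta>" "integral\<^sup>L M \<eta> = z"
      using less.IH[of "DIM('a) - dim W'" "\<lambda>k. \<zeta> (s k)" W'] dim le less.prems(4) M s.dominated_sequence_axioms
      unfolding W'_def by (auto simp: diff_less_mono2)
    have "cluster_selection \<eta>"
      unfolding cluster_selection_def
    proof
      show "AE t in M. \<forall>e>0. \<forall>N. \<exists>k\<ge>N. norm (\<zeta> k t - \<eta> t) < e"
        using \<eta>(1)[unfolded s.cluster_selection_def, THEN conjunct2]
      proof eventually_elim
        case (elim t)
        show ?case
        proof (intro allI impI)
          fix e :: real and N assume "0 < e"
          then obtain k where "k \<ge> N" "norm (\<zeta> (s k) t - \<eta> t) < e" using elim by blast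
          moreover have "k \<le> s k" by (rule seq_suble[OF s(1)])
          ultimately show "\<exists>k\<ge>N. norm (\<zeta> k t - \<eta> t) < e" by (intro exI[of _ "s k"]) auto
        qed
      qed
    qed (use \<eta>(1) in \<open>simp add: s.cluster_selection_def\<close>)
    with \<eta>(2) show ?thesis by blast
  qed
qed

lemma Fatou_atomless:
  fixes \<zeta> :: "nat \<Rightarrow> 't \<Rightarrow> 'a::euclidean_space"
  assumes "dominated_sequence M \<zeta> L" "atomless M" "(\<lambda>k. integral\<^sup>L M (\<zeta> k)) \<longlonglongrightarrow> z"
  shows "\<exists>\<eta>. dominated_sequence.cluster_selection M \<zeta> \<eta> \<and> integral\<^sup>L M \<eta> = z"
  by (rule Fatou_atomless_directions[OF assms(1,2) subspace_single_0 refl _ assms(3)])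
    (simp add: convergent_const)

section \<open>Atoms and the general Fatou lemma\<close>

definition is_atom :: "'t measure \<Rightarrow> 't set \<Rightarrow> bool" where
  "is_atom M A \<longleftrightarrow> A \<in> sets M \<and> 0 < measure M A \<and>
     (\<forall>B\<in>sets M. B \<subseteq> A \<longrightarrow> measure M B = 0 \<or> measure M B = measure M A)"

text \<open>Exhaustion over countable unions of atoms, where the empty set pads finite families. An
  atom disjoint from a maximal union could be added and would increase its measure, so the
  complement is atomless.\<close>

lemma (in finite_measure) atoms_decomposition:
  obtains A :: "nat \<Rightarrow> 'a set" where "\<And>n. A n = {} \<or> is_atom M (A n)"
    "atomless (restrict_space M (space M - (\<Union>n. A n)))"
proof -
  define \<S> where "\<S> = {\<Union>(range A) | A :: nat \<Rightarrow> 'a set. \<forall>n. A n = {} \<or> is_atom M (A n)}"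
  have sets: "\<S> \<subseteq> sets M"
  proof
    fix B assume "B \<in> \<S>"
    then obtain A :: "nat \<Rightarrow> 'a set" where "B = \<Union>(range A)" "\<And>n. A n = {} \<or> is_atom M (A n)"
      unfolding \<S>_def by blast
    moreover from this(2) have "A n \<in> sets M" for n using is_atom_def sets.empty_sets by metis
    ultimately show "B \<in> sets M" by auto
  qed
  have lim: "(\<Union>n. F n) \<in> \<S>" if F: "\<And>n::nat. F n \<in> \<S>" for F
  proof -
    have "\<forall>n. \<exists>A::nat \<Rightarrow> 'a set. F n = \<Union>(range A) \<and> (\<forall>m. A m = {} \<or> is_atom M (A m))"
      using F unfolding \<S>_def by blast
    then obtain A :: "nat \<Rightarrow> nat \<Rightarrow> 'a set" where A: "\<And>n. F n = \<Union>(range (A n))" "\<And>n m. A n m = {} \<or> is_atom M (A n m)"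
      by metis
    \<comment> \<open>A countable union of countable families is again one countable family, through
      the pairing of naturals.\<close>
    define A' where "A' k = A (fst (prod_decode k)) (snd (prod_decode k))" for k
    have "A' (prod_encode (n, m)) = A n m" for n m by (simp add: A'_def)
    then have "(\<Union>n. F n) = \<Union>(range A')"
      unfolding A(1) using A'_def by fastforce
    moreover have "\<forall>k. A' k = {} \<or> is_atom M (A' k)" using A(2) by (simp add: A'_def)
    ultimately show ?thesis unfolding \<S>_def by blast
  qed
  have "{} \<in> \<S>" unfolding \<S>_def by (auto intro!: exI[of _ "\<lambda>_. {}"])
  then obtain D where D: "D \<in> \<S>" "\<And>B. B \<in> \<S> \<Longrightarrow> D \<subseteq> B \<Longrightarrow> measure M B = measure M D"
    by (rule exhaustion[OF sets _ lim]) (assumption, rule that)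
  then obtain A :: "nat \<Rightarrow> 'a set" where A: "D = \<Union>(range A)" "\<And>n. A n = {} \<or> is_atom M (A n)"
    unfolding \<S>_def by blast
  have Dm[measurable]: "D \<in> sets M" using D(1) sets by auto
  have Om: "(space M - D) \<inter> space M \<in> sets M" by auto
  have "atomless (restrict_space M (space M - D))"
    unfolding atomless_def
  proof (intro ballI impI)
    fix B assume B: "B \<in> sets (restrict_space M (space M - D))"
      "0 < measure (restrict_space M (space M - D)) B"
    have B': "B \<subseteq> space M - D" "B \<in> sets M" using B(1) Om by (auto simp: sets_restrict_space_iff)
    have eq: "measure (restrict_space M (space M - D)) C = measure M C" if "C \<subseteq> B" for C
      by (rule measure_restrict_space[OF Om]) (use that B' in auto)
    have "\<not> is_atom M B"
    proof
      assume at: "is_atom M B"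
      define A' where "A' n = (case n of 0 \<Rightarrow> B | Suc m \<Rightarrow> A m)" for n
      have "(\<Union>n. A' n) = B \<union> D"
      proof -
        have "(\<Union>n. A' n) = A' 0 \<union> (\<Union>n. A' (Suc n))" by (auto simp: gr0_conv_Suc) (metis not0_implies_Suc)
        then show ?thesis by (simp add: A'_def A(1))
      qed
      moreover have "\<forall>n. A' n = {} \<or> is_atom M (A' n)" using at A(2) by (auto simp: A'_def split: nat.split)
      ultimately have "B \<union> D \<in> \<S>" unfolding \<S>_def by blast
      then have "measure M (B \<union> D) = measure M D" by (rule D(2)) auto
      moreover have "measure M (B \<union> D) = measure M B + measure M D"
        by (rule finite_measure_Union) (use B' in auto)
      ultimately show False using at by (simp add: is_atom_def)
    qed
    then obtain C where C: "C \<in> sets M" "C \<subseteq> B" "measure M C \<noteq> 0" "measure M C \<noteq> measure M B"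
      using B(2) B'(2) eq[of B] unfolding is_atom_def by auto
    have "measure M C \<le> measure M B" by (rule finite_measure_mono[OF C(2) B'(2)])
    with C have "0 < measure M C" "measure M C < measure M B"
      using measure_nonneg[of M C] by linarith+
    moreover have "C \<in> sets (restrict_space M (space M - D))"
      using C B' Om by (auto simp: sets_restrict_space_iff)
    ultimately show "\<exists>C\<in>sets (restrict_space M (space M - D)). C \<subseteq> B
        \<and> 0 < measure (restrict_space M (space M - D)) C
        \<and> measure (restrict_space M (space M - D)) C < measure (restrict_space M (space M - D)) B"
      using C(2) eq[of C] eq[of B] by auto
  qed
  with A that show ?thesis by blast
qed

text \<open>Let c be the mean of g on A. The set where g is below c is null or has full measure in
  A, so g - c has one sign there; as its integral is 0, it vanishes almost everywhere on A.\<close>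

lemma (in finite_measure) AE_const_on_atom_real:
  fixes g :: "'a \<Rightarrow> real"
  assumes A: "is_atom M A" and g: "integrable M g"
  obtains c where "AE t in M. t \<in> A \<longrightarrow> g t = c"
proof -
  have [measurable]: "A \<in> sets M" "g \<in> borel_measurable M" using A g by (auto simp: is_atom_def)
  define c where "c = (\<integral>t. indicator A t * g t \<partial>M) / measure M A"
  have iA: "integrable M (\<lambda>t. indicator A t * (g t - c))"
    using g integrable_mult_indicator[of A M "\<lambda>t. g t - c"] by simp
  have ig: "integrable M (\<lambda>t. indicator A t * g t)"
    using g integrable_mult_indicator[of A M g] by simp
  have "(\<integral>t. indicator A t * (g t - c) \<partial>M) = (\<integral>t. indicator A t * g t \<partial>M) - measure M A * c"
    using ig by (simp add: right_diff_distrib emeasure_finite less_top[symmetric])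
  then have zero: "(\<integral>t. indicator A t * (g t - c) \<partial>M) = 0"
    using A by (simp add: c_def is_atom_def)
  define B where "B = {t\<in>A. g t < c}"
  have B[measurable]: "B \<in> sets M" unfolding B_def
    using measurable_sets_borel by measurable
  have "measure M B = 0 \<or> measure M B = measure M A"
    using A B unfolding is_atom_def by (auto simp: B_def)
  then have "AE t in M. indicator A t * (g t - c) = 0"
  proof
    assume "measure M B = 0"
    then have "AE t in M. t \<notin> B" by (intro AE_not_in) (auto simp: emeasure_eq_measure null_sets_def)
    then have "AE t in M. 0 \<le> indicator A t * (g t - c)"
      by eventually_elim (auto simp: B_def indicator_def not_less)
    from integral_nonneg_eq_0_iff_AE[OF iA this] zero show ?thesis by simp
  next
    assume eq: "measure M B = measure M A"
    have "measure M (A - B) = measure M A - measure M B"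
      by (rule finite_measure_Diff) (auto simp: B_def)
    then have "AE t in M. t \<notin> A - B" using eq by (intro AE_not_in) (auto simp: emeasure_eq_measure null_sets_def)
    then have "AE t in M. 0 \<le> - (indicator A t * (g t - c))"
      by eventually_elim (auto simp: B_def indicator_def)
    from integral_nonneg_eq_0_iff_AE[OF _ this] iA zero show ?thesis by simp
  qed
  then have "AE t in M. t \<in> A \<longrightarrow> g t = c" by eventually_elim (auto simp: indicator_def split: if_splits)
  with that show ?thesis by blast
qed

lemma (in finite_measure) AE_const_on_atom:
  fixes f :: "'a \<Rightarrow> 'b::euclidean_space"
  assumes A: "is_atom M A" and f: "integrable M f"
  obtains c where "AE t in M. t \<in> A \<longrightarrow> f t = c"
proof -
  have "\<exists>c. AE t in M. t \<in> A \<longrightarrow> f t \<bullet> b = c" for b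
    using AE_const_on_atom_real[OF A, of "\<lambda>t. f t \<bullet> b"] f by auto
  then obtain c where c: "\<And>b. AE t in M. t \<in> A \<longrightarrow> f t \<bullet> b = c b" by metis
  have "AE t in M. \<forall>b\<in>Basis. t \<in> A \<longrightarrow> f t \<bullet> b = c b"
    by (rule AE_finite_allI) (use c in auto)
  then have "AE t in M. t \<in> A \<longrightarrow> f t = (\<Sum>b\<in>Basis. c b *\<^sub>R b)"
    by eventually_elim (auto intro!: euclidean_eqI[where 'a='b])
  with that show ?thesis by blast
qed

context dominated_sequence
begin

lemma \<zeta>_integrable: "integrable M (\<zeta> k)"
  using at_index_integrable[of "\<lambda>_. k" 0] by (simp add: late_def at_index_def[abs_def])

text \<open>On an atom the sequence is almost everywhere a sequence of constants. A point common to
  all the exceptional complements bounds these constants by L t, so a subsequence of them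
  converges.\<close>

lemma atom_convergent_subsequence:
  assumes A: "is_atom M A"
  shows "\<exists>r. strict_mono (r :: nat \<Rightarrow> nat) \<and> (AE t in M. t \<in> A \<longrightarrow> convergent (\<lambda>k. \<zeta> (r k) t))"
proof -
  have "\<exists>c. AE t in M. t \<in> A \<longrightarrow> \<zeta> k t = c" for k
    using AE_const_on_atom[OF A \<zeta>_integrable[of k]] by blast
  then obtain c where "\<And>k. AE t in M. t \<in> A \<longrightarrow> \<zeta> k t = c k" by metis
  then have c: "AE t in M. \<forall>k. t \<in> A \<longrightarrow> \<zeta> k t = c k" unfolding AE_all_countable by blast
  have "\<exists>t\<in>space M. t \<in> A \<and> (\<forall>k. \<zeta> k t = c k)"
  proof (rule ccontr)
    assume none: "\<not> ?thesis"
    have "AE t in M. t \<notin> A" using c AE_space by eventually_elim (use none in blast)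
    moreover have "A \<in> sets M" using A by (simp add: is_atom_def)
    ultimately have "A \<in> null_sets M" by (simp add: AE_iff_null_sets)
    then have "measure M A = 0" by (rule measure_eq_0_null_sets)
    with A show False by (simp add: is_atom_def)
  qed
  then obtain t where t: "t \<in> space M" "\<And>k. \<zeta> k t = c k" by blast
  have "norm (c k) \<le> L t" for k using \<zeta>_bound[OF t(1), of k] t(2)[of k] by simp
  then have "bounded (range c)" by (auto simp: bounded_iff)
  then obtain l r where r: "strict_mono r" "(c \<circ> r) \<longlonglongrightarrow> l"
    using bounded_imp_convergent_subsequence by blast
  have "AE t in M. t \<in> A \<longrightarrow> convergent (\<lambda>k. \<zeta> (r k) t)"
    using c
  proof eventually_elim
    case (elim t)
    show ?case
    proof
      assume "t \<in> A"
      then have "(\<lambda>k. \<zeta> (r k) t) = c \<circ> r" using elim by (auto simp: o_def)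
      with r(2) show "convergent (\<lambda>k. \<zeta> (r k) t)" by (simp add: convergentI)
    qed
  qed
  with r(1) show ?thesis by blast
qed

lemma subsequence: "dominated_sequence M (\<lambda>k. \<zeta> (r k)) L"
  by unfold_locales (auto simp: \<zeta>_bound L_integrable)

lemma atoms_convergent_subsequence:
  assumes A: "\<And>n::nat. A n = {} \<or> is_atom M (A n)"
  obtains s where "strict_mono (s :: nat \<Rightarrow> nat)"
    "AE t in M. t \<in> (\<Union>n. A n) \<longrightarrow> convergent (\<lambda>k. \<zeta> (s k) t)"
proof -
  define P where "P n s \<longleftrightarrow> (AE t in M. t \<in> A n \<longrightarrow> convergent (\<lambda>k. \<zeta> (s k) t))" for n and s :: "nat \<Rightarrow> nat"
  interpret subseqs P
  proof
    fix n and s :: "nat \<Rightarrow> nat"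
    interpret s: dominated_sequence M "\<lambda>k. \<zeta> (s k)" L by (rule subsequence)
    show "\<exists>r'. strict_mono r' \<and> P n (s \<circ> r')"
      using A[of n]
    proof
      assume "is_atom M (A n)"
      from s.atom_convergent_subsequence[OF this] show ?thesis by (simp add: P_def)
    qed (auto simp: P_def intro!: exI[of _ "\<lambda>n. n"] strict_monoI)
  qed
  have "P n (diagseq \<circ> ((+) (Suc n)))" for n
  proof (rule diagseq_holds)
    fix r s :: "nat \<Rightarrow> nat" and n assume r: "strict_mono r" and P: "P n s"
    show "P n (s \<circ> r)"
      unfolding P_def using P[unfolded P_def]
    proof eventually_elim
      case (elim t)
      then show ?case
        using convergent_subseq_convergent[OF _ r, of "\<lambda>k. \<zeta> (s k) t"] by (auto simp: o_def)
    qed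
  qed
  then have "AE t in M. t \<in> A n \<longrightarrow> convergent (\<lambda>k. \<zeta> (diagseq k) t)" for n
  proof -
    have "convergent (\<lambda>k. \<zeta> (diagseq (Suc n + k)) t) \<longleftrightarrow> convergent (\<lambda>k. \<zeta> (diagseq k) t)" for t
      using convergent_ignore_initial_segment[of "\<lambda>k. \<zeta> (diagseq k) t" "Suc n"] by (simp add: add.commute)
    then show ?thesis using \<open>P n (diagseq \<circ> ((+) (Suc n)))\<close> unfolding P_def o_def by simp
  qed
  then have "AE t in M. \<forall>n. t \<in> A n \<longrightarrow> convergent (\<lambda>k. \<zeta> (diagseq k) t)"
    unfolding AE_all_countable by blast
  then have "AE t in M. t \<in> (\<Union>n. A n) \<longrightarrow> convergent (\<lambda>k. \<zeta> (diagseq k) t)"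
    by eventually_elim blast
  with subseq_diagseq that show ?thesis by blast
qed

text \<open>Mixing fails on atoms, but there a diagonal subsequence converges pointwise and its
  limit is the selection. Its integral is subtracted from z, and the atomless case provides a
  selection for the difference on the complement. The cluster property passes from the subsequence
  back to \<zeta>.\<close>

theorem Fatou_several_dimensions:
  assumes z: "(\<lambda>k. integral\<^sup>L M (\<zeta> k)) \<longlonglongrightarrow> z"
  obtains \<eta> where "integrable M \<eta>" "integral\<^sup>L M \<eta> = z"
    "AE t in M. \<forall>e>0. \<forall>N. \<exists>k\<ge>N. norm (\<zeta> k t - \<eta> t) < e"
proof -
  obtain A :: "nat \<Rightarrow> 't set" where A: "\<And>n. A n = {} \<or> is_atom M (A n)"
    "atomless (restrict_space M (space M - (\<Union>n. A n)))" by (rule atoms_decomposition) (rule that)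
  define D where "D = (\<Union>n. A n)"
  have "A n \<in> sets M" for n using A(1)[of n] by (auto simp: is_atom_def)
  then have D[measurable]: "D \<in> sets M" unfolding D_def by auto
  have Om: "(space M - D) \<inter> space M \<in> sets M" by auto
  obtain s where s: "strict_mono (s :: nat \<Rightarrow> nat)" "AE t in M. t \<in> D \<longrightarrow> convergent (\<lambda>k. \<zeta> (s k) t)"
    unfolding D_def by (rule atoms_convergent_subsequence[OF A(1)])
  define \<eta>1 where "\<eta>1 t = lim (\<lambda>k. \<zeta> (s k) t)" for t
  have [measurable]: "\<eta>1 \<in> borel_measurable M" unfolding \<eta>1_def by measurable
  have lim: "AE t in M. t \<in> D \<longrightarrow> (\<lambda>k. \<zeta> (s k) t) \<longlonglongrightarrow> \<eta>1 t"
    using s(2) by eventually_elim (auto simp: \<eta>1_def convergent_LIMSEQ_iff)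
  have AElim: "AE t in M. (\<lambda>k. indicator D t *\<^sub>R \<zeta> (s k) t) \<longlonglongrightarrow> indicator D t *\<^sub>R \<eta>1 t"
    using lim by eventually_elim (auto simp: indicator_def)
  have bnd: "norm (indicator B t *\<^sub>R \<zeta> k t) \<le> L t" if "t \<in> space M" for B k t
    using \<zeta>_bound[OF that] L_nonneg[OF that] by (auto simp: indicator_def)
  have I1: "(\<lambda>k. \<integral>t. indicator D t *\<^sub>R \<zeta> (s k) t \<partial>M) \<longlonglongrightarrow> (\<integral>t. indicator D t *\<^sub>R \<eta>1 t \<partial>M)"
    by (rule integral_dominated_convergence[OF _ _ L_integrable AElim]) (use bnd in auto)
  have i1: "integrable M (\<lambda>t. indicator D t *\<^sub>R \<eta>1 t)"
    by (rule integrable_dominated_convergence[OF _ _ L_integrable AElim]) (use bnd in auto)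
  let ?M' = "restrict_space M (space M - D)"
  interpret M': finite_measure ?M'
    by (rule finite_measure_restrict_space) (auto simp: finite_measure_axioms)
  have ds: "dominated_sequence ?M' (\<lambda>k. \<zeta> (s k)) L"
  proof unfold_locales
    show "\<zeta> (s k) \<in> borel_measurable ?M'" for k by (rule measurable_restrict_space1) simp
    show "norm (\<zeta> (s k) t) \<le> L t" if "t \<in> space ?M'" for k t
      using that by (intro \<zeta>_bound) (auto simp: space_restrict_space)
    show "integrable ?M' L"
      unfolding integrable_restrict_space[OF Om]
      by (rule integrable_mult_indicator) (use L_integrable in auto)
  qed
  interpret M': dominated_sequence ?M' "\<lambda>k. \<zeta> (s k)" L by (rule ds)
  have "(\<integral>t. indicator (space M - D) t *\<^sub>R \<zeta> (s k) t \<partial>M)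
     = integral\<^sup>L M (\<zeta> (s k)) - (\<integral>t. indicator D t *\<^sub>R \<zeta> (s k) t \<partial>M)" for k
  proof -
    have "(\<integral>t. indicator (space M - D) t *\<^sub>R \<zeta> (s k) t \<partial>M) = (\<integral>t. \<zeta> (s k) t - indicator D t *\<^sub>R \<zeta> (s k) t \<partial>M)"
      by (rule Bochner_Integration.integral_cong) (auto simp: indicator_def)
    also have "\<dots> = integral\<^sup>L M (\<zeta> (s k)) - (\<integral>t. indicator D t *\<^sub>R \<zeta> (s k) t \<partial>M)"
      by (rule Bochner_Integration.integral_diff[OF \<zeta>_integrable])
        (rule integrable_mult_indicator[OF D \<zeta>_integrable])
    finally show ?thesis .
  qed
  moreover have "(\<lambda>k. integral\<^sup>L M (\<zeta> (s k))) \<longlonglongrightarrow> z"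
    using LIMSEQ_subseq_LIMSEQ[OF z s(1)] by (simp add: o_def)
  ultimately have "(\<lambda>k. \<integral>t. \<zeta> (s k) t \<partial>?M') \<longlonglongrightarrow> z - (\<integral>t. indicator D t *\<^sub>R \<eta>1 t \<partial>M)"
    using I1 by (simp add: integral_restrict_space[OF Om] tendsto_diff)
  from Fatou_atomless[OF ds A(2)[folded D_def] this]
  obtain \<eta>2 where \<eta>2: "M'.cluster_selection \<eta>2" "integral\<^sup>L ?M' \<eta>2 = z - (\<integral>t. indicator D t *\<^sub>R \<eta>1 t \<partial>M)" by blast
  have \<eta>2m[measurable]: "(\<lambda>t. indicator (space M - D) t *\<^sub>R \<eta>2 t) \<in> borel_measurable M"
    using \<eta>2(1) unfolding M'.cluster_selection_def borel_measurable_restrict_space_iff[OF Om] by blast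
  have cl2: "AE t in M. t \<in> space M - D \<longrightarrow> (\<forall>e>0. \<forall>N. \<exists>k\<ge>N. norm (\<zeta> (s k) t - \<eta>2 t) < e)"
    using \<eta>2(1) unfolding M'.cluster_selection_def AE_restrict_space_iff[OF Om] by blast
  define \<eta> where "\<eta> t = indicator D t *\<^sub>R \<eta>1 t + indicator (space M - D) t *\<^sub>R \<eta>2 t" for t
  have \<eta>m[measurable]: "\<eta> \<in> borel_measurable M" unfolding \<eta>_def by measurable
  have cl: "AE t in M. \<forall>e>0. \<forall>N. \<exists>k\<ge>N. norm (\<zeta> k t - \<eta> t) < e"
    using cl2 lim AE_space
  proof eventually_elim
    case (elim t)
    have "\<forall>e>0. \<forall>N. \<exists>k\<ge>N. norm (\<zeta> (s k) t - \<eta> t) < e"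
    proof (cases "t \<in> D")
      case True
      then have "(\<lambda>k. \<zeta> (s k) t) \<longlonglongrightarrow> \<eta> t" using elim(2) by (simp add: \<eta>_def)
      then show ?thesis
        unfolding LIMSEQ_def dist_norm by (meson nle_le)
    qed (use elim in \<open>simp add: \<eta>_def\<close>)
    then show ?case by (meson s(1) seq_suble order_trans)
  qed
  have "AE t in M. norm (\<eta> t) \<le> norm (L t)"
    using cl AE_space
  proof eventually_elim
    case (elim t)
    show ?case
    proof (rule field_le_epsilon)
      fix e :: real assume "0 < e"
      then obtain k where "norm (\<zeta> k t - \<eta> t) < e" using elim(1) by blast
      then show "norm (\<eta> t) \<le> norm (L t) + e"
        using \<zeta>_bound[OF elim(2), of k] norm_triangle_ineq2[of "\<eta> t" "\<zeta> k t"] by (simp add: norm_minus_commute)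
    qed
  qed
  then have i: "integrable M \<eta>" by (rule Bochner_Integration.integrable_bound[OF L_integrable \<eta>m])
  then have i2: "integrable M (\<lambda>t. indicator (space M - D) t *\<^sub>R \<eta>2 t)"
    using Bochner_Integration.integrable_diff[OF i i1] by (simp add: \<eta>_def)
  have "integral\<^sup>L M \<eta> = (\<integral>t. indicator D t *\<^sub>R \<eta>1 t \<partial>M) + (\<integral>t. indicator (space M - D) t *\<^sub>R \<eta>2 t \<partial>M)"
    unfolding \<eta>_def by (rule Bochner_Integration.integral_add[OF i1 i2])
  then have "integral\<^sup>L M \<eta> = z"
    using \<eta>2(2) by (simp add: integral_restrict_space[OF Om])
  with i cl that show ?thesis by blast
qed

end

section \<open>Subgradients of integral functionals\<close>

text \<open>u is approximated by measurable functions with values in a countable dense subset of K,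
  for which the composition is a countable case distinction.\<close>

lemma Caratheodory_measurable:
  fixes g :: "'t \<Rightarrow> 'a::euclidean_space \<Rightarrow> 'b::metric_space"
  assumes g: "\<And>x. x \<in> K \<Longrightarrow> (\<lambda>t. g t x) \<in> borel_measurable M"
    and cont: "\<And>t. t \<in> space M \<Longrightarrow> continuous_on K (g t)"
    and u[measurable]: "u \<in> borel_measurable M" and uK: "\<And>t. t \<in> space M \<Longrightarrow> u t \<in> K"
  shows "(\<lambda>t. g t (u t)) \<in> borel_measurable M"
proof (cases "K = {}")
  case True
  then have "space M = {}" using uK by auto
  then show ?thesis by (simp add: measurable_def)
next
  case False
  obtain d :: "nat \<Rightarrow> 'a" where "range d \<subseteq> K" and dense: "K \<subseteq> closure (range d)" by (rule dense_sequence[OF False])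
  then have d: "d i \<in> K" for i by auto
  define \<kappa> where "\<kappa> j t = (LEAST i. dist (d i) (u t) < 1 / Suc j)" for j t
  have \<kappa>m: "\<kappa> j \<in> measurable M (count_space UNIV)" for j
    unfolding \<kappa>_def by measurable
  have \<kappa>: "dist (d (\<kappa> j t)) (u t) < 1 / Suc j" if t: "t \<in> space M" for j t
  proof -
    have "\<exists>i. dist (d i) (u t) < 1 / Suc j"
      using dense uK[OF t] closure_approachable[of "u t" "range d"] by auto
    then show ?thesis unfolding \<kappa>_def by (rule LeastI_ex)
  qed
  show ?thesis
  proof (rule borel_measurable_LIMSEQ_metric)
    show "(\<lambda>t. g t (d (\<kappa> j t))) \<in> borel_measurable M" for j
      by (rule measurable_compose_countable[of "\<lambda>i t. g t (d i)", OF g[OF d] \<kappa>m])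
    fix t assume t: "t \<in> space M"
    have "(\<lambda>j. d (\<kappa> j t)) \<longlonglongrightarrow> u t"
    proof (rule metric_tendsto_imp_tendsto[OF LIMSEQ_inverse_real_of_nat])
      show "\<forall>\<^sub>F j in sequentially. dist (d (\<kappa> j t)) (u t) \<le> dist (inverse (real (Suc j))) 0"
        using \<kappa>[OF t] by (intro always_eventually allI) (simp add: less_imp_le inverse_eq_divide)
    qed
    then show "(\<lambda>j. g t (d (\<kappa> j t))) \<longlonglongrightarrow> g t (u t)"
      by (rule continuous_on_tendsto_compose[OF cont[OF t] _ uK[OF t]]) (use d in auto)
  qed
qed

lemma quadratic_le_linear:
  fixes C \<epsilon> x :: real
  assumes "0 < \<epsilon>" "0 \<le> x" "x \<le> \<epsilon> / (\<bar>C\<bar> + 1)"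
  shows "C * x\<^sup>2 \<le> \<epsilon> * x"
proof -
  have "C * x \<le> (\<bar>C\<bar> + 1) * (\<epsilon> / (\<bar>C\<bar> + 1))" using assms by (intro mult_mono) auto
  also have "\<dots> = \<epsilon>" using abs_ge_zero[of C] by (simp add: add_nonneg_eq_0_iff)
  finally have "C * x * x \<le> \<epsilon> * x" using assms(2) by (rule mult_right_mono)
  then show ?thesis by (simp add: power2_eq_square)
qed

lemma first_order_condition:
  fixes w :: "'a::real_inner"
  assumes d: "0 < d" and le: "\<And>h. norm h < d \<Longrightarrow> 0 \<le> w \<bullet> h + C * (norm h)\<^sup>2"
  shows "w = 0"
proof (rule ccontr)
  assume w: "w \<noteq> 0"
  \<comment> \<open>The test vector -\<tau> w must stay inside the ball, and C \<tau> must stay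
    below 1, so that the linear term beats the quadratic one.\<close>
  define \<tau> where "\<tau> = min (d / (2 * norm w)) (1 / (2 * (\<bar>C\<bar> + 1)))"
  have \<tau>: "0 < \<tau>" "\<tau> \<le> d / (2 * norm w)" "\<tau> \<le> 1 / (2 * (\<bar>C\<bar> + 1))"
    using d w by (auto simp: \<tau>_def)
  have "norm (- \<tau> *\<^sub>R w) < d"
  proof -
    have "\<tau> * norm w \<le> d / (2 * norm w) * norm w" using \<tau>(2) by (rule mult_right_mono) simp
    also have "\<dots> = d / 2" using w by simp
    finally show ?thesis using d \<tau>(1) by simp
  qed
  from le[OF this] have "\<tau> * (norm w)\<^sup>2 \<le> C * \<tau>\<^sup>2 * (norm w)\<^sup>2"
    using \<tau>(1) by (simp add: power_mult_distrib power2_norm_eq_inner)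
  then have "\<tau> \<le> C * \<tau>\<^sup>2" using w by simp
  then have "1 \<le> C * \<tau>" using \<tau>(1) by (simp add: power2_eq_square)
  also have "\<dots> \<le> (\<bar>C\<bar> + 1) * (1 / (2 * (\<bar>C\<bar> + 1)))"
    using \<tau> by (intro mult_mono) auto
  also have "\<dots> = 1 / 2"
  proof -
    have "\<bar>C\<bar> + 1 \<noteq> 0" by linarith
    then show ?thesis by (simp add: field_simps)
  qed
  finally show False by simp
qed

section \<open>Moreau envelopes of a Lipschitz integrand\<close>

locale lipschitz_integrand = finite_measure M for M :: "'t measure" +
  fixes g :: "'t \<Rightarrow> 'a::euclidean_space \<Rightarrow> real" and a :: 'a and r :: real and L :: "'t \<Rightarrow> real"
  assumes r: "0 < r"
    and g_measurable: "\<And>x. x \<in> cball a r \<Longrightarrow> (\<lambda>t. g t x) \<in> borel_measurable M"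
    and g_lipschitz: "\<And>t x y. t \<in> space M \<Longrightarrow> x \<in> cball a r \<Longrightarrow> y \<in> cball a r \<Longrightarrow>
           \<bar>g t x - g t y\<bar> \<le> L t * norm (x - y)"
    and L_pos: "\<And>t. t \<in> space M \<Longrightarrow> 0 < L t"
    and L_int: "integrable M L"
    and g_integrable_center: "integrable M (\<lambda>t. g t a)"
begin

lemma L_meas[measurable]: "L \<in> borel_measurable M"
  using L_int by auto

lemma integral_L_nonneg: "0 \<le> integral\<^sup>L M L"
  using L_pos by (intro integral_nonneg_AE AE_I2 less_imp_le)

lemma g_continuous: "t \<in> space M \<Longrightarrow> continuous_on (cball a r) (g t)"
  using g_lipschitz L_pos
  by (intro lipschitz_on_continuous_on[of "L t"] lipschitz_onI)
    (auto simp: dist_norm less_imp_le)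

lemma g_integrable:
  assumes x: "x \<in> cball a r" shows "integrable M (\<lambda>t. g t x)"
proof (rule Bochner_Integration.integrable_bound)
  show "integrable M (\<lambda>t. \<bar>g t a\<bar> + L t * norm (x - a))"
    using g_integrable_center L_int by auto
  show "AE t in M. norm (g t x) \<le> norm (\<bar>g t a\<bar> + L t * norm (x - a))"
  proof (rule AE_I2)
    fix t assume t: "t \<in> space M"
    have "\<bar>g t x - g t a\<bar> \<le> L t * norm (x - a)" using g_lipschitz[OF t x, of a] r by simp
    then show "norm (g t x) \<le> norm (\<bar>g t a\<bar> + L t * norm (x - a))" by (simp add: abs_le_iff) linarith
  qed
qed (use g_measurable[OF x] in auto)

definition G :: "'a \<Rightarrow> real" where "G x = (\<integral>t. g t x \<partial>M)"

text \<open>The penalty term is weighted by \<open>L\<close>, so that it is integrable and minimizers stay within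
  distance \<open>2 / K\<close> of \<open>x\<close> uniformly in \<open>t\<close>.\<close>

definition penalized :: "real \<Rightarrow> 'a \<Rightarrow> 't \<Rightarrow> 'a \<Rightarrow> real" where
  "penalized K x t u = g t u + K * L t / 2 * (norm (u - x))\<^sup>2"

lemma penalized_argmin:
  assumes K: "0 < K"
  obtains u where "u \<in> borel_measurable M" "\<And>t. t \<in> space M \<Longrightarrow> u t \<in> cball a r"
    "\<And>t y. t \<in> space M \<Longrightarrow> y \<in> cball a r \<Longrightarrow> penalized K x t (u t) \<le> penalized K x t y"
proof (rule measurable_argmin[of "cball a r" "penalized K x" M])
  show "(\<lambda>t. penalized K x t y) \<in> borel_measurable M" if "y \<in> cball a r" for y
    unfolding penalized_def using g_measurable[OF that] by measurable
  show "continuous_on (cball a r) (penalized K x t)" if "t \<in> space M" for t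
    unfolding penalized_def by (intro continuous_intros g_continuous[OF that])
qed (use r in \<open>auto intro: that\<close>)

text \<open>Minimizers need not be unique, and a pointwise choice could fail to be measurable in t.
  Therefore a measurable function is chosen as a whole.\<close>

definition prox :: "real \<Rightarrow> 'a \<Rightarrow> 't \<Rightarrow> 'a" where
  "prox K x = (SOME u. u \<in> borel_measurable M \<and> (\<forall>t\<in>space M. u t \<in> cball a r \<and>
     (\<forall>y\<in>cball a r. penalized K x t (u t) \<le> penalized K x t y)))"

definition envelope :: "real \<Rightarrow> 'a \<Rightarrow> 't \<Rightarrow> real" where
  "envelope K x t = penalized K x t (prox K x t)"

context
  fixes K :: real assumes K: "0 < K"
begin

lemma prox: "prox K x \<in> borel_measurable M \<and> (\<forall>t\<in>space M. prox K x t \<in> cball a r \<and>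
     (\<forall>y\<in>cball a r. penalized K x t (prox K x t) \<le> penalized K x t y))"
proof -
  obtain u where u: "u \<in> borel_measurable M" "\<And>t. t \<in> space M \<Longrightarrow> u t \<in> cball a r"
    "\<And>t y. t \<in> space M \<Longrightarrow> y \<in> cball a r \<Longrightarrow> penalized K x t (u t) \<le> penalized K x t y"
    by (rule penalized_argmin[OF K, of x]) (rule that)
  show ?thesis unfolding prox_def by (rule someI[of _ u]) (use u in blast)
qed

lemma prox_measurable[measurable]: "prox K x \<in> borel_measurable M"
  and prox_in: "t \<in> space M \<Longrightarrow> prox K x t \<in> cball a r"
  and envelope_le: "t \<in> space M \<Longrightarrow> y \<in> cball a r \<Longrightarrow> envelope K x t \<le> penalized K x t y"
  using prox by (auto simp: envelope_def)

lemma envelope_measurable[measurable]: "envelope K x \<in> borel_measurable M"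
proof -
  have [measurable]: "(\<lambda>t. g t (prox K x t)) \<in> borel_measurable M"
    by (rule Caratheodory_measurable[OF g_measurable g_continuous prox_measurable prox_in])
  show ?thesis unfolding envelope_def penalized_def by measurable
qed

lemma envelope_upper: "t \<in> space M \<Longrightarrow> x \<in> cball a r \<Longrightarrow> envelope K x t \<le> g t x"
  using envelope_le[of t x x] by (simp add: penalized_def)

lemma envelope_lower:
  assumes t: "t \<in> space M" and x: "x \<in> cball a r"
  shows "g t x - L t / (2 * K) \<le> envelope K x t"
proof -
  let ?d = "norm (prox K x t - x)"
  have "g t x - L t * ?d \<le> g t (prox K x t)"
    using g_lipschitz[OF t prox_in[OF t] x, of x] by (simp add: abs_le_iff)
  \<comment> \<open>Completing the square: K L d^2 / 2 - L d is smallest at d = 1 / K, with value -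
    L / (2 K).\<close>
  moreover have "0 \<le> K * L t / 2 * (?d - 1 / K)\<^sup>2" using K L_pos[OF t] by simp
  moreover have "K * L t / 2 * (?d - 1 / K)\<^sup>2 = K * L t / 2 * ?d\<^sup>2 - L t * ?d + L t / (2 * K)"
    using K by (simp add: power2_eq_square field_simps)
  ultimately show ?thesis by (simp add: envelope_def penalized_def)
qed

lemma prox_dist:
  assumes t: "t \<in> space M" and x: "x \<in> cball a r"
  shows "norm (prox K x t - x) \<le> 2 / K"
proof -
  let ?d = "norm (prox K x t - x)"
  have "g t (prox K x t) + K * L t / 2 * ?d\<^sup>2 \<le> g t x"
    using envelope_upper[OF t x] by (simp add: envelope_def penalized_def)
  moreover have "g t x - L t * ?d \<le> g t (prox K x t)"
    using g_lipschitz[OF t prox_in[OF t] x, of x] by (simp add: abs_le_iff)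
  ultimately have "L t * (K / 2 * ?d * ?d) \<le> L t * ?d" by (simp add: power2_eq_square algebra_simps)
  then have "K / 2 * ?d * ?d \<le> 1 * ?d" using L_pos[OF t] by simp
  then have "K / 2 * ?d \<le> 1 \<or> ?d = 0" by (metis mult_right_le_imp_le norm_ge_zero order_le_less)
  then show ?thesis using K by (auto simp: field_simps)
qed

lemma envelope_integrable:
  assumes x: "x \<in> cball a r" shows "integrable M (envelope K x)"
proof (rule Bochner_Integration.integrable_bound)
  show "integrable M (\<lambda>t. \<bar>g t x\<bar> + L t / (2 * K))" using g_integrable[OF x] L_int by auto
  show "AE t in M. norm (envelope K x t) \<le> norm (\<bar>g t x\<bar> + L t / (2 * K))"
  proof (rule AE_I2)
    fix t assume t: "t \<in> space M"
    have "0 \<le> L t / (2 * K)" using L_pos[OF t] K by simp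
    then show "norm (envelope K x t) \<le> norm (\<bar>g t x\<bar> + L t / (2 * K))"
      using envelope_upper[OF t x] envelope_lower[OF t x] by (simp add: abs_le_iff) linarith
  qed
qed simp

definition envelope_integral :: "'a \<Rightarrow> real" where
  "envelope_integral x = (\<integral>t. envelope K x t \<partial>M)"

lemma envelope_integral_upper: "x \<in> cball a r \<Longrightarrow> envelope_integral x \<le> G x"
  unfolding envelope_integral_def G_def
  by (intro integral_mono envelope_integrable g_integrable envelope_upper)

lemma envelope_integral_lower:
  assumes x: "x \<in> cball a r" shows "G x - integral\<^sup>L M L / (2 * K) \<le> envelope_integral x"
proof -
  have "(\<integral>t. g t x - L t / (2 * K) \<partial>M) \<le> envelope_integral x"
    unfolding envelope_integral_def
    by (intro integral_mono envelope_integrable envelope_lower x) (use g_integrable[OF x] L_int in auto)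
  then show ?thesis using g_integrable[OF x] L_int by (simp add: G_def)
qed

text \<open>The proximal points of x are used as competitors at y. This gives a quadratic upper
  bound that touches at x; at a minimizer such a one-sided bound already yields the first-order
  condition, although the envelope may fail to be differentiable.\<close>

lemma envelope_integral_majorant:
  assumes x: "x \<in> cball a r" "y \<in> cball a r"
  shows "integrable M (\<lambda>t. (K * L t) *\<^sub>R (x - prox K x t))" (is ?int)
    and "envelope_integral y \<le> envelope_integral x
      + (\<integral>t. (K * L t) *\<^sub>R (x - prox K x t) \<partial>M) \<bullet> (y - x) + K * integral\<^sup>L M L / 2 * (norm (y - x))\<^sup>2"
proof -
  show int: ?int
  proof (rule Bochner_Integration.integrable_bound[of _ "\<lambda>t. 2 * L t"])
    show "AE t in M. norm ((K * L t) *\<^sub>R (x - prox K x t)) \<le> norm (2 * L t)"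
    proof (rule AE_I2)
      fix t assume t: "t \<in> space M"
      have "(K * L t) * norm (prox K x t - x) \<le> (K * L t) * (2 / K)"
        using K L_pos[OF t] by (intro mult_left_mono prox_dist t x) auto
      then show "norm ((K * L t) *\<^sub>R (x - prox K x t)) \<le> norm (2 * L t)"
        using K L_pos[OF t] by (simp add: norm_minus_commute)
    qed
  qed (use L_int in auto)
  let ?h = "y - x"
  have "envelope_integral y \<le> (\<integral>t. envelope K x t + ((K * L t) *\<^sub>R (x - prox K x t)) \<bullet> ?h
      + L t * (K / 2 * (norm ?h)\<^sup>2) \<partial>M)"
    unfolding envelope_integral_def
  proof (rule integral_mono[OF envelope_integrable[OF x(2)]])
    fix t assume t: "t \<in> space M"
    let ?u = "prox K x t"
    have "(norm (?u - y))\<^sup>2 = (norm (?u - x))\<^sup>2 + 2 * ((x - ?u) \<bullet> ?h) + (norm ?h)\<^sup>2"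
      by (simp add: power2_norm_eq_inner inner_diff_left inner_diff_right inner_commute)
    note eq = this
    have "penalized K y t ?u = envelope K x t + ((K * L t) *\<^sub>R (x - ?u)) \<bullet> ?h + L t * (K / 2 * (norm ?h)\<^sup>2)"
      unfolding penalized_def envelope_def eq inner_scaleR_left by (simp add: ring_distribs)
    then show "envelope K y t \<le> envelope K x t + ((K * L t) *\<^sub>R (x - ?u)) \<bullet> ?h + L t * (K / 2 * (norm ?h)\<^sup>2)"
      using envelope_le[OF t prox_in[OF t], of y x] by simp
  qed (intro Bochner_Integration.integrable_add envelope_integrable[OF x(1)] integrable_inner_left int
      integrable_mult_left L_int)
  also have "\<dots> = envelope_integral x
      + (\<integral>t. (K * L t) *\<^sub>R (x - prox K x t) \<partial>M) \<bullet> ?h + integral\<^sup>L M L * (K / 2 * (norm ?h)\<^sup>2)"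
  proof -
    define \<zeta> c where "\<zeta> t = (K * L t) *\<^sub>R (x - prox K x t)" and "c = K / 2 * (norm ?h)\<^sup>2" for t
    have "integrable M \<zeta>" unfolding \<zeta>_def by (rule int)
    then have "(\<integral>t. envelope K x t + \<zeta> t \<bullet> ?h + L t * c \<partial>M)
        = envelope_integral x + integral\<^sup>L M \<zeta> \<bullet> ?h + integral\<^sup>L M L * c"
      using envelope_integrable[OF x(1)] L_int by (simp add: envelope_integral_def)
    then show ?thesis by (simp only: \<zeta>_def[abs_def] c_def)
  qed
  finally show "envelope_integral y \<le> envelope_integral x
      + (\<integral>t. (K * L t) *\<^sub>R (x - prox K x t) \<partial>M) \<bullet> (y - x) + K * integral\<^sup>L M L / 2 * (norm (y - x))\<^sup>2"
    by (simp add: algebra_simps)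
qed

lemma envelope_integral_continuous: "continuous_on (cball a r) envelope_integral"
proof -
  have 1: "envelope_integral y - envelope_integral x \<le> (2 * integral\<^sup>L M L + K * integral\<^sup>L M L * r) * norm (y - x)"
    if x: "x \<in> cball a r" and y: "y \<in> cball a r" for x y
  proof -
    let ?z = "\<integral>t. (K * L t) *\<^sub>R (x - prox K x t) \<partial>M"
    have "norm ?z \<le> (\<integral>t. 2 * L t \<partial>M)"
    proof (rule order_trans[OF integral_norm_bound integral_mono])
      show "integrable M (\<lambda>t. norm ((K * L t) *\<^sub>R (x - prox K x t)))"
        by (rule integrable_norm[OF envelope_integral_majorant(1)[OF x x]])
      fix t assume t: "t \<in> space M"
      have "(K * L t) * norm (prox K x t - x) \<le> (K * L t) * (2 / K)"
        using K L_pos[OF t] by (intro mult_left_mono prox_dist t x) auto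
      then show "norm ((K * L t) *\<^sub>R (x - prox K x t)) \<le> 2 * L t"
        using K L_pos[OF t] by (simp add: norm_minus_commute)
    qed (use L_int in auto)
    then have "?z \<bullet> (y - x) \<le> 2 * integral\<^sup>L M L * norm (y - x)"
      using norm_cauchy_schwarz[of ?z "y - x"] mult_right_mono[of "norm ?z" "2 * integral\<^sup>L M L" "norm (y - x)"] by simp
    moreover have "K * integral\<^sup>L M L / 2 * (norm (y - x))\<^sup>2 \<le> K * integral\<^sup>L M L * r * norm (y - x)"
    proof -
      have "norm (y - x) \<le> 2 * r"
        using x y dist_triangle[of y x a] by (simp add: dist_norm norm_minus_commute)
      then have "(norm (y - x))\<^sup>2 \<le> 2 * r * norm (y - x)" by (simp add: power2_eq_square mult_right_mono)
      then have "K * integral\<^sup>L M L / 2 * (norm (y - x))\<^sup>2 \<le> K * integral\<^sup>L M L / 2 * (2 * r * norm (y - x))"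
        using K integral_L_nonneg by (intro mult_left_mono) auto
      then show ?thesis by simp
    qed
    ultimately show ?thesis using envelope_integral_majorant(2)[OF x y] by (simp add: algebra_simps)
  qed
  show ?thesis
  proof (rule lipschitz_on_continuous_on[of "2 * integral\<^sup>L M L + K * integral\<^sup>L M L * r"], rule lipschitz_onI)
    fix x y assume xy: "x \<in> cball a r" "y \<in> cball a r"
    from 1[OF xy] 1[OF xy(2,1)]
    show "dist (envelope_integral x) (envelope_integral y) \<le> (2 * integral\<^sup>L M L + K * integral\<^sup>L M L * r) * dist x y"
      by (simp add: dist_norm norm_minus_commute abs_le_iff)
  qed (use K integral_L_nonneg r in simp)
qed

text \<open>Minimality of the proximal point, expanded around it, exhibits K L t (x -
  \<open>prox K x t\<close>) as a proximal subgradient of g t there.\<close>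

lemma prox_subgradient:
  assumes t: "t \<in> space M" and y: "y \<in> cball a r"
  shows "g t (prox K x t) + ((K * L t) *\<^sub>R (x - prox K x t)) \<bullet> (y - prox K x t)
     - K * L t / 2 * (norm (y - prox K x t))\<^sup>2 \<le> g t y"
proof -
  let ?u = "prox K x t"
  have "(norm (y - x))\<^sup>2 = (norm (y - ?u))\<^sup>2 - 2 * ((x - ?u) \<bullet> (y - ?u)) + (norm (?u - x))\<^sup>2"
    by (simp add: power2_norm_eq_inner inner_diff_left inner_diff_right inner_commute)
  note eq = this
  have "penalized K x t y = g t y + K * L t / 2 * (norm (y - ?u))\<^sup>2
      - ((K * L t) *\<^sub>R (x - ?u)) \<bullet> (y - ?u) + K * L t / 2 * (norm (?u - x))\<^sup>2"
    unfolding penalized_def eq inner_scaleR_left by (simp add: ring_distribs)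
  moreover have "envelope K x t = g t ?u + K * L t / 2 * (norm (?u - x))\<^sup>2"
    by (simp add: envelope_def penalized_def)
  ultimately show ?thesis using envelope_le[OF t y, of x] by linarith
qed

end

text \<open>The envelopes integrate to G up to \<integral> L / (2 K). After subtracting the linear
  part z and adding a quadratic well, the minimum over a small ball is attained inside it, and the
  first-order condition at the minimizer equates \<integral> \<zeta> with z up to the gradient of
  the well. Since each \<zeta> t is L t times a quantity bounded by 2, a bound independent of K
  survives.\<close>

theorem fuzzy_Leibniz:
  assumes \<epsilon>: "0 < \<epsilon>" and \<delta>: "0 < \<delta>"
    and ineq: "\<And>x. x \<in> cball a r \<Longrightarrow> norm (x - a) \<le> \<delta> \<Longrightarrow> G a + z \<bullet> (x - a) - \<epsilon> * norm (x - a) \<le> G x"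
  obtains u \<zeta> K where "u \<in> borel_measurable M" "integrable M \<zeta>"
    "\<And>t. t \<in> space M \<Longrightarrow> norm (u t - a) \<le> \<epsilon>" "\<And>t. t \<in> space M \<Longrightarrow> u t \<in> ball a r"
    "\<And>t. t \<in> space M \<Longrightarrow> norm (\<zeta> t) \<le> 2 * L t"
    "\<And>t y. t \<in> space M \<Longrightarrow> y \<in> cball a r \<Longrightarrow>
        g t (u t) + \<zeta> t \<bullet> (y - u t) - K t * (norm (y - u t))\<^sup>2 \<le> g t y"
    "norm (integral\<^sup>L M \<zeta> - z) \<le> 4 * \<epsilon>"
proof -
  define d where "d = min \<delta> (min (r / 4) (\<epsilon> / 2))"
  have d: "0 < d" "d \<le> \<delta>" "d \<le> r / 4" "d \<le> \<epsilon> / 2" using \<epsilon> \<delta> r by (auto simp: d_def)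
  \<comment> \<open>The first three summands give, in turn, 2 / K \<le> r / 4, 2 / K \<le>
    \<epsilon> / 2 and an envelope error below \<epsilon> d.\<close>
  define K where "K = 8 / r + 4 / \<epsilon> + integral\<^sup>L M L / (\<epsilon> * d) + 1"
  have rest: "0 \<le> 8 / r" "0 \<le> 4 / \<epsilon>" "0 \<le> integral\<^sup>L M L / (\<epsilon> * d)"
    using r \<epsilon> d integral_L_nonneg by auto
  have K: "0 < K" "8 / r \<le> K" "4 / \<epsilon> \<le> K" "integral\<^sup>L M L / (\<epsilon> * d) < K"
    unfolding K_def using rest by linarith+
  have K': "2 / K \<le> r / 4" "2 / K \<le> \<epsilon> / 2" "integral\<^sup>L M L / (2 * K) < \<epsilon> * d"
    using K r \<epsilon> d integral_L_nonneg by (simp_all add: field_simps)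
  have sub: "cball a d \<subseteq> cball a r" using d r by auto
  \<comment> \<open>On the sphere of radius d the well contributes 2 \<epsilon> d, which beats the
    loss \<epsilon> d in the hypothesis together with the envelope error below \<epsilon> d. Inside,
    its gradient has norm at most 4 \<epsilon>.\<close>
  define s where "s x = - (z \<bullet> (x - a)) + 2 * \<epsilon> / d * (norm (x - a))\<^sup>2" for x
  define H where "H x = envelope_integral K x + s x" for x
  have "continuous_on (cball a d) H"
    unfolding H_def s_def
    by (intro continuous_intros continuous_on_subset[OF envelope_integral_continuous[OF K(1)] sub])
  then obtain x where x: "x \<in> cball a d" and min: "\<And>y. y \<in> cball a d \<Longrightarrow> H x \<le> H y"
    using continuous_attains_inf[of "cball a d" H] d(1) by force
  have ar: "a \<in> cball a r" using r by simp
  have xr: "x \<in> cball a r" using x sub by auto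
  have "norm (x - a) \<noteq> d"
  proof
    assume eq: "norm (x - a) = d"
    have "G a + z \<bullet> (x - a) - \<epsilon> * d \<le> G x" using ineq[OF xr] eq d(2) by simp
    moreover have "G x - integral\<^sup>L M L / (2 * K) \<le> envelope_integral K x"
      by (rule envelope_integral_lower[OF K(1) xr])
    moreover have "s x = - (z \<bullet> (x - a)) + 2 * (\<epsilon> * d)" using d(1) eq by (simp add: s_def power2_eq_square)
    ultimately have "G a < H x" using K'(3) unfolding H_def by linarith
    moreover have "H x \<le> H a" by (rule min) (use d in simp)
    moreover have "H a \<le> G a" using envelope_integral_upper[OF K(1) ar] by (simp add: H_def s_def)
    ultimately show False by simp
  qed
  then have xd: "norm (x - a) < d" using x by (simp add: dist_norm norm_minus_commute)
  define \<zeta> where "\<zeta> t = (K * L t) *\<^sub>R (x - prox K x t)" for t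
  have \<zeta>i: "integrable M \<zeta>" unfolding \<zeta>_def by (rule envelope_integral_majorant(1)[OF K(1) xr xr])
  have "integral\<^sup>L M \<zeta> - z + (4 * \<epsilon> / d) *\<^sub>R (x - a) = 0"
  proof (rule first_order_condition[of "d - norm (x - a)" _ "K * integral\<^sup>L M L / 2 + 2 * \<epsilon> / d"])
    fix h :: 'a assume h: "norm h < d - norm (x - a)"
    have yd: "x + h \<in> cball a d"
      using h norm_triangle_ineq[of "x - a" h] by (simp add: dist_norm norm_minus_commute[of a] algebra_simps)
    then have yr: "x + h \<in> cball a r" using sub by auto
    have "envelope_integral K (x + h) \<le> envelope_integral K x + integral\<^sup>L M \<zeta> \<bullet> h + K * integral\<^sup>L M L / 2 * (norm h)\<^sup>2"
      using envelope_integral_majorant(2)[OF K(1) xr yr] by (simp add: \<zeta>_def[abs_def])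
    moreover have "s (x + h) = s x - z \<bullet> h + (4 * \<epsilon> / d) * ((x - a) \<bullet> h) + 2 * \<epsilon> / d * (norm h)\<^sup>2"
    proof -
      have "(norm (x + h - a))\<^sup>2 = (norm (x - a))\<^sup>2 + 2 * ((x - a) \<bullet> h) + (norm h)\<^sup>2"
        by (simp add: power2_norm_eq_inner inner_diff_left inner_diff_right inner_add_left inner_add_right inner_commute)
      then show ?thesis unfolding s_def by (simp add: inner_diff_right inner_add_right ring_distribs add_divide_distrib)
    qed
    ultimately show "0 \<le> (integral\<^sup>L M \<zeta> - z + (4 * \<epsilon> / d) *\<^sub>R (x - a)) \<bullet> h
        + (K * integral\<^sup>L M L / 2 + 2 * \<epsilon> / d) * (norm h)\<^sup>2"
      using min[OF yd] unfolding H_def by (simp add: inner_add_left inner_diff_left distrib_right)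
  qed (use xd in simp)
  then have "integral\<^sup>L M \<zeta> - z = - ((4 * \<epsilon> / d) *\<^sub>R (x - a))" by (simp add: eq_neg_iff_add_eq_0)
  then have "norm (integral\<^sup>L M \<zeta> - z) = (4 * \<epsilon> / d) * norm (x - a)" using \<epsilon> d(1) by simp
  also have "\<dots> \<le> (4 * \<epsilon> / d) * d" using \<epsilon> d(1) xd by (intro mult_left_mono) auto
  also have "\<dots> = 4 * \<epsilon>" using d(1) by simp
  finally have Iz: "norm (integral\<^sup>L M \<zeta> - z) \<le> 4 * \<epsilon>" .
  show ?thesis
  proof (rule that[of "prox K x" \<zeta> "\<lambda>t. K * L t / 2"])
    fix t assume t: "t \<in> space M"
    have tri: "norm (prox K x t - a) \<le> norm (prox K x t - x) + norm (x - a)"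
      using norm_triangle_ineq[of "prox K x t - x" "x - a"] by simp
    show "norm (prox K x t - a) \<le> \<epsilon>"
      using tri prox_dist[OF K(1) t xr] K'(2) xd d(4) by linarith
    show "prox K x t \<in> ball a r"
      using tri prox_dist[OF K(1) t xr] K'(1) xd d(3) r
      by (simp add: dist_norm norm_minus_commute[of a])
    have "(K * L t) * norm (prox K x t - x) \<le> (K * L t) * (2 / K)"
      using K L_pos[OF t] by (intro mult_left_mono prox_dist K t xr) auto
    then show "norm (\<zeta> t) \<le> 2 * L t"
      unfolding \<zeta>_def using K L_pos[OF t] by (simp add: norm_minus_commute)
    fix y assume "y \<in> cball a r"
    from prox_subgradient[OF K(1) t this, of x]
    show "g t (prox K x t) + \<zeta> t \<bullet> (y - prox K x t) - K * L t / 2 * (norm (y - prox K x t))\<^sup>2 \<le> g t y"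
      by (simp add: \<zeta>_def)
  qed (use prox_measurable[OF K(1)] \<zeta>i Iz in auto)
qed

text \<open>The hypothesis expresses, in \<epsilon>-form, that z is a limiting subgradient of G at
  a; the conclusion expresses the same for \<zeta> t and g t through proximal subgradients at nearby
  points. The fuzzy rule is applied around each b, and its bound 2 L makes the Fatou lemma
  applicable to the resulting sequence.\<close>

theorem Leibniz_rule:
  assumes approx: "\<And>\<epsilon>. 0 < \<epsilon> \<Longrightarrow> \<exists>b z' \<delta>. 0 < \<delta> \<and> norm (b - a) < \<epsilon> \<and> norm (z' - z) < \<epsilon> \<and>
      (\<forall>x. norm (x - b) \<le> \<delta> \<longrightarrow> G b + z' \<bullet> (x - b) - \<epsilon> * norm (x - b) \<le> G x)"
  obtains \<zeta> where "integrable M \<zeta>" "integral\<^sup>L M \<zeta> = z"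
    "AE t in M. \<forall>e>0. \<exists>u m C d. norm (u - a) < e \<and> norm (m - \<zeta> t) < e \<and> 0 < d \<and>
       (\<forall>y. norm (y - u) < d \<longrightarrow> g t u + m \<bullet> (y - u) - C * (norm (y - u))\<^sup>2 \<le> g t y)"
proof -
  \<comment> \<open>The bound r / 2 keeps the ball of radius r / 2 around the shifted centre b
    inside the original ball.\<close>
  define \<epsilon> where "\<epsilon> k = min (r / 2) (1 / Suc k)" for k
  have \<epsilon>: "0 < \<epsilon> k" "\<epsilon> k \<le> r / 2" "\<epsilon> k \<le> 1 / Suc k" for k using r by (auto simp: \<epsilon>_def)
  \<comment> \<open>The subgradient inequality is kept only on some small ball around u t, a form
    that no longer mentions the centre b, which varies with k.\<close>
  define Q where "Q k u \<zeta> K \<longleftrightarrow> u \<in> borel_measurable M \<and> integrable M \<zeta> \<and>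
      (\<forall>t\<in>space M. norm (u t - a) \<le> 2 * \<epsilon> k \<and> norm (\<zeta> t) \<le> 2 * L t \<and>
        (\<exists>d>0. \<forall>y. norm (y - u t) < d \<longrightarrow>
          g t (u t) + \<zeta> t \<bullet> (y - u t) - K t * (norm (y - u t))\<^sup>2 \<le> g t y)) \<and>
      norm (integral\<^sup>L M \<zeta> - z) \<le> 5 * \<epsilon> k" for k u \<zeta> K
  have "\<exists>u \<zeta> K. Q k u \<zeta> K" for k
  proof -
    obtain b z' \<delta> where b: "0 < \<delta>" "norm (b - a) < \<epsilon> k" "norm (z' - z) < \<epsilon> k"
      and ineq: "\<And>x. norm (x - b) \<le> \<delta> \<Longrightarrow> G b + z' \<bullet> (x - b) - \<epsilon> k * norm (x - b) \<le> G x"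
      using approx[OF \<epsilon>(1)] by blast
    have ball: "cball b (r / 2) \<subseteq> cball a r"
      using b(2) \<epsilon>(2)[of k] by (simp add: cball_subset_cball_iff dist_norm)
    have "b \<in> cball a r" using r by (intro subsetD[OF ball]) simp
    interpret b: lipschitz_integrand M g b "r / 2" L
    proof
      show "0 < r / 2" using r by simp
      show "(\<lambda>t. g t x) \<in> borel_measurable M" if "x \<in> cball b (r / 2)" for x
        by (rule g_measurable[OF subsetD[OF ball that]])
      show "\<bar>g t x - g t y\<bar> \<le> L t * norm (x - y)"
        if "t \<in> space M" "x \<in> cball b (r / 2)" "y \<in> cball b (r / 2)" for t x y
        by (rule g_lipschitz[OF that(1) subsetD[OF ball that(2)] subsetD[OF ball that(3)]])
    qed (rule L_pos L_int g_integrable \<open>b \<in> cball a r\<close> | assumption)+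
    obtain u \<zeta> K where u: "u \<in> borel_measurable M" "integrable M \<zeta>"
      "\<And>t. t \<in> space M \<Longrightarrow> norm (u t - b) \<le> \<epsilon> k" "\<And>t. t \<in> space M \<Longrightarrow> u t \<in> ball b (r / 2)"
      "\<And>t. t \<in> space M \<Longrightarrow> norm (\<zeta> t) \<le> 2 * L t"
      "\<And>t y. t \<in> space M \<Longrightarrow> y \<in> cball b (r / 2) \<Longrightarrow>
          g t (u t) + \<zeta> t \<bullet> (y - u t) - K t * (norm (y - u t))\<^sup>2 \<le> g t y"
      "norm (integral\<^sup>L M \<zeta> - z') \<le> 4 * \<epsilon> k"
      by (rule b.fuzzy_Leibniz[OF \<epsilon>(1)[of k] b(1) ineq]) (assumption, rule that)
    show ?thesis
      unfolding Q_def
    proof (rule exI[of _ u], rule exI[of _ \<zeta>], rule exI[of _ K], intro conjI ballI)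
      fix t assume t: "t \<in> space M"
      show "norm (u t - a) \<le> 2 * \<epsilon> k"
        using u(3)[OF t] b(2) norm_triangle_ineq[of "u t - b" "b - a"] by simp
      obtain d where d: "0 < d" "ball (u t) d \<subseteq> ball b (r / 2)"
        using openE[OF open_ball u(4)[OF t]] by blast
      have "y \<in> cball b (r / 2)" if "norm (y - u t) < d" for y
      proof -
        have "y \<in> ball (u t) d" using that by (simp add: dist_norm norm_minus_commute)
        then show ?thesis using d(2) ball_subset_cball by blast
      qed
      then show "\<exists>d>0. \<forall>y. norm (y - u t) < d \<longrightarrow>
          g t (u t) + \<zeta> t \<bullet> (y - u t) - K t * (norm (y - u t))\<^sup>2 \<le> g t y"
        using u(6)[OF t] d(1) by blast
    next
      show "norm (integral\<^sup>L M \<zeta> - z) \<le> 5 * \<epsilon> k"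
        using u(7) b(3) norm_triangle_ineq[of "integral\<^sup>L M \<zeta> - z'" "z' - z"] by simp
    qed (use u in auto)
  qed
  then obtain u \<zeta> K where Q: "\<And>k. Q k (u k) (\<zeta> k) (K k)" by metis
  have u: "\<And>k. u k \<in> borel_measurable M" "\<And>k. integrable M (\<zeta> k)"
      "\<And>k t. t \<in> space M \<Longrightarrow> norm (u k t - a) \<le> 2 * \<epsilon> k" "\<And>k t. t \<in> space M \<Longrightarrow> norm (\<zeta> k t) \<le> 2 * L t"
      "\<And>k t. t \<in> space M \<Longrightarrow> \<exists>d>0. \<forall>y. norm (y - u k t) < d \<longrightarrow>
          g t (u k t) + \<zeta> k t \<bullet> (y - u k t) - K k t * (norm (y - u k t))\<^sup>2 \<le> g t y"
      "\<And>k. norm (integral\<^sup>L M (\<zeta> k) - z) \<le> 5 * \<epsilon> k"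
    using Q unfolding Q_def by blast+
  have \<epsilon>0: "\<epsilon> \<longlonglongrightarrow> 0"
    by (rule tendsto_sandwich[OF _ _ tendsto_const inverse_Suc_tendsto_zero])
      (use \<epsilon> in \<open>auto intro!: always_eventually simp: less_imp_le\<close>)
  interpret \<zeta>: dominated_sequence M \<zeta> "\<lambda>t. 2 * L t"
    by unfold_locales (use u L_int in auto)
  have "(\<lambda>k. integral\<^sup>L M (\<zeta> k) - z) \<longlonglongrightarrow> 0"
    by (rule Lim_null_comparison[OF _ tendsto_mult_right_zero[OF \<epsilon>0, of 5]]) (use u(6) in auto)
  then have lim: "(\<lambda>k. integral\<^sup>L M (\<zeta> k)) \<longlonglongrightarrow> z" by (rule LIM_zero_cancel)
  obtain \<eta> where \<eta>: "integrable M \<eta>" "integral\<^sup>L M \<eta> = z"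
    "AE t in M. \<forall>e>0. \<forall>N. \<exists>k\<ge>N. norm (\<zeta> k t - \<eta> t) < e"
    by (rule \<zeta>.Fatou_several_dimensions[OF lim])
  have "AE t in M. \<forall>e>0. \<exists>u m C d. norm (u - a) < e \<and> norm (m - \<eta> t) < e \<and> 0 < d \<and>
       (\<forall>y. norm (y - u) < d \<longrightarrow> g t u + m \<bullet> (y - u) - C * (norm (y - u))\<^sup>2 \<le> g t y)"
    using \<eta>(3) AE_space
  proof eventually_elim
    case (elim t)
    show ?case
    proof (intro allI impI)
      fix e :: real assume e: "0 < e"
      have "\<forall>\<^sub>F k in sequentially. \<epsilon> k < e / 2" by (rule order_tendstoD(2)[OF \<epsilon>0]) (use e in simp)
      then obtain N where N: "\<And>k. k \<ge> N \<Longrightarrow> \<epsilon> k < e / 2" by (auto simp: eventually_sequentially)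
      obtain k where k: "k \<ge> N" "norm (\<zeta> k t - \<eta> t) < e" using elim(1) e by blast
      have "norm (u k t - a) < e" using u(3)[OF elim(2), of k] N[OF k(1)] by simp
      with u(5)[OF elim(2), of k] k(2)
      show "\<exists>u m C d. norm (u - a) < e \<and> norm (m - \<eta> t) < e \<and> 0 < d \<and>
       (\<forall>y. norm (y - u) < d \<longrightarrow> g t u + m \<bullet> (y - u) - C * (norm (y - u))\<^sup>2 \<le> g t y)" by blast
    qed
  qed
  with \<eta>(1,2) that show ?thesis by blast
qed

end

section \<open>Weakly convex functions\<close>

lemma regular_normal_coneI:
  assumes z0: "z0 \<in> \<Omega>"
    and le: "\<And>\<epsilon>. 0 < \<epsilon> \<Longrightarrow> \<exists>\<delta>>0. \<forall>z\<in>\<Omega>. norm (z - z0) < \<delta> \<longrightarrow> z' \<bullet> (z - z0) \<le> \<epsilon> * norm (z - z0)"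
  shows "z' \<in> regular_normal_cone z0 \<Omega>"
proof -
  have "Limsup (at z0 within \<Omega>) (\<lambda>z. ereal (z' \<bullet> (z - z0) / norm (z - z0))) \<le> 0"
    unfolding Limsup_le_iff
  proof (intro allI impI)
    fix y :: ereal assume "0 < y"
    then obtain e where e: "0 < ereal e" "ereal e < y" using ereal_dense2 by blast
    then obtain \<delta> where \<delta>: "0 < \<delta>" "\<And>z. z \<in> \<Omega> \<Longrightarrow> norm (z - z0) < \<delta> \<Longrightarrow> z' \<bullet> (z - z0) \<le> e * norm (z - z0)"
      using le[of e] by auto
    have "\<forall>z\<in>\<Omega>. z \<noteq> z0 \<and> dist z z0 < \<delta> \<longrightarrow> ereal (z' \<bullet> (z - z0) / norm (z - z0)) < y"
    proof (intro ballI impI)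
      fix z assume z: "z \<in> \<Omega>" "z \<noteq> z0 \<and> dist z z0 < \<delta>"
      then have "z' \<bullet> (z - z0) / norm (z - z0) \<le> e"
        using \<delta>(2)[of z] by (simp add: dist_norm pos_divide_le_eq)
      with e(2) show "ereal (z' \<bullet> (z - z0) / norm (z - z0)) < y"
        by (meson ereal_less_eq(3) order_le_less_trans)
    qed
    with \<delta>(1) show "\<forall>\<^sub>F z in at z0 within \<Omega>. ereal (z' \<bullet> (z - z0) / norm (z - z0)) < y"
      unfolding eventually_at by blast
  qed
  with z0 show ?thesis by (simp add: regular_normal_cone_def)
qed

lemma regular_normal_coneD:
  assumes z': "z' \<in> regular_normal_cone z0 \<Omega>"
  shows "z0 \<in> \<Omega>"
    and "0 < \<epsilon> \<Longrightarrow> \<exists>\<delta>>0. \<forall>z\<in>\<Omega>. norm (z - z0) < \<delta> \<longrightarrow> z' \<bullet> (z - z0) \<le> \<epsilon> * norm (z - z0)"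
proof -
  show "z0 \<in> \<Omega>" using z' by (auto simp: regular_normal_cone_def split: if_splits)
  assume \<epsilon>: "0 < \<epsilon>"
  have "Limsup (at z0 within \<Omega>) (\<lambda>z. ereal (z' \<bullet> (z - z0) / norm (z - z0))) \<le> 0"
    using z' by (auto simp: regular_normal_cone_def split: if_splits)
  then have "\<forall>\<^sub>F z in at z0 within \<Omega>. ereal (z' \<bullet> (z - z0) / norm (z - z0)) < ereal \<epsilon>"
    unfolding Limsup_le_iff using \<epsilon> by (metis ereal_less(2))
  then obtain \<delta> where \<delta>: "0 < \<delta>"
    "\<And>z. z \<in> \<Omega> \<Longrightarrow> z \<noteq> z0 \<Longrightarrow> dist z z0 < \<delta> \<Longrightarrow> z' \<bullet> (z - z0) / norm (z - z0) < \<epsilon>"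
    unfolding eventually_at by auto
  have "z' \<bullet> (z - z0) \<le> \<epsilon> * norm (z - z0)" if "z \<in> \<Omega>" "norm (z - z0) < \<delta>" for z
    using \<delta>(2)[OF that(1)] that(2) by (cases "z = z0") (auto simp: dist_norm pos_divide_less_eq)
  with \<delta>(1) show "\<exists>\<delta>>0. \<forall>z\<in>\<Omega>. norm (z - z0) < \<delta> \<longrightarrow> z' \<bullet> (z - z0) \<le> \<epsilon> * norm (z - z0)" by blast
qed

lemma regular_normal_cone_subset_limiting:
  "regular_normal_cone z0 \<Omega> \<subseteq> limiting_normal_cone z0 \<Omega>"
proof
  fix z' assume "z' \<in> regular_normal_cone z0 \<Omega>"
  then show "z' \<in> limiting_normal_cone z0 \<Omega>"
    unfolding limiting_normal_cone_def
    by (intro CollectI exI[of _ "\<lambda>_. z0"] exI[of _ "\<lambda>_. z'"]) simp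
qed

lemma epi_regular_normalI:
  assumes u: "f u = ereal \<alpha>"
    and le: "\<And>\<epsilon>. 0 < \<epsilon> \<Longrightarrow> \<exists>\<delta>>0. \<forall>v \<beta>. norm (v - u) < \<delta> \<longrightarrow> f v \<le> ereal \<beta> \<longrightarrow> \<alpha> + y \<bullet> (v - u) - \<epsilon> * norm (v - u) \<le> \<beta>"
  shows "(y, -1) \<in> regular_normal_cone (u, \<alpha>) (epi f)"
proof (rule regular_normal_coneI)
  show "(u, \<alpha>) \<in> epi f" using u by (simp add: epi_def)
  fix \<epsilon> :: real assume \<epsilon>: "0 < \<epsilon>"
  obtain \<delta> where \<delta>: "0 < \<delta>"
    "\<And>v \<beta>. norm (v - u) < \<delta> \<Longrightarrow> f v \<le> ereal \<beta> \<Longrightarrow> \<alpha> + y \<bullet> (v - u) - \<epsilon> * norm (v - u) \<le> \<beta>"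
    using le[OF \<epsilon>] by blast
  have "(y, -1) \<bullet> (z - (u, \<alpha>)) \<le> \<epsilon> * norm (z - (u, \<alpha>))"
    if z: "z \<in> epi f" "norm (z - (u, \<alpha>)) < \<delta>" for z
  proof -
    obtain v \<beta> where zv: "z = (v, \<beta>)" by (cases z)
    have n: "norm (v - u) \<le> norm (z - (u, \<alpha>))" by (simp add: zv norm_fst_le)
    have "\<alpha> + y \<bullet> (v - u) - \<epsilon> * norm (v - u) \<le> \<beta>"
      by (rule \<delta>(2)) (use n z in \<open>auto simp: zv epi_def\<close>)
    moreover have "\<epsilon> * norm (v - u) \<le> \<epsilon> * norm (z - (u, \<alpha>))" using n \<epsilon> by (intro mult_left_mono) auto
    ultimately show ?thesis by (simp add: zv inner_prod_def)
  qed
  with \<delta>(1) show "\<exists>\<delta>>0. \<forall>z\<in>epi f. norm (z - (u, \<alpha>)) < \<delta> \<longrightarrow>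
      (y, -1) \<bullet> (z - (u, \<alpha>)) \<le> \<epsilon> * norm (z - (u, \<alpha>))" by blast
qed

lemma le_by_epsilon_multiple:
  fixes x y c :: real
  assumes c: "0 \<le> c" and "\<And>\<epsilon>. 0 < \<epsilon> \<Longrightarrow> x \<le> y + \<epsilon> * c"
  shows "x \<le> y"
proof (rule field_le_epsilon)
  fix e :: real assume "0 < e"
  with assms(2)[of "e / (c + 1)"] c have "x \<le> y + e / (c + 1) * c" by simp
  also have "e / (c + 1) * c \<le> e" using \<open>0 < e\<close> c by (simp add: field_simps)
  finally show "x \<le> y + e" by simp
qed

text \<open>The assumption \<open>wc\<close> is convexity of h + L/2 |.|^2 on the ball, written out.
  One constant L serves for this and for the Lipschitz bound.\<close>

locale weakly_convex =
  fixes h :: "'a::euclidean_space \<Rightarrow> real" and a :: 'a and r L :: real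
  assumes r: "0 < r" and L: "0 < L"
    and lip: "\<And>x y. x \<in> cball a r \<Longrightarrow> y \<in> cball a r \<Longrightarrow> \<bar>h x - h y\<bar> \<le> L * norm (x - y)"
    and wc: "\<And>u v s. u \<in> cball a r \<Longrightarrow> v \<in> cball a r \<Longrightarrow> 0 \<le> s \<Longrightarrow> s \<le> 1 \<Longrightarrow>
        h ((1 - s) *\<^sub>R u + s *\<^sub>R v) \<le> (1 - s) * h u + s * h v + L / 2 * (s * (1 - s)) * (norm (u - v))\<^sup>2"
begin

text \<open>The inequality is imposed on the whole ball and with the fixed modulus L. Weak convexity
  makes this agree with local notions of subgradient, and in this form it passes to limits.\<close>

definition prox_subdiff :: "'a \<Rightarrow> 'a set" where
  "prox_subdiff u = {y. \<forall>v\<in>cball a r. h u + y \<bullet> (v - u) - L / 2 * (norm (v - u))\<^sup>2 \<le> h v}"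

lemma h_continuous: "continuous_on (cball a r) h"
  using lip L by (intro lipschitz_on_continuous_on[of L] lipschitz_onI) (auto simp: dist_norm)

lemma segment_in: "u \<in> cball a r \<Longrightarrow> v \<in> cball a r \<Longrightarrow> 0 \<le> s \<Longrightarrow> s \<le> 1 \<Longrightarrow> (1 - s) *\<^sub>R u + s *\<^sub>R v \<in> cball a r"
  using convex_cball[of a r] unfolding convex_alt by blast

text \<open>A normal pointing downwards can only occur on the graph, since from a point above it one
  may move down. The inequality at v follows by testing with points of the segment from u to v close
  to u: weak convexity transports the local information to v.\<close>

lemma regular_normal_epi:
  assumes f: "\<And>x. x \<in> cball a r \<Longrightarrow> f x = ereal (h x)"
    and u: "u \<in> cball a r" and n: "n \<in> regular_normal_cone (u, \<alpha>) (epi f)" and neg: "snd n < 0"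
  shows "\<alpha> = h u"
    and "v \<in> cball a r \<Longrightarrow> fst n \<bullet> (v - u) \<le> - snd n * (h v - h u + L / 2 * (norm (v - u))\<^sup>2)"
proof -
  have "(u, \<alpha>) \<in> epi f" by (rule regular_normal_coneD(1)[OF n])
  then have le: "h u \<le> \<alpha>" using f[OF u] by (simp add: epi_def)
  show eq: "\<alpha> = h u"
  proof (rule ccontr)
    assume "\<alpha> \<noteq> h u"
    with le have less: "h u < \<alpha>" by simp
    obtain \<delta> where \<delta>: "0 < \<delta>"
      "\<And>z. z \<in> epi f \<Longrightarrow> norm (z - (u, \<alpha>)) < \<delta> \<Longrightarrow> n \<bullet> (z - (u, \<alpha>)) \<le> (- snd n / 2) * norm (z - (u, \<alpha>))"
      using regular_normal_coneD(2)[OF n, of "- snd n / 2"] neg by auto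
    define s where "s = min (\<delta> / 2) (\<alpha> - h u)"
    have s: "0 < s" "s < \<delta>" "s \<le> \<alpha> - h u" using \<delta>(1) less by (auto simp: s_def)
    have "(u, \<alpha> - s) \<in> epi f" using f[OF u] s(3) by (simp add: epi_def)
    from \<delta>(2)[OF this] s have "- snd n * s \<le> - snd n / 2 * s"
      by (simp add: norm_Pair inner_prod_def)
    with neg s(1) show False by (simp add: mult_neg_pos less_le_not_le)
  qed
  assume v: "v \<in> cball a r"
  show "fst n \<bullet> (v - u) \<le> - snd n * (h v - h u + L / 2 * (norm (v - u))\<^sup>2)"
  proof (rule le_by_epsilon_multiple[of "(1 + L) * norm (v - u)"])
    show "0 \<le> (1 + L) * norm (v - u)" using L by simp
    fix \<epsilon> :: real assume \<epsilon>: "0 < \<epsilon>"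
    obtain \<delta> where \<delta>: "0 < \<delta>"
      "\<And>z. z \<in> epi f \<Longrightarrow> norm (z - (u, \<alpha>)) < \<delta> \<Longrightarrow> n \<bullet> (z - (u, \<alpha>)) \<le> \<epsilon> * norm (z - (u, \<alpha>))"
      using regular_normal_coneD(2)[OF n \<epsilon>] by auto
    let ?c = "(1 + L) * norm (v - u)"
    \<comment> \<open>The graph point above \<open>?w\<close> lies within s \<open>?c\<close> of (u,
      h u), so this s keeps it in the \<delta>-ball.\<close>
    define s where "s = min 1 (\<delta> / (2 * (?c + 1)))"
    have c0: "0 \<le> ?c" using L by simp
    have s: "0 < s" "s \<le> 1" "s \<le> \<delta> / (2 * (?c + 1))" using \<delta>(1) c0 by (auto simp: s_def)
    have "s * ?c \<le> \<delta> / (2 * (?c + 1)) * (?c + 1)"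
      using s c0 \<delta>(1) by (intro mult_mono) auto
    also have "\<dots> = \<delta> / 2"
    proof -
      have "?c + 1 \<noteq> 0" using c0 by linarith
      then show ?thesis by (simp add: field_simps)
    qed
    finally have sc: "s * ?c < \<delta>" using \<delta>(1) by simp
    let ?w = "(1 - s) *\<^sub>R u + s *\<^sub>R v"
    have w: "?w \<in> cball a r" by (rule segment_in) (use u v s in auto)
    have wu: "?w - u = s *\<^sub>R (v - u)" by (simp add: algebra_simps)
    have hw: "\<bar>h ?w - h u\<bar> \<le> L * (s * norm (v - u))" using lip[OF w u] s(1) unfolding wu by simp
    let ?z = "(?w, h ?w)"
    have "norm (?z - (u, \<alpha>)) \<le> norm (?w - u) + norm (h ?w - h u)"
      unfolding eq using norm_Pair_le[of "?w - u" "h ?w - h u"] by simp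
    also have "\<dots> \<le> s * norm (v - u) + L * (s * norm (v - u))" using hw s(1) unfolding wu by simp
    also have "\<dots> = s * ?c" by (simp add: ring_distribs)
    finally have nz: "norm (?z - (u, \<alpha>)) \<le> s * ?c" .
    have "?z \<in> epi f" using f[OF w] by (simp add: epi_def)
    then have "n \<bullet> (?z - (u, \<alpha>)) \<le> \<epsilon> * norm (?z - (u, \<alpha>))"
      by (rule \<delta>(2)) (use nz sc in simp)
    also have "\<dots> \<le> \<epsilon> * (s * ?c)" using nz \<epsilon> by (intro mult_left_mono) auto
    also have "n \<bullet> (?z - (u, \<alpha>)) = s * (fst n \<bullet> (v - u)) + snd n * (h ?w - h u)"
      using wu by (simp add: inner_prod_def eq)
    finally have 1: "s * (fst n \<bullet> (v - u)) \<le> - snd n * (h ?w - h u) + \<epsilon> * (s * ?c)" by simp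
    have "h ?w \<le> (1 - s) * h u + s * h v + L / 2 * (s * (1 - s)) * (norm (u - v))\<^sup>2"
      by (rule wc) (use u v s in auto)
    also have "L / 2 * (s * (1 - s)) * (norm (u - v))\<^sup>2 \<le> L / 2 * s * (norm (u - v))\<^sup>2"
      using s L by (intro mult_right_mono mult_left_mono) (auto simp: mult_le_cancel_left1)
    finally have "h ?w - h u \<le> s * (h v - h u + L / 2 * (norm (v - u))\<^sup>2)"
      by (simp add: algebra_simps norm_minus_commute)
    then have "- snd n * (h ?w - h u) \<le> - snd n * (s * (h v - h u + L / 2 * (norm (v - u))\<^sup>2))"
      using neg by (intro mult_left_mono) auto
    with 1 have "s * (fst n \<bullet> (v - u)) \<le> s * (- snd n * (h v - h u + L / 2 * (norm (v - u))\<^sup>2) + \<epsilon> * ?c)"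
      by (simp add: algebra_simps)
    then show "fst n \<bullet> (v - u) \<le> - snd n * (h v - h u + L / 2 * (norm (v - u))\<^sup>2) + \<epsilon> * ?c"
      using s(1) by simp
  qed
qed

lemma prox_subdiff_closed:
  assumes u: "uk \<longlonglongrightarrow> u" "\<And>k. uk k \<in> cball a r" "u \<in> cball a r"
    and y: "yk \<longlonglongrightarrow> y" "\<And>k. yk k \<in> prox_subdiff (uk k)"
  shows "y \<in> prox_subdiff u"
  unfolding prox_subdiff_def
proof (rule CollectI, rule ballI)
  fix v assume v: "v \<in> cball a r"
  have "(\<lambda>k. h (uk k)) \<longlonglongrightarrow> h u"
    by (rule continuous_on_tendsto_compose[OF h_continuous u(1) u(3)]) (use u(2) in auto)
  then have "(\<lambda>k. h (uk k) + yk k \<bullet> (v - uk k) - L / 2 * (norm (v - uk k))\<^sup>2) \<longlonglongrightarrow>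
      h u + y \<bullet> (v - u) - L / 2 * (norm (v - u))\<^sup>2"
    by (intro tendsto_intros u y)
  then show "h u + y \<bullet> (v - u) - L / 2 * (norm (v - u))\<^sup>2 \<le> h v"
    by (rule LIMSEQ_le_const2) (use y(2) v in \<open>auto simp: prox_subdiff_def\<close>)
qed

lemma regular_subgradient_imp_prox:
  assumes u: "u \<in> cball a r"
    and le: "\<And>\<epsilon>. 0 < \<epsilon> \<Longrightarrow> \<exists>\<delta>>0. \<forall>v\<in>cball a r. norm (v - u) < \<delta> \<longrightarrow> h u + y \<bullet> (v - u) - \<epsilon> * norm (v - u) \<le> h v"
  shows "y \<in> prox_subdiff u"
proof -
  \<comment> \<open>The value \<infinity> outside the ball removes all other test points from the
    epigraph, so that \<open>regular_normal_epi\<close> also applies when u lies on the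
    boundary.\<close>
  define f where "f x = (if x \<in> cball a r then ereal (h x) else \<infinity>)" for x
  have f: "f x = ereal (h x)" if "x \<in> cball a r" for x using that by (simp add: f_def)
  have "(y, -1) \<in> regular_normal_cone (u, h u) (epi f)"
  proof (rule epi_regular_normalI)
    fix \<epsilon> :: real assume "0 < \<epsilon>"
    then obtain \<delta> where "0 < \<delta>"
      "\<And>v. v \<in> cball a r \<Longrightarrow> norm (v - u) < \<delta> \<Longrightarrow> h u + y \<bullet> (v - u) - \<epsilon> * norm (v - u) \<le> h v"
      using le by blast
    then show "\<exists>\<delta>>0. \<forall>v \<beta>. norm (v - u) < \<delta> \<longrightarrow> f v \<le> ereal \<beta> \<longrightarrow> h u + y \<bullet> (v - u) - \<epsilon> * norm (v - u) \<le> \<beta>"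
      unfolding f_def by (intro exI[of _ \<delta>]) (fastforce split: if_splits)
  qed (use f[OF u] in simp)
  from regular_normal_epi(2)[OF f u this]
  show ?thesis unfolding prox_subdiff_def by (auto simp: algebra_simps)
qed

lemma prox_imp_regular_subgradient:
  assumes u: "u \<in> ball a r" and y: "y \<in> prox_subdiff u" and \<epsilon>: "0 < \<epsilon>"
  obtains \<delta> where "0 < \<delta>"
    "\<And>v. norm (v - u) < \<delta> \<Longrightarrow> v \<in> ball a r \<and> h u + y \<bullet> (v - u) - \<epsilon> * norm (v - u) \<le> h v"
proof -
  define \<delta> where "\<delta> = min (r - dist a u) (\<epsilon> / (\<bar>L / 2\<bar> + 1))"
  show ?thesis
  proof (rule that[of \<delta>])
    show "0 < \<delta>" using u \<epsilon> L by (simp add: \<delta>_def)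
    fix v assume v: "norm (v - u) < \<delta>"
    have vb: "v \<in> ball a r"
      using v dist_triangle[of a v u] by (simp add: \<delta>_def dist_norm norm_minus_commute)
    have "L / 2 * (norm (v - u))\<^sup>2 \<le> \<epsilon> * norm (v - u)"
      by (rule quadratic_le_linear[OF \<epsilon>]) (use v in \<open>auto simp: \<delta>_def\<close>)
    then show "v \<in> ball a r \<and> h u + y \<bullet> (v - u) - \<epsilon> * norm (v - u) \<le> h v"
      using y vb ball_subset_cball[of a r] unfolding prox_subdiff_def by fastforce
  qed
qed

text \<open>In a sequence of regular normals tending to (y, -1) the last component is eventually
  negative, so each satisfies the inequality of \<open>regular_normal_epi\<close>, which survives
  the limit. Conversely, the quadratic term is negligible near u, so a proximal subgradient is
  already a regular one.\<close>

theorem subdifferential_eq_prox: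
  assumes f: "\<And>x. x \<in> cball a r \<Longrightarrow> f x = ereal (h x)" and u: "u \<in> ball a r"
  shows "subdifferential f u = prox_subdiff u"
proof
  have uc: "u \<in> cball a r" using u ball_subset_cball by blast
  have real: "real_of_ereal (f u) = h u" "\<bar>f u\<bar> \<noteq> \<infinity>" using f[OF uc] by auto
  show "subdifferential f u \<subseteq> prox_subdiff u"
  proof
    fix y assume "y \<in> subdifferential f u"
    then have "(y, -1) \<in> limiting_normal_cone (u, h u) (epi f)"
      using real by (auto simp: subdifferential_def)
    then obtain z n where zn: "z \<longlonglongrightarrow> (u, h u)" "n \<longlonglongrightarrow> (y, -1::real)"
      "\<And>k. n k \<in> regular_normal_cone (z k) (epi f)"
      unfolding limiting_normal_cone_def by blast
    have fz: "(\<lambda>k. fst (z k)) \<longlonglongrightarrow> u" using tendsto_fst[OF zn(1)] by simp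
    have fn: "(\<lambda>k. fst (n k)) \<longlonglongrightarrow> y" using tendsto_fst[OF zn(2)] by simp
    have sn: "(\<lambda>k. snd (n k)) \<longlonglongrightarrow> -1" using tendsto_snd[OF zn(2)] by simp
    have ev: "\<forall>\<^sub>F k in sequentially. fst (z k) \<in> cball a r \<and> snd (n k) < 0"
    proof (rule eventually_conj)
      have "\<forall>\<^sub>F k in sequentially. fst (z k) \<in> ball a r"
        by (rule topological_tendstoD[OF fz open_ball u])
      then show "\<forall>\<^sub>F k in sequentially. fst (z k) \<in> cball a r"
        by eventually_elim (rule subsetD[OF ball_subset_cball])
      show "\<forall>\<^sub>F k in sequentially. snd (n k) < 0" by (rule order_tendstoD(2)[OF sn]) simp
    qed
    show "y \<in> prox_subdiff u"
      unfolding prox_subdiff_def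
    proof (rule CollectI, rule ballI)
      fix v assume v: "v \<in> cball a r"
      have "(\<lambda>k. h (fst (z k))) \<longlonglongrightarrow> h u"
        by (rule continuous_on_tendsto_compose[OF h_continuous fz uc])
          (use ev in \<open>auto elim: eventually_mono\<close>)
      then have "(\<lambda>k. - snd (n k) * (h v - h (fst (z k)) + L / 2 * (norm (v - fst (z k)))\<^sup>2)) \<longlonglongrightarrow>
          - (-1) * (h v - h u + L / 2 * (norm (v - u))\<^sup>2)"
        by (intro tendsto_intros fz sn)
      moreover have "(\<lambda>k. fst (n k) \<bullet> (v - fst (z k))) \<longlonglongrightarrow> y \<bullet> (v - u)"
        by (intro tendsto_intros fz fn)
      moreover have "\<forall>\<^sub>F k in sequentially. fst (n k) \<bullet> (v - fst (z k))
          \<le> - snd (n k) * (h v - h (fst (z k)) + L / 2 * (norm (v - fst (z k)))\<^sup>2)"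
        using ev
      proof eventually_elim
        case (elim k)
        have "n k \<in> regular_normal_cone (fst (z k), snd (z k)) (epi f)" using zn(3)[of k] by simp
        from regular_normal_epi(2)[OF f _ this _ v] elim show ?case by blast
      qed
      ultimately have "y \<bullet> (v - u) \<le> - (-1) * (h v - h u + L / 2 * (norm (v - u))\<^sup>2)"
        by (intro tendsto_le[OF sequentially_bot])
      then show "h u + y \<bullet> (v - u) - L / 2 * (norm (v - u))\<^sup>2 \<le> h v" by simp
    qed
  qed
  show "prox_subdiff u \<subseteq> subdifferential f u"
  proof
    fix y assume y: "y \<in> prox_subdiff u"
    have "(y, -1) \<in> regular_normal_cone (u, h u) (epi f)"
    proof (rule epi_regular_normalI)
      fix \<epsilon> :: real assume \<epsilon>: "0 < \<epsilon>"
      obtain \<delta> where \<delta>: "0 < \<delta>"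
        "\<And>v. norm (v - u) < \<delta> \<Longrightarrow> v \<in> ball a r \<and> h u + y \<bullet> (v - u) - \<epsilon> * norm (v - u) \<le> h v"
        by (rule prox_imp_regular_subgradient[OF u y \<epsilon>]) (rule that)
      have "h u + y \<bullet> (v - u) - \<epsilon> * norm (v - u) \<le> \<beta>" if "norm (v - u) < \<delta>" "f v \<le> ereal \<beta>" for v \<beta>
        using \<delta>(2)[OF that(1)] that(2) f[of v] by simp
      with \<delta>(1) show "\<exists>\<delta>>0. \<forall>v \<beta>. norm (v - u) < \<delta> \<longrightarrow> f v \<le> ereal \<beta> \<longrightarrow> h u + y \<bullet> (v - u) - \<epsilon> * norm (v - u) \<le> \<beta>"
        by blast
    qed (use f[OF uc] in simp)
    then have "(y, -1) \<in> limiting_normal_cone (u, h u) (epi f)"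
      using regular_normal_cone_subset_limiting by blast
    then show "y \<in> subdifferential f u" using real by (simp add: subdifferential_def)
  qed
qed

end

section \<open>The proximal map of a weakly convex function\<close>

lemma norm_convex_combination:
  fixes p q x :: "'a::real_inner"
  shows "(norm ((1 - s) *\<^sub>R p + s *\<^sub>R q - x))\<^sup>2
    = (1 - s) * (norm (p - x))\<^sup>2 + s * (norm (q - x))\<^sup>2 - s * (1 - s) * (norm (p - q))\<^sup>2"
proof -
  have "(1 - s) *\<^sub>R p + s *\<^sub>R q - x = (1 - s) *\<^sub>R (p - x) + s *\<^sub>R (q - x)" by (simp add: algebra_simps)
  moreover have "p - q = (p - x) - (q - x)" by simp
  ultimately show ?thesis
    by (simp only: power2_norm_eq_inner inner_add_left inner_add_right inner_diff_left inner_diff_right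
        inner_scaleR_left inner_scaleR_right)
      (simp add: inner_commute algebra_simps power2_eq_square)
qed

text \<open>Away from 0 the norm lies below its quadratic expansion, by 2 |x| |x + d| \<le> |x|^2 +
  |x + d|^2.\<close>

lemma norm_add_le_quadratic:
  fixes x d :: "'a::real_inner"
  assumes x: "x \<noteq> 0"
  shows "norm (x + d) \<le> norm x + (x /\<^sub>R norm x) \<bullet> d + (norm d)\<^sup>2 / (2 * norm x)"
proof -
  have "(norm (x + d))\<^sup>2 = (norm x)\<^sup>2 + 2 * (x \<bullet> d) + (norm d)\<^sup>2"
    by (simp add: power2_norm_eq_inner inner_add_left inner_add_right inner_commute)
  moreover have "0 \<le> (norm (x + d) - norm x)\<^sup>2" by simp
  ultimately have "2 * (norm x * norm (x + d)) \<le> 2 * (norm x)\<^sup>2 + 2 * (x \<bullet> d) + (norm d)\<^sup>2"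
    unfolding power2_diff by (simp add: mult.commute mult.left_commute)
  then show ?thesis using x by (simp add: field_simps power2_eq_square)
qed

context weakly_convex
begin

text \<open>Half of the weight L makes h convex, and the other half remains as strong convexity.
  Hence minimizers are unique and grow quadratically with constant L / 2.\<close>

definition penalty :: "'a \<Rightarrow> 'a \<Rightarrow> real" where
  "penalty x u = h u + L * (norm (u - x))\<^sup>2"

definition P :: "'a \<Rightarrow> 'a" where
  "P x = (SOME p. p \<in> cball a r \<and> (\<forall>u\<in>cball a r. penalty x p \<le> penalty x u))"

lemma P_in: "P x \<in> cball a r" and P_min: "u \<in> cball a r \<Longrightarrow> penalty x (P x) \<le> penalty x u"
proof -
  have "continuous_on (cball a r) (penalty x)"
    unfolding penalty_def by (intro continuous_intros h_continuous)
  then have "\<exists>p\<in>cball a r. \<forall>u\<in>cball a r. penalty x p \<le> penalty x u"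
    using r by (intro continuous_attains_inf) auto
  then have "P x \<in> cball a r \<and> (\<forall>u\<in>cball a r. penalty x (P x) \<le> penalty x u)"
    unfolding P_def by (intro someI_ex[of "\<lambda>p. p \<in> cball a r \<and> (\<forall>u\<in>cball a r. penalty x p \<le> penalty x u)"]) blast
  then show "P x \<in> cball a r" "u \<in> cball a r \<Longrightarrow> penalty x (P x) \<le> penalty x u" by auto
qed

text \<open>The minimizer p is compared with (1 - s) p + s u. Strong convexity gives the claim with
  the factor 1 - s, which may be taken arbitrarily close to 1.\<close>

lemma penalty_growth:
  assumes p: "p \<in> cball a r" "\<And>u. u \<in> cball a r \<Longrightarrow> penalty x p \<le> penalty x u" and u: "u \<in> cball a r"
  shows "penalty x p + L / 2 * (norm (u - p))\<^sup>2 \<le> penalty x u"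
proof -
  have "L / 2 * (norm (u - p))\<^sup>2 \<le> penalty x u - penalty x p"
  proof (rule field_le_mult_one_interval)
    fix z :: real assume z: "0 < z" "z < 1"
    define s where "s = 1 - z"
    have s: "0 < s" "s < 1" using z by (auto simp: s_def)
    let ?w = "(1 - s) *\<^sub>R p + s *\<^sub>R u"
    have "penalty x p \<le> penalty x ?w" by (rule p(2)[OF segment_in[OF p(1) u]]) (use s in auto)
    also have "\<dots> \<le> ((1 - s) * h p + s * h u + L / 2 * (s * (1 - s)) * (norm (p - u))\<^sup>2)
        + L * (norm (?w - x))\<^sup>2"
      unfolding penalty_def using wc[OF p(1) u, of s] s by simp
    also have "\<dots> = (1 - s) * penalty x p + s * penalty x u - L / 2 * (s * (1 - s)) * (norm (p - u))\<^sup>2"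
      unfolding norm_convex_combination penalty_def by (simp add: algebra_simps)
    finally have "s * ((1 - s) * (L / 2 * (norm (p - u))\<^sup>2)) \<le> s * (penalty x u - penalty x p)"
      by (simp add: algebra_simps)
    then have "(1 - s) * (L / 2 * (norm (p - u))\<^sup>2) \<le> penalty x u - penalty x p" using s(1) by simp
    then show "z * (L / 2 * (norm (u - p))\<^sup>2) \<le> penalty x u - penalty x p"
      by (simp add: s_def norm_minus_commute)
  qed
  then show ?thesis by simp
qed

lemma P_growth: "u \<in> cball a r \<Longrightarrow> penalty x (P x) + L / 2 * (norm (u - P x))\<^sup>2 \<le> penalty x u"
  by (rule penalty_growth[OF P_in]) (use P_min in auto)

lemma P_unique:
  assumes "u \<in> cball a r" "\<And>v. v \<in> cball a r \<Longrightarrow> penalty x u \<le> penalty x v"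
  shows "P x = u"
proof -
  have "penalty x u + L / 2 * (norm (P x - u))\<^sup>2 \<le> penalty x (P x)"
    by (rule penalty_growth[OF assms P_in])
  with P_min[OF assms(1), of x] have "L / 2 * (norm (P x - u))\<^sup>2 \<le> 0" by simp
  then show ?thesis using L by (simp add: mult_le_0_iff)
qed

text \<open>The growth inequalities at x and x', each tested with the other minimizer, are added;
  the values of h cancel. The estimate contains both monotonicity and the Lipschitz constant
  2.\<close>

lemma P_monotone: "(norm (P x - P x'))\<^sup>2 \<le> 2 * ((P x - P x') \<bullet> (x - x'))"
proof -
  let ?p = "P x" and ?q = "P x'"
  have "penalty x ?p + L / 2 * (norm (?q - ?p))\<^sup>2 \<le> penalty x ?q"
    "penalty x' ?q + L / 2 * (norm (?p - ?q))\<^sup>2 \<le> penalty x' ?p"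
    using P_growth[OF P_in] by blast+
  then have "L * (norm (?p - ?q))\<^sup>2 \<le> L * ((norm (?q - x))\<^sup>2 - (norm (?p - x))\<^sup>2 + (norm (?p - x'))\<^sup>2 - (norm (?q - x'))\<^sup>2)"
    unfolding penalty_def by (simp add: norm_minus_commute[of ?q ?p] algebra_simps)
  also have "(norm (?q - x))\<^sup>2 - (norm (?p - x))\<^sup>2 + (norm (?p - x'))\<^sup>2 - (norm (?q - x'))\<^sup>2
      = 2 * ((?p - ?q) \<bullet> (x - x'))"
    by (simp add: power2_norm_eq_inner inner_diff_left inner_diff_right inner_commute algebra_simps)
  finally show ?thesis using L by simp
qed

lemma P_lipschitz: "norm (P x - P x') \<le> 2 * norm (x - x')"
proof -
  have "norm (P x - P x') * norm (P x - P x') \<le> norm (P x - P x') * (2 * norm (x - x'))"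
    using P_monotone[of x x'] norm_cauchy_schwarz[of "P x - P x'" "x - x'"] by (simp add: power2_eq_square)
  then show ?thesis by (cases "norm (P x - P x') = 0") (auto simp: mult_le_cancel_left)
qed

lemma P_continuous: "continuous_on S P"
  by (intro lipschitz_on_continuous_on[of 2] lipschitz_onI) (use P_lipschitz in \<open>auto simp: dist_norm\<close>)

lemma P_subgradient: "(2 * L) *\<^sub>R (x - P x) \<in> prox_subdiff (P x)"
  unfolding prox_subdiff_def
proof (rule CollectI, rule ballI)
  fix v assume v: "v \<in> cball a r"
  have eq: "(norm (v - x))\<^sup>2 = (norm (v - P x))\<^sup>2 - 2 * ((x - P x) \<bullet> (v - P x)) + (norm (P x - x))\<^sup>2"
    by (simp add: power2_norm_eq_inner inner_diff_left inner_diff_right inner_commute)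
  have "penalty x (P x) + L / 2 * (norm (v - P x))\<^sup>2 \<le> penalty x v" by (rule P_growth[OF v])
  then have "h (P x) + L * (norm (P x - x))\<^sup>2 + L / 2 * (norm (v - P x))\<^sup>2 \<le>
      h v + L * (norm (v - P x))\<^sup>2 - 2 * L * ((x - P x) \<bullet> (v - P x)) + L * (norm (P x - x))\<^sup>2"
    unfolding penalty_def eq by (simp add: ring_distribs)
  then show "h (P x) + (2 * L) *\<^sub>R (x - P x) \<bullet> (v - P x) - L / 2 * (norm (v - P x))\<^sup>2 \<le> h v"
    unfolding inner_scaleR_left by (simp add: field_simps)
qed

text \<open>Minty's parametrization: the graph of the subdifferential is the image of
  \<open>x \<mapsto> (P x, 2 L (x - P x))\<close>.\<close>

lemma P_of_subgradient:
  assumes u: "u \<in> cball a r" and y: "y \<in> prox_subdiff u"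
  shows "P (u + y /\<^sub>R (2 * L)) = u"
proof (rule P_unique[OF u])
  fix v assume v: "v \<in> cball a r"
  let ?x = "u + y /\<^sub>R (2 * L)"
  have "(norm (v - (u + e)))\<^sup>2 = (norm (v - u))\<^sup>2 - 2 * (e \<bullet> (v - u)) + (norm (u - (u + e)))\<^sup>2" for e
    by (simp add: power2_norm_eq_inner inner_diff_left inner_diff_right inner_add_left inner_add_right inner_commute)
  from this[of "y /\<^sub>R (2 * L)"] have eq: "L * (norm (v - ?x))\<^sup>2 = L * (norm (v - u))\<^sup>2 - y \<bullet> (v - u) + L * (norm (u - ?x))\<^sup>2"
    using L by (simp add: ring_distribs)
  have "h u + y \<bullet> (v - u) - L / 2 * (norm (v - u))\<^sup>2 \<le> h v"
    using y v by (auto simp: prox_subdiff_def)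
  moreover have "0 \<le> L / 2 * (norm (v - u))\<^sup>2" using L by simp
  ultimately show "penalty ?x u \<le> penalty ?x v"
    unfolding penalty_def eq by simp
qed

text \<open>A graph point (u, y) near the base point has the parameter x' = u + y / (2 L), with P x'
  = u. Splitting m \<bullet> (x' - x) accordingly turns a first-order inequality for P in the
  parameter into a normal to the graph.\<close>

lemma graph_normal:
  assumes f: "\<And>x. x \<in> cball a r \<Longrightarrow> f x = ereal (h x)"
    and Px: "P x \<in> ball a r" and C: "0 \<le> C" and \<delta>: "0 < \<delta>"
    and le: "\<And>x'. norm (x' - x) < \<delta> \<Longrightarrow> m \<bullet> (x' - x) \<le> w \<bullet> (P x' - P x) + C * (norm (x' - x))\<^sup>2"
  shows "(m - w, m /\<^sub>R (2 * L)) \<in> regular_normal_cone (P x, (2 * L) *\<^sub>R (x - P x)) (gph (subdifferential f))"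
proof (rule regular_normal_coneI)
  define c where "c = 1 + 1 / (2 * L)"
  let ?y = "(2 * L) *\<^sub>R (x - P x)"
  have c: "1 \<le> c" "0 < c" using L by (auto simp: c_def intro: add_pos_pos)
  show "(P x, ?y) \<in> gph (subdifferential f)"
    using subdifferential_eq_prox[OF f Px] P_subgradient by (simp add: gph_def)
  fix \<epsilon> :: real assume \<epsilon>: "0 < \<epsilon>"
  \<comment> \<open>The three bounds keep u in the ball, keep x' within \<delta> of x, and make the
    quadratic remainder smaller than \<epsilon> times the distance. The factor c is a Lipschitz
    constant of the parameter in terms of the graph point.\<close>
  define d where "d = min (r - dist a (P x)) (min (\<delta> / c) (\<epsilon> / ((C + 1) * c * c)))"
  have d: "0 < d" "d \<le> r - dist a (P x)" "d \<le> \<delta> / c" "d \<le> \<epsilon> / ((C + 1) * c * c)"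
    using Px \<delta> \<epsilon> C c unfolding d_def by auto
  have "(m - w, m /\<^sub>R (2 * L)) \<bullet> (z - (P x, ?y)) \<le> \<epsilon> * norm (z - (P x, ?y))"
    if z: "z \<in> gph (subdifferential f)" "norm (z - (P x, ?y)) < d" for z
  proof -
    obtain u y where zuy: "z = (u, y)" by (cases z)
    let ?n = "norm (z - (P x, ?y))"
    have n: "norm (u - P x) \<le> ?n" "norm (y - ?y) \<le> ?n"
      by (auto simp: zuy norm_fst_le norm_snd_le)
    have ub: "u \<in> ball a r"
      using n(1) z(2) d(2) dist_triangle[of a u "P x"] by (simp add: dist_norm norm_minus_commute)
    have y: "y \<in> prox_subdiff u"
      using z(1) subdifferential_eq_prox[OF f ub] by (simp add: zuy gph_def)
    define x' where "x' = u + y /\<^sub>R (2 * L)"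
    have Px': "P x' = u"
      unfolding x'_def by (rule P_of_subgradient[OF _ y]) (use ub ball_subset_cball in blast)
    have x: "?y /\<^sub>R (2 * L) = x - P x" using L by simp
    have dx: "x' - x = (u - P x) + (y - ?y) /\<^sub>R (2 * L)"
      unfolding x'_def scaleR_diff_right[of "inverse (2 * L)" y ?y] x by simp
    have nL: "norm (v /\<^sub>R (2 * L)) = norm v / (2 * L)" for v :: 'a
    proof -
      have "norm (v /\<^sub>R (2 * L)) = inverse (2 * L) * norm v"
        using L unfolding norm_scaleR by simp
      also have "\<dots> = norm v / (2 * L)" by (simp only: divide_inverse mult.commute)
      finally show ?thesis .
    qed
    have "norm (x' - x) \<le> norm (u - P x) + norm (y - ?y) / (2 * L)"
      unfolding dx nL[symmetric] by (rule norm_triangle_ineq)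
    also have "\<dots> \<le> ?n + ?n / (2 * L)" using n L by (intro add_mono divide_right_mono) auto
    finally have nx: "norm (x' - x) \<le> c * ?n" by (simp add: c_def algebra_simps)
    also have "\<dots> < c * d" using z(2) c by (intro mult_strict_left_mono) auto
    also have "\<dots> \<le> c * (\<delta> / c)" using d(3) c by (intro mult_left_mono) auto
    also have "\<dots> = \<delta>" using c(2) by (metis nonzero_eq_divide_eq less_irrefl mult.commute)
    finally have "m \<bullet> (x' - x) \<le> w \<bullet> (u - P x) + C * (norm (x' - x))\<^sup>2"
      using le[of x'] Px' by simp
    moreover have "C * (norm (x' - x))\<^sup>2 \<le> \<epsilon> * ?n"
    proof -
      have "(norm (x' - x))\<^sup>2 \<le> (c * ?n) * (c * ?n)"
        unfolding power2_eq_square using nx c by (intro mult_mono) auto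
      also have "\<dots> \<le> c * c * (d * ?n)"
      proof -
        have "?n * ?n \<le> d * ?n" using z(2) by (intro mult_right_mono) auto
        then have "(c * c) * (?n * ?n) \<le> (c * c) * (d * ?n)" using c by (intro mult_left_mono) auto
        then show ?thesis by (simp only: mult.assoc mult.left_commute)
      qed
      finally have "C * (norm (x' - x))\<^sup>2 \<le> (C + 1) * (c * c * (d * ?n))"
        using C by (intro mult_mono) auto
      also have "\<dots> = ((C + 1) * c * c) * d * ?n" by (simp only: mult.assoc)
      also have "\<dots> \<le> ((C + 1) * c * c) * (\<epsilon> / ((C + 1) * c * c)) * ?n"
        using d(4) C c by (intro mult_right_mono mult_left_mono) auto
      also have "\<dots> = \<epsilon> * ?n"
      proof -
        have "0 < (C + 1) * c * c" using C c by (intro mult_pos_pos) auto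
        then have "((C + 1) * c * c) * (\<epsilon> / ((C + 1) * c * c)) = \<epsilon>"
          by (metis less_irrefl nonzero_mult_div_cancel_left times_divide_eq_right)
        then show ?thesis by simp
      qed
      finally show ?thesis .
    qed
    moreover have "m \<bullet> (x' - x) = m \<bullet> (u - P x) + (m /\<^sub>R (2 * L)) \<bullet> (y - ?y)"
      unfolding dx inner_add_right by simp
    moreover have "(m - w, m /\<^sub>R (2 * L)) \<bullet> (z - (P x, ?y)) = m \<bullet> (u - P x) - w \<bullet> (u - P x) + (m /\<^sub>R (2 * L)) \<bullet> (y - ?y)"
      by (simp add: zuy inner_prod_def inner_diff_left)
    ultimately show ?thesis by linarith
  qed
  with d(1) show "\<exists>\<delta>>0. \<forall>z\<in>gph (subdifferential f). norm (z - (P x, ?y)) < \<delta> \<longrightarrow>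
     (m - w, m /\<^sub>R (2 * L)) \<bullet> (z - (P x, ?y)) \<le> \<epsilon> * norm (z - (P x, ?y))" by blast
qed

text \<open>The first-order condition for the displayed minimization. As P x differs from u, the
  norm has a quadratic expansion there, and the Lipschitz bound for P turns its remainder into one
  in x' - x. Dividing by 16 \<tau> explains the factor 8 \<tau> in m.\<close>

lemma local_minimizer_normal:
  assumes f: "\<And>x. x \<in> cball a r \<Longrightarrow> f x = ereal (h x)"
    and Px: "P x \<in> ball a r" and \<tau>: "0 < \<tau>" and ne: "P x \<noteq> u" and \<delta>: "0 < \<delta>"
    and min: "\<And>x'. norm (x' - x) < \<delta> \<Longrightarrow>
      16 * \<tau> * norm (P x - u) + (norm (x - b))\<^sup>2 \<le> 16 * \<tau> * norm (P x' - u) + (norm (x' - b))\<^sup>2"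
  defines "w \<equiv> (P x - u) /\<^sub>R norm (P x - u)" and "m \<equiv> - ((x - b) /\<^sub>R (8 * \<tau>))"
  shows "norm w = 1"
    and "(m - w, m /\<^sub>R (2 * L)) \<in> regular_normal_cone (P x, (2 * L) *\<^sub>R (x - P x)) (gph (subdifferential f))"
proof -
  show "norm w = 1" using ne by (simp add: w_def)
  let ?e = "P x - u"
  let ?C = "2 / norm ?e + 1 / (16 * \<tau>)"
  show "(m - w, m /\<^sub>R (2 * L)) \<in> regular_normal_cone (P x, (2 * L) *\<^sub>R (x - P x)) (gph (subdifferential f))"
  proof (rule graph_normal[OF f Px _ \<delta>])
    show "0 \<le> ?C" using \<tau> by simp
    fix x' assume x': "norm (x' - x) < \<delta>"
    let ?d = "P x' - P x" and ?h = "x' - x"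
    have "P x' - u = ?e + ?d" by simp
    then have 1: "norm (P x' - u) \<le> norm ?e + w \<bullet> ?d + (norm ?d)\<^sup>2 / (2 * norm ?e)"
      using norm_add_le_quadratic[of ?e ?d] ne by (simp add: w_def)
    have "(norm ?d)\<^sup>2 \<le> (2 * norm ?h)\<^sup>2" using P_lipschitz[of x' x] by (intro power_mono) auto
    then have "(norm ?d)\<^sup>2 / (2 * norm ?e) \<le> (4 * (norm ?h)\<^sup>2) / (2 * norm ?e)"
      by (intro divide_right_mono) (auto simp: power_mult_distrib)
    with 1 have "norm (P x' - u) \<le> norm ?e + w \<bullet> ?d + 2 / norm ?e * (norm ?h)\<^sup>2" by simp
    then have 2: "16 * \<tau> * norm (P x' - u) \<le> 16 * \<tau> * (norm ?e + w \<bullet> ?d + 2 / norm ?e * (norm ?h)\<^sup>2)"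
      using \<tau> by (intro mult_left_mono) auto
    have "(norm (x' - b))\<^sup>2 = (norm (x - b))\<^sup>2 + 2 * ((x - b) \<bullet> ?h) + (norm ?h)\<^sup>2"
      by (simp add: power2_norm_eq_inner inner_diff_left inner_diff_right inner_commute)
    moreover have "(x - b) \<bullet> ?h = - (8 * \<tau> * (m \<bullet> ?h))"
    proof -
      have "X = - (8 * \<tau> * - (inverse (8 * \<tau>) * X))" for X :: real using \<tau> by simp
      then show ?thesis unfolding m_def inner_minus_left inner_scaleR_left .
    qed
    moreover have "16 * \<tau> * (w \<bullet> ?d + ?C * (norm ?h)\<^sup>2)
        = 16 * \<tau> * (w \<bullet> ?d + 2 / norm ?e * (norm ?h)\<^sup>2) + (norm ?h)\<^sup>2"
    proof -
      define A B where "A = 2 / norm ?e" and "B = (norm ?h)\<^sup>2"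
      have "16 * \<tau> * (w \<bullet> ?d + (A + 1 / (16 * \<tau>)) * B) = 16 * \<tau> * (w \<bullet> ?d + A * B) + B"
        using \<tau> by (simp add: field_simps)
      then show ?thesis by (simp only: A_def B_def)
    qed
    moreover have "16 * \<tau> * (norm ?e + w \<bullet> ?d + 2 / norm ?e * (norm ?h)\<^sup>2)
       = 16 * \<tau> * norm ?e + 16 * \<tau> * (w \<bullet> ?d + 2 / norm ?e * (norm ?h)\<^sup>2)"
      by (simp only: distrib_left add.assoc)
    ultimately have "16 * \<tau> * (m \<bullet> ?h) \<le> 16 * \<tau> * (w \<bullet> ?d + ?C * (norm ?h)\<^sup>2)"
      using min[OF x'] 2 by linarith
    then show "m \<bullet> ?h \<le> w \<bullet> ?d + ?C * (norm ?h)\<^sup>2" 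
      by (rule mult_left_le_imp_le) (use \<tau> in simp)
  qed
qed

text \<open>With d = x2 - x1, the value u + s d has a preimage within 4 s |d| of x1, by the covering
  at x1. Monotonicity against x2 then gives 0 \<le> (4 s - 1) |d|^2, which is false for s \<le>
  1/8.\<close>

lemma monotone_inverse_unique:
  assumes \<rho>: "0 < \<rho>" and P: "P x1 = u" "P x2 = u"
    and cov: "\<And>v. norm (v - u) < \<rho> \<Longrightarrow> \<exists>x. P x = v \<and> norm (x - x1) \<le> 4 * norm (v - u)"
  shows "x1 = x2"
proof (rule ccontr)
  assume ne: "x1 \<noteq> x2"
  define d where "d = x2 - x1"
  have d: "0 < norm d" using ne by (simp add: d_def)
  define s where "s = min (1 / 8) (\<rho> / (2 * norm d))"
  have s: "0 < s" "s \<le> 1 / 8" "s \<le> \<rho> / (2 * norm d)" using \<rho> d by (auto simp: s_def)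
  have "s * norm d \<le> \<rho> / (2 * norm d) * norm d" using s(3) by (rule mult_right_mono) simp
  also have "\<dots> = \<rho> / 2" using d by simp
  finally have "norm (u + s *\<^sub>R d - u) < \<rho>" using \<rho> s(1) by simp
  from cov[OF this] obtain x where x: "P x = u + s *\<^sub>R d" "norm (x - x1) \<le> 4 * (s * norm d)" using s(1) by auto
  have "0 \<le> 2 * ((P x - P x2) \<bullet> (x - x2))"
    using P_monotone[of x x2] zero_le_power2 order_trans by blast
  also have "P x - P x2 = s *\<^sub>R d" using x(1) P(2) by simp
  finally have "0 \<le> d \<bullet> (x - x2)" using s(1) by (simp add: zero_le_mult_iff)
  also have "x - x2 = (x - x1) - d" by (simp add: d_def)
  also have "d \<bullet> ((x - x1) - d) \<le> norm d * (4 * (s * norm d)) - (norm d)\<^sup>2"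
    using norm_cauchy_schwarz[of d "x - x1"] mult_left_mono[OF x(2), of "norm d"]
    by (simp add: inner_diff_right power2_norm_eq_inner)
  also have "\<dots> = (4 * s - 1) * (norm d)\<^sup>2" by (simp add: power2_eq_square algebra_simps)
  also have "\<dots> < 0" using s(2) d by (intro mult_neg_pos) auto
  finally show False by simp
qed

text \<open>Metric regularity of \<open>P\<close> with linear rate makes the inverse of the monotone map \<open>P\<close>
  single-valued and Lipschitz continuous.\<close>

lemma inverse_lipschitz:
  assumes \<rho>: "0 < \<rho>" and c: "P c = a"
    and cov: "\<And>b v. norm (b - c) < \<rho> \<Longrightarrow> norm (v - P b) < \<rho> \<Longrightarrow>
        \<exists>x. P x = v \<and> norm (x - b) \<le> 4 * norm (v - P b)"
  obtains F where "\<And>u. u \<in> ball a (min r (\<rho> / 8)) \<Longrightarrow> prox_subdiff u = {F u}"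
    "\<And>u v. u \<in> ball a (min r (\<rho> / 8)) \<Longrightarrow> v \<in> ball a (min r (\<rho> / 8)) \<Longrightarrow> norm (F u - F v) \<le> 10 * L * norm (u - v)"
proof -
  \<comment> \<open>A point within \<rho> / 8 of a has a preimage within \<rho> / 2 of c, and two
    such points differ by less than \<rho>, so the covering property applies at every
    preimage.\<close>
  let ?B = "ball a (min r (\<rho> / 8))"
  have ex: "\<exists>x. P x = u \<and> norm (x - c) < \<rho>" if u: "u \<in> ?B" for u
  proof -
    have "norm (u - a) < \<rho> / 8" using u by (simp add: dist_norm norm_minus_commute)
    with cov[of c u] \<rho> c show ?thesis by fastforce
  qed
  then obtain X where X: "\<And>u. u \<in> ?B \<Longrightarrow> P (X u) = u" "\<And>u. u \<in> ?B \<Longrightarrow> norm (X u - c) < \<rho>" by metis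
  have uniq: "x = X u" if u: "u \<in> ?B" and x: "P x = u" for u x
    using monotone_inverse_unique[OF \<rho> X(1)[OF u] x] cov[OF X(2)[OF u]] X(1)[OF u] by auto
  \<comment> \<open>The subgradient at the graph point with parameter X u. Its Lipschitz constant is
    2 L (4 + 1), from the constant 4 of X and 1 of the identity.\<close>
  define F where "F u = (2 * L) *\<^sub>R (X u - u)" for u
  show ?thesis
  proof (rule that[of F])
    fix u assume u: "u \<in> ?B"
    then have uc: "u \<in> cball a r" by (simp add: dist_norm)
    show "prox_subdiff u = {F u}"
    proof
      show "{F u} \<subseteq> prox_subdiff u" using P_subgradient[of "X u"] X(1)[OF u] by (simp add: F_def)
      show "prox_subdiff u \<subseteq> {F u}"
      proof
        fix y assume y: "y \<in> prox_subdiff u"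
        have "u + y /\<^sub>R (2 * L) = X u" by (rule uniq[OF u P_of_subgradient[OF uc y]])
        then have "y = F u" unfolding F_def using L by (simp add: algebra_simps flip: \<open>u + y /\<^sub>R (2 * L) = X u\<close>)
        then show "y \<in> {F u}" by simp
      qed
    qed
  next
    fix u v assume u: "u \<in> ?B" and v: "v \<in> ?B"
    have "norm (v - u) < \<rho>"
      using u v \<rho> norm_triangle_ineq4[of "v - a" "u - a"] by (simp add: dist_norm norm_minus_commute)
    then obtain x where "P x = v" "norm (x - X u) \<le> 4 * norm (v - u)"
      using cov[OF X(2)[OF u], of v] X(1)[OF u] by auto
    with uniq[OF v] have 1: "norm (X v - X u) \<le> 4 * norm (v - u)" by simp
    have "F u - F v = (2 * L) *\<^sub>R ((X u - X v) - (u - v))" by (simp add: F_def algebra_simps)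
    then have "norm (F u - F v) = 2 * L * norm ((X u - X v) - (u - v))" using L by simp
    also have "\<dots> \<le> 2 * L * (4 * norm (u - v) + norm (u - v))"
      using norm_triangle_ineq4[of "X u - X v" "u - v"] 1 L
      by (intro mult_left_mono) (auto simp: norm_minus_commute)
    finally show "norm (F u - F v) \<le> 10 * L * norm (u - v)" by simp
  qed
qed

text \<open>Preimages for approximating pairs from D are bounded, and by continuity of P a cluster
  point solves the limit problem with the same rate. It serves to reduce an uncountable family of
  almost everywhere statements to a countable one.\<close>

lemma covering_from_dense:
  assumes D: "closure D = UNIV"
    and cov: "\<And>b v. b \<in> D \<Longrightarrow> v \<in> D \<Longrightarrow> norm (b - c) < \<rho> \<Longrightarrow> norm (v - P b) < \<rho> \<Longrightarrow>
        \<exists>x. P x = v \<and> norm (x - b) \<le> 4 * norm (v - P b)"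
    and b: "norm (b - c) < \<rho>" and v: "norm (v - P b) < \<rho>"
  shows "\<exists>x. P x = v \<and> norm (x - b) \<le> 4 * norm (v - P b)"
proof -
  obtain bk where bk: "\<And>k. bk k \<in> D" "bk \<longlonglongrightarrow> b" using D closure_sequential[of b D] by auto
  obtain vk where vk: "\<And>k. vk k \<in> D" "vk \<longlonglongrightarrow> v" using D closure_sequential[of v D] by auto
  have Pb: "(\<lambda>k. P (bk k)) \<longlonglongrightarrow> P b"
    by (rule continuous_on_tendsto_compose[OF P_continuous[of UNIV] bk(2)]) auto
  have "(\<lambda>k. norm (bk k - c)) \<longlonglongrightarrow> norm (b - c)" by (intro tendsto_intros bk)
  from order_tendstoD(2)[OF this b] have 1: "\<forall>\<^sub>F k in sequentially. norm (bk k - c) < \<rho>" .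
  have lim2: "(\<lambda>k. norm (vk k - P (bk k))) \<longlonglongrightarrow> norm (v - P b)" by (intro tendsto_intros vk Pb)
  from order_tendstoD(2)[OF this v] have 2: "\<forall>\<^sub>F k in sequentially. norm (vk k - P (bk k)) < \<rho>" .
  from 1 2 have "\<forall>\<^sub>F k in sequentially. \<exists>x. P x = vk k \<and> norm (x - bk k) \<le> 4 * norm (vk k - P (bk k))"
    by eventually_elim (intro cov bk vk)
  then obtain K where "\<And>k. k \<ge> K \<Longrightarrow> \<exists>x. P x = vk k \<and> norm (x - bk k) \<le> 4 * norm (vk k - P (bk k))"
    by (auto simp: eventually_sequentially)
  then obtain X where X: "\<And>k. k \<ge> K \<Longrightarrow> P (X k) = vk k"
    "\<And>k. k \<ge> K \<Longrightarrow> norm (X k - bk k) \<le> 4 * norm (vk k - P (bk k))" by metis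
  define Y where "Y k = X (k + K)" for k
  have Y: "P (Y k) = vk (k + K)" "norm (Y k - bk (k + K)) \<le> 4 * norm (vk (k + K) - P (bk (k + K)))" for k
    unfolding Y_def by (rule X, simp)+
  have limb: "(\<lambda>k. bk (k + K)) \<longlonglongrightarrow> b" and limv: "(\<lambda>k. vk (k + K)) \<longlonglongrightarrow> v"
    and limn: "(\<lambda>k. norm (vk (k + K) - P (bk (k + K)))) \<longlonglongrightarrow> norm (v - P b)"
    by (rule LIMSEQ_ignore_initial_segment[OF bk(2)], rule LIMSEQ_ignore_initial_segment[OF vk(2)],
        rule LIMSEQ_ignore_initial_segment[OF lim2])
  obtain B1 where B1: "\<And>k. norm (bk (k + K)) \<le> B1"
    using convergent_imp_bounded[OF limb] by (auto simp: bounded_iff)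
  obtain B2 where B2: "\<And>k. norm (vk (k + K) - P (bk (k + K))) \<le> B2"
    using convergent_imp_bounded[OF limn] by (auto simp: bounded_iff)
  have "norm (Y k) \<le> B1 + 4 * B2" for k
    using Y(2)[of k] B1[of k] B2[of k] norm_triangle_ineq[of "bk (k + K)" "Y k - bk (k + K)"] by simp
  then have "bounded (range Y)" by (auto simp: bounded_iff)
  then obtain x s where s: "strict_mono s" "(Y \<circ> s) \<longlonglongrightarrow> x"
    using bounded_imp_convergent_subsequence by blast
  have "(\<lambda>k. P ((Y \<circ> s) k)) \<longlonglongrightarrow> P x"
    by (rule continuous_on_tendsto_compose[OF P_continuous[of UNIV] s(2)]) auto
  moreover have "(\<lambda>k. P ((Y \<circ> s) k)) \<longlonglongrightarrow> v"
    using LIMSEQ_subseq_LIMSEQ[OF limv s(1)] by (simp add: o_def Y(1))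
  ultimately have "P x = v" by (rule LIMSEQ_unique)
  moreover have "norm (x - b) \<le> 4 * norm (v - P b)"
  proof (rule LIMSEQ_le)
    show "(\<lambda>k. norm ((Y \<circ> s) k - ((\<lambda>k. bk (k + K)) \<circ> s) k)) \<longlonglongrightarrow> norm (x - b)"
      by (intro tendsto_intros s(2) LIMSEQ_subseq_LIMSEQ[OF limb s(1)])
    show "(\<lambda>k. 4 * ((\<lambda>k. norm (vk (k + K) - P (bk (k + K)))) \<circ> s) k) \<longlonglongrightarrow> 4 * norm (v - P b)"
      by (intro tendsto_intros LIMSEQ_subseq_LIMSEQ[OF limn s(1)])
  qed (use Y(2) in auto)
  ultimately show ?thesis by blast
qed

end

section \<open>Weakly convex integrands\<close>

locale weakly_convex_integrand = lipschitz_integrand M g a r L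
  for M :: "'t measure" and g :: "'t \<Rightarrow> 'a::euclidean_space \<Rightarrow> real" and a r L +
  assumes g_weakly_convex: "\<And>t u v s. t \<in> space M \<Longrightarrow> u \<in> cball a r \<Longrightarrow> v \<in> cball a r \<Longrightarrow> 0 \<le> s \<Longrightarrow> s \<le> 1 \<Longrightarrow>
     g t ((1 - s) *\<^sub>R u + s *\<^sub>R v) \<le> (1 - s) * g t u + s * g t v + L t / 2 * (s * (1 - s)) * (norm (u - v))\<^sup>2"
begin

lemma weakly_convex_at: "t \<in> space M \<Longrightarrow> weakly_convex (g t) a r (L t)"
  by unfold_locales (use r L_pos g_lipschitz g_weakly_convex in blast)+

abbreviation Pt :: "'t \<Rightarrow> 'a \<Rightarrow> 'a" where
  "Pt t \<equiv> weakly_convex.P (g t) a r (L t)"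

abbreviation subd :: "'t \<Rightarrow> 'a \<Rightarrow> 'a set" where
  "subd t \<equiv> weakly_convex.prox_subdiff (g t) a r (L t)"

lemma Pt_measurable: "(\<lambda>t. Pt t x) \<in> borel_measurable M"
proof -
  \<comment> \<open>For K = 2 the penalized function is exactly the one that \<open>Pt t\<close>
    minimizes, and its minimizer is unique, so the measurable argmin coincides with
    \<open>Pt t x\<close>.\<close>
  obtain u where u: "u \<in> borel_measurable M" "\<And>t. t \<in> space M \<Longrightarrow> u t \<in> cball a r"
    "\<And>t y. t \<in> space M \<Longrightarrow> y \<in> cball a r \<Longrightarrow> penalized 2 x t (u t) \<le> penalized 2 x t y"
    by (rule penalized_argmin[of 2 x]) (simp, rule that)
  have "Pt t x = u t" if t: "t \<in> space M" for t
  proof -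
    interpret t: weakly_convex "g t" a r "L t" by (rule weakly_convex_at[OF t])
    show ?thesis
      by (rule t.P_unique[OF u(2)[OF t]]) (use u(3)[OF t] in \<open>simp add: t.penalty_def penalized_def\<close>)
  qed
  then show ?thesis using u(1) by (simp cong: measurable_cong)
qed

lemma Pt_composition_measurable:
  assumes "X \<in> borel_measurable M" shows "(\<lambda>t. Pt t (X t)) \<in> borel_measurable M"
proof (rule Caratheodory_measurable[where K=UNIV, OF Pt_measurable _ assms])
  show "continuous_on UNIV (Pt t)" if "t \<in> space M" for t
    by (rule weakly_convex.P_continuous[OF weakly_convex_at[OF that]])
qed auto

text \<open>Both inequalities integrate. The summand 1 keeps the modulus positive even if the
  measure is zero.\<close>

lemma weakly_convex_G: "weakly_convex G a r (integral\<^sup>L M L + 1)"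
proof
  show "0 < integral\<^sup>L M L + 1" using integral_L_nonneg by simp
  show "0 < r" by (rule r)
  show "\<bar>G x - G y\<bar> \<le> (integral\<^sup>L M L + 1) * norm (x - y)" if xy: "x \<in> cball a r" "y \<in> cball a r" for x y
  proof -
    have "\<bar>G x - G y\<bar> = norm (\<integral>t. g t x - g t y \<partial>M)"
      unfolding G_def using g_integrable[OF xy(1)] g_integrable[OF xy(2)] by simp
    also have "\<dots> \<le> (\<integral>t. norm (g t x - g t y) \<partial>M)" by (rule integral_norm_bound)
    also have "\<dots> \<le> (\<integral>t. L t * norm (x - y) \<partial>M)"
      by (rule integral_mono) (use g_integrable[OF xy(1)] g_integrable[OF xy(2)] L_int g_lipschitz[OF _ xy] in auto)
    also have "\<dots> = integral\<^sup>L M L * norm (x - y)" by simp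
    also have "\<dots> \<le> (integral\<^sup>L M L + 1) * norm (x - y)" by (intro mult_right_mono) auto
    finally show ?thesis .
  qed
  fix u v :: 'a and s :: real assume uv: "u \<in> cball a r" "v \<in> cball a r" "0 \<le> s" "s \<le> 1"
  let ?w = "(1 - s) *\<^sub>R u + s *\<^sub>R v"
  define c where "c = s * (1 - s) * (norm (u - v))\<^sup>2 / 2"
  have w: "?w \<in> cball a r" using uv convex_cball[of a r] unfolding convex_alt by blast
  have "G ?w \<le> (\<integral>t. (1 - s) * g t u + s * g t v + L t * c \<partial>M)"
    unfolding G_def
  proof (rule integral_mono[OF g_integrable[OF w]])
    show "g t ?w \<le> (1 - s) * g t u + s * g t v + L t * c" if "t \<in> space M" for t
      using g_weakly_convex[OF that uv] by (simp add: c_def algebra_simps)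
  qed (use g_integrable[OF uv(1)] g_integrable[OF uv(2)] L_int in auto)
  also have "\<dots> = (1 - s) * G u + s * G v + integral\<^sup>L M L * c"
    unfolding G_def using g_integrable[OF uv(1)] g_integrable[OF uv(2)] L_int by simp
  also have "integral\<^sup>L M L * c \<le> (integral\<^sup>L M L + 1) * c"
    unfolding c_def using uv by (intro mult_right_mono) auto
  finally show "G ?w \<le> (1 - s) * G u + s * G v + (integral\<^sup>L M L + 1) / 2 * (s * (1 - s)) * (norm (u - v))\<^sup>2"
    by (simp add: c_def algebra_simps)
qed

lemma subdifferential_eq_subd:
  assumes "t \<in> space M" "\<forall>x\<in>cball a r. f x = ereal (g t x)" "u \<in> ball a r"
  shows "subdifferential f u = subd t u"
  using weakly_convex.subdifferential_eq_prox[OF weakly_convex_at[OF assms(1)], of f u] assms(2,3) by blast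

text \<open>The Leibniz rule approximates w t by proximal subgradients at points near a, with
  uncontrolled moduli C. Weak convexity improves them to members of \<open>subd t\<close> with the
  fixed modulus L t, and these are closed under limits.\<close>

lemma subgradient_selection:
  assumes y: "y \<in> weakly_convex.prox_subdiff G a r (integral\<^sup>L M L + 1) a"
  obtains w where "integrable M w" "integral\<^sup>L M w = y" "AE t in M. w t \<in> subd t a"
proof -
  interpret G: weakly_convex G a r "integral\<^sup>L M L + 1" by (rule weakly_convex_G)
  have ar: "a \<in> ball a r" using r by simp
  have "\<exists>b z' \<delta>. 0 < \<delta> \<and> norm (b - a) < \<epsilon> \<and> norm (z' - y) < \<epsilon> \<and>
      (\<forall>x. norm (x - b) \<le> \<delta> \<longrightarrow> G b + z' \<bullet> (x - b) - \<epsilon> * norm (x - b) \<le> G x)" if \<epsilon>: "0 < \<epsilon>" for \<epsilon>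
  proof -
    obtain \<delta> where \<delta>: "0 < \<delta>"
      "\<And>v. norm (v - a) < \<delta> \<Longrightarrow> v \<in> ball a r \<and> G a + y \<bullet> (v - a) - \<epsilon> * norm (v - a) \<le> G v"
      by (rule G.prox_imp_regular_subgradient[OF ar y \<epsilon>]) (rule that)
    show ?thesis
      by (rule exI[of _ a], rule exI[of _ y], rule exI[of _ "\<delta> / 2"]) (use \<delta> \<epsilon> in auto)
  qed
  from Leibniz_rule[OF this] obtain w where w: "integrable M w" "integral\<^sup>L M w = y"
    "AE t in M. \<forall>e>0. \<exists>u m C d. norm (u - a) < e \<and> norm (m - w t) < e \<and> 0 < d \<and>
       (\<forall>y. norm (y - u) < d \<longrightarrow> g t u + m \<bullet> (y - u) - C * (norm (y - u))\<^sup>2 \<le> g t y)"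
    by blast
  have "AE t in M. w t \<in> subd t a"
    using w(3) AE_space
  proof eventually_elim
    case (elim t)
    interpret t: weakly_convex "g t" a r "L t" by (rule weakly_convex_at[OF elim(2)])
    have "\<exists>u m. norm (u - a) < e \<and> u \<in> cball a r \<and> norm (m - w t) < e \<and> m \<in> t.prox_subdiff u"
      if e: "0 < e" for e
    proof -
      obtain u m C d where u: "norm (u - a) < min e r" "norm (m - w t) < min e r" "0 < d"
        and le: "\<And>y. norm (y - u) < d \<Longrightarrow> g t u + m \<bullet> (y - u) - C * (norm (y - u))\<^sup>2 \<le> g t y"
        using elim(1)[rule_format, of "min e r"] e r by auto
      have uc: "u \<in> cball a r" using u(1) by (simp add: dist_norm norm_minus_commute)
      have "m \<in> t.prox_subdiff u"
      proof (rule t.regular_subgradient_imp_prox[OF uc])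
        fix \<epsilon> :: real assume \<epsilon>: "0 < \<epsilon>"
        define \<delta> where "\<delta> = min d (\<epsilon> / (\<bar>C\<bar> + 1))"
        have \<delta>: "0 < \<delta>" "\<delta> \<le> d" "\<delta> \<le> \<epsilon> / (\<bar>C\<bar> + 1)" using u(3) \<epsilon> by (auto simp: \<delta>_def)
        have "g t u + m \<bullet> (v - u) - \<epsilon> * norm (v - u) \<le> g t v" if v: "norm (v - u) < \<delta>" for v
        proof -
          have "C * (norm (v - u))\<^sup>2 \<le> \<epsilon> * norm (v - u)"
            by (rule quadratic_le_linear[OF \<epsilon>]) (use v \<delta>(3) in auto)
          then show ?thesis using le[of v] v \<delta>(2) by simp
        qed
        with \<delta>(1) show "\<exists>\<delta>>0. \<forall>v\<in>cball a r. norm (v - u) < \<delta> \<longrightarrow> g t u + m \<bullet> (v - u) - \<epsilon> * norm (v - u) \<le> g t v"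
          by blast
      qed
      with u uc show ?thesis by auto
    qed
    then have "\<exists>u m. norm (u - a) < 1 / Suc k \<and> u \<in> cball a r \<and> norm (m - w t) < 1 / Suc k \<and> m \<in> t.prox_subdiff u" for k :: nat
      by (simp add: zero_less_divide_iff)
    then obtain u m where um: "\<And>k. norm (u k - a) < 1 / Suc k" "\<And>k. u k \<in> cball a r"
      "\<And>k. norm (m k - w t) < 1 / Suc k" "\<And>k. m k \<in> t.prox_subdiff (u k)" by metis
    have "u \<longlonglongrightarrow> a"
      by (rule LIM_zero_cancel, rule Lim_null_comparison[OF _ inverse_Suc_tendsto_zero])
        (use um(1) in \<open>auto intro!: always_eventually less_imp_le\<close>)
    moreover have "m \<longlonglongrightarrow> w t"
      by (rule LIM_zero_cancel, rule Lim_null_comparison[OF _ inverse_Suc_tendsto_zero])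
        (use um(3) in \<open>auto intro!: always_eventually less_imp_le\<close>)
    ultimately show ?case
      by (intro t.prox_subdiff_closed[of u a m] um) (use r in auto)
  qed
  with w(1,2) that show ?thesis by blast
qed

end

section \<open>Single-valuedness of the subdifferential\<close>

lemma norm_divideR_pos: "0 < c \<Longrightarrow> norm (v /\<^sub>R c) = norm v / c"
  for v :: "'a::real_normed_vector"
  by (simp only: norm_scaleR abs_inverse abs_of_pos divide_inverse mult.commute)

lemma in_LinfI:
  assumes "x \<in> borel_measurable M" "AE t in M. norm (x t) \<le> c"
  shows "in_Linf M x"
proof -
  have "esssup M (\<lambda>t. ereal (norm (x t))) \<le> ereal c"
    by (rule esssup_I) (use assms in auto)
  also have "ereal c < \<infinity>" by simp
  finally show ?thesis using assms(1) unfolding in_Linf_def Linf_norm_def by blast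
qed

context weakly_convex_integrand
begin

context
  fixes \<phi> :: "'t \<Rightarrow> 'a \<Rightarrow> ereal" and w :: "'t \<Rightarrow> 'a" and l :: "'t \<Rightarrow> real" and \<eta> \<rho> :: real
  assumes L1: "\<And>t. t \<in> space M \<Longrightarrow> 1 \<le> L t"
    and lL: "\<And>t. t \<in> space M \<Longrightarrow> l t \<le> L t"
    and \<phi>: "AE t in M. \<forall>x\<in>cball a r. \<phi> t x = ereal (g t x)"
    and w: "integrable M w" "AE t in M. w t \<in> subd t a"
    and quasi: "\<And>x y y'. in_Linf M x \<Longrightarrow> Linf_norm M (\<lambda>t. x t - a) \<le> ereal \<eta> \<Longrightarrow>
           integrable M y \<Longrightarrow> L1_norm M (\<lambda>t. y t - w t) \<le> \<eta> \<Longrightarrow>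
           (AE t in M. y t \<in> subdifferential (\<phi> t) (x t)) \<Longrightarrow> in_Linf M y' \<Longrightarrow>
           (AE t in M. (SUP x'\<in>second_subdifferential (\<phi> t) (x t) (y t) (y' t). ereal (norm x'))
                         \<le> ereal (l t * norm (y' t)))"
    and \<rho>: "0 < \<rho>" "\<rho> \<le> 1 / 8" "10 * \<rho> < r" "10 * \<rho> \<le> \<eta>" "30 * \<rho> * integral\<^sup>L M L \<le> \<eta>"
begin

text \<open>The Minty parameter of the graph point (a, w t).\<close>

definition center :: "'t \<Rightarrow> 'a" where "center t = a + w t /\<^sub>R (2 * L t)"

lemma Pt_center: "AE t in M. Pt t (center t) = a"
  using w(2) AE_space
proof eventually_elim
  case (elim t)
  then show ?case
    unfolding center_def using r by (intro weakly_convex.P_of_subgradient[OF weakly_convex_at]) auto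
qed

lemma w_measurable[measurable]: "w \<in> borel_measurable M"
  using w(1) by auto

lemma center_measurable[measurable]: "center \<in> borel_measurable M"
  unfolding center_def by measurable

text \<open>A quantitative coderivative criterion, by contradiction. Let D be the set of t where the
  minimizer X t of a penalized distance to v still has P value different from v. There the
  optimality condition gives a graph normal (m - e, m / (2 L)) with |e| = 1 and |m| \<le> 1/2. The
  graph points on D, completed by (a, w t) off D, form a pair admissible for \<open>quasi\<close>,
  which yields |m - e| \<le> |m| / 2 almost everywhere on D and hence 1 \<le> 3/4. So D is null. The
  exceptional set depends on b and v.\<close>

lemma covering_at:
  "AE t in M. norm (b - center t) < \<rho> \<longrightarrow> norm (v - Pt t b) < \<rho> \<longrightarrow>
     (\<exists>x. Pt t x = v \<and> norm (x - b) \<le> 4 * norm (v - Pt t b))"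
proof -
  define \<tau> where "\<tau> t = norm (Pt t b - v)" for t
  note [measurable] = Pt_measurable[of b]
  have \<tau>m[measurable]: "\<tau> \<in> borel_measurable M" unfolding \<tau>_def by measurable
  \<comment> \<open>The weight 16 \<tau> has two effects: comparison with b gives |X t - b| \<le> 4
    \<tau> t, the asserted rate, and then |m t| \<le> 4 \<tau> t / (8 \<tau> t) = 1/2. For \<tau> t
    < \<rho> \<le> 1/8 the minimizer stays within 1/2 of b, hence inside the unit ball.\<close>
  obtain X where X[measurable]: "X \<in> borel_measurable M" and XK: "\<And>t. t \<in> space M \<Longrightarrow> X t \<in> cball b 1"
    and Xmin: "\<And>t x. t \<in> space M \<Longrightarrow> x \<in> cball b 1 \<Longrightarrow>
       16 * \<tau> t * norm (Pt t (X t) - v) + (norm (X t - b))\<^sup>2 \<le> 16 * \<tau> t * norm (Pt t x - v) + (norm (x - b))\<^sup>2"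
  proof (rule measurable_argmin[of "cball b 1" "\<lambda>t x. 16 * \<tau> t * norm (Pt t x - v) + (norm (x - b))\<^sup>2" M])
    show "(\<lambda>t. 16 * \<tau> t * norm (Pt t x - v) + (norm (x - b))\<^sup>2) \<in> borel_measurable M" for x
      using Pt_measurable[of x] by measurable
    show "continuous_on (cball b 1) (\<lambda>x. 16 * \<tau> t * norm (Pt t x - v) + (norm (x - b))\<^sup>2)"
      if "t \<in> space M" for t
      by (intro continuous_intros weakly_convex.P_continuous[OF weakly_convex_at[OF that]])
  qed (auto intro: that)
  note [measurable] = Pt_composition_measurable[OF X]
  define D where "D = {t\<in>space M. norm (b - center t) < \<rho> \<and> \<tau> t < \<rho> \<and> Pt t (X t) \<noteq> v}"
  have [measurable]: "D \<in> sets M" unfolding D_def by measurable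
  have XD: "norm (X t - b) \<le> 4 * \<tau> t" if t: "t \<in> space M" for t
  proof -
    have "0 \<le> 16 * \<tau> t * norm (Pt t (X t) - v)" by (simp add: \<tau>_def)
    then have "(norm (X t - b))\<^sup>2 \<le> 16 * \<tau> t * norm (Pt t b - v)"
      using Xmin[OF t, of b] by simp
    also have "\<dots> = (4 * \<tau> t)\<^sup>2" by (simp add: \<tau>_def power2_eq_square)
    finally show ?thesis by (rule power2_le_imp_le) (simp add: \<tau>_def)
  qed
  \<comment> \<open>Off D the pair is the unperturbed graph point (a, w t). The direction y' below
    carries a minus sign because the coderivative is defined through normals (x*, -y').\<close>
  define x where "x t = (if t \<in> D then Pt t (X t) else a)" for t
  define y where "y t = (if t \<in> D then (2 * L t) *\<^sub>R (X t - Pt t (X t)) else w t)" for t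
  define m where "m t = - ((X t - b) /\<^sub>R (8 * \<tau> t))" for t
  define y' where "y' t = (if t \<in> D then - (m t /\<^sub>R (2 * L t)) else 0)" for t
  have [measurable]: "x \<in> borel_measurable M" "y \<in> borel_measurable M" "m \<in> borel_measurable M"
    "y' \<in> borel_measurable M" unfolding x_def y_def m_def y'_def by measurable
  have m: "norm (m t) \<le> 1 / 2" if t: "t \<in> space M" for t
  proof (cases "\<tau> t = 0")
    case False
    then have "0 < \<tau> t" by (simp add: \<tau>_def)
    then have "norm (m t) = norm (X t - b) / (8 * \<tau> t)"
      unfolding m_def norm_minus_cancel by (intro norm_divideR_pos) simp
    also have "\<dots> \<le> 4 * \<tau> t / (8 * \<tau> t)" using XD[OF t] \<open>0 < \<tau> t\<close> by (intro divide_right_mono) auto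
    also have "\<dots> = 1 / 2" using \<open>0 < \<tau> t\<close> by simp
    finally show ?thesis .
  qed (simp add: m_def)
  have distD: "norm (X t - center t) \<le> 5 * \<rho> \<and> norm (Pt t (X t) - a) \<le> 10 * \<rho>"
    if t: "t \<in> D" and P: "Pt t (center t) = a" for t
  proof -
    have "t \<in> space M" "norm (b - center t) < \<rho>" "\<tau> t < \<rho>" using t by (auto simp: D_def)
    then have 1: "norm (X t - center t) \<le> 5 * \<rho>"
      using XD[of t] norm_triangle_ineq[of "X t - b" "b - center t"] by simp
    have "norm (Pt t (X t) - Pt t (center t)) \<le> 2 * norm (X t - center t)"
      by (rule weakly_convex.P_lipschitz[OF weakly_convex_at[OF \<open>t \<in> space M\<close>]])
    with 1 P show ?thesis by simp
  qed
  have x_bound: "AE t in M. norm (x t - a) \<le> 10 * \<rho>"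
    using Pt_center by eventually_elim (use distD \<rho>(1) in \<open>auto simp: x_def\<close>)
  \<comment> \<open>Subgradients are 2 L t times differences of parameters, and 5 \<rho> + 10 \<rho>
    bounds these differences. The bound is integrable, so closeness in L1 follows although it is not
    uniform in t.\<close>
  have y_bound: "AE t in M. norm (y t - w t) \<le> 30 * \<rho> * L t"
    using Pt_center AE_space
  proof eventually_elim
    case (elim t)
    have Lt: "0 < L t" by (rule L_pos[OF elim(2)])
    show ?case
    proof (cases "t \<in> D")
      case True
      have "y t - w t = (2 * L t) *\<^sub>R ((X t - center t) - (Pt t (X t) - a))"
        using True Lt by (simp add: y_def center_def algebra_simps)
      then have "norm (y t - w t) = 2 * L t * norm ((X t - center t) - (Pt t (X t) - a))" using Lt by simp
      also have "\<dots> \<le> 2 * L t * (5 * \<rho> + 10 * \<rho>)"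
        using distD[OF True elim(1)] norm_triangle_ineq4[of "X t - center t" "Pt t (X t) - a"] Lt
        by (intro mult_left_mono) auto
      finally show ?thesis by (simp add: mult_ac)
    qed (use Lt \<rho>(1) in \<open>simp add: y_def\<close>)
  qed
  have yw: "integrable M (\<lambda>t. y t - w t)"
  proof (rule Bochner_Integration.integrable_bound)
    show "integrable M (\<lambda>t. 30 * \<rho> * L t)" using L_int by simp
    show "AE t in M. norm (y t - w t) \<le> norm (30 * \<rho> * L t)"
      using y_bound by eventually_elim simp
  qed measurable
  have Q: "AE t in M. (SUP x'\<in>second_subdifferential (\<phi> t) (x t) (y t) (y' t). ereal (norm x'))
                         \<le> ereal (l t * norm (y' t))"
  proof (rule quasi)
    show "in_Linf M x"
    proof (rule in_LinfI[of _ _ "norm a + 10 * \<rho>"])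
      show "AE t in M. norm (x t) \<le> norm a + 10 * \<rho>"
        using x_bound
      proof eventually_elim
        case (elim t)
        then show ?case using norm_triangle_ineq2[of "x t" a] by linarith
      qed
    qed measurable
    show "Linf_norm M (\<lambda>t. x t - a) \<le> ereal \<eta>"
      unfolding Linf_norm_def
    proof (rule esssup_I)
      show "AE t in M. ereal (norm (x t - a)) \<le> ereal \<eta>"
        using x_bound by eventually_elim (use \<rho>(4) in simp)
    qed measurable
    show "integrable M y" using Bochner_Integration.integrable_add[OF yw w(1)] by simp
    have "L1_norm M (\<lambda>t. y t - w t) \<le> (\<integral>t. 30 * \<rho> * L t \<partial>M)"
      unfolding L1_norm_def by (rule integral_mono_AE) (use yw L_int y_bound in auto)
    then show "L1_norm M (\<lambda>t. y t - w t) \<le> \<eta>" using \<rho>(5) by simp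
    show "AE t in M. y t \<in> subdifferential (\<phi> t) (x t)"
      using Pt_center w(2) \<phi> AE_space
    proof eventually_elim
      case (elim t)
      interpret t: weakly_convex "g t" a r "L t" by (rule weakly_convex_at[OF elim(4)])
      note eq = subdifferential_eq_subd[OF elim(4,3)]
      show ?case
      proof (cases "t \<in> D")
        case True
        have "norm (Pt t (X t) - a) < r" using distD[OF True elim(1)] \<rho>(3) by linarith
        then have "Pt t (X t) \<in> ball a r" by (simp add: dist_norm norm_minus_commute)
        then show ?thesis using True t.P_subgradient[of "X t"] by (simp add: x_def y_def eq)
      next
        case False
        have "a \<in> ball a r" using r by simp
        then show ?thesis using False elim(2) by (simp add: x_def y_def eq)
      qed
    qed
    show "in_Linf M y'"
    proof (rule in_LinfI[of _ _ 1], measurable, rule AE_I2)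
      fix t assume t: "t \<in> space M"
      have "norm (m t /\<^sub>R (2 * L t)) = norm (m t) / (2 * L t)"
        using L_pos[OF t] by (intro norm_divideR_pos) simp
      also have "\<dots> \<le> (1 / 2) / (2 * L t)" using m[OF t] L_pos[OF t] by (intro divide_right_mono) auto
      also have "\<dots> \<le> 1" using L1[OF t] by (simp add: field_simps)
      finally show "norm (y' t) \<le> 1" by (simp add: y'_def)
    qed
  qed
  have "AE t in M. t \<notin> D"
    using Q Pt_center \<phi> AE_space
  proof eventually_elim
    case (elim t)
    show ?case
    proof
      assume D: "t \<in> D"
      note t = elim(4)
      interpret t: weakly_convex "g t" a r "L t" by (rule weakly_convex_at[OF t])
      have Lt: "0 < L t" by (rule L_pos[OF t])
      have ne: "Pt t (X t) \<noteq> v" and \<tau>\<rho>: "\<tau> t < \<rho>" using D by (auto simp: D_def)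
      have "\<tau> t \<noteq> 0"
      proof
        assume z: "\<tau> t = 0"
        then have "X t = b" using XD[OF t] by simp
        with z ne show False by (simp add: \<tau>_def)
      qed
      then have \<tau>0: "0 < \<tau> t" by (simp add: \<tau>_def)
      have "norm (Pt t (X t) - a) < r" using distD[OF D elim(2)] \<rho>(3) by linarith
      then have ball: "Pt t (X t) \<in> ball a r" by (simp add: dist_norm norm_minus_commute)
      define e where "e = (Pt t (X t) - v) /\<^sub>R norm (Pt t (X t) - v)"
      have min: "16 * \<tau> t * norm (Pt t (X t) - v) + (norm (X t - b))\<^sup>2 \<le> 16 * \<tau> t * norm (Pt t x' - v) + (norm (x' - b))\<^sup>2"
        if "norm (x' - X t) < 1 / 2" for x'
      proof (rule Xmin[OF t])
        have "norm (X t - b) \<le> 1 / 2" using XD[OF t] \<tau>\<rho> \<rho>(2) by linarith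
        then show "x' \<in> cball b 1"
          using that norm_triangle_ineq[of "x' - X t" "X t - b"] by (simp add: dist_norm norm_minus_commute)
      qed
      have \<phi>t: "\<phi> t u = ereal (g t u)" if "u \<in> cball a r" for u using elim(3) that by blast
      have e: "norm e = 1" and "(m t - e, m t /\<^sub>R (2 * L t)) \<in>
          regular_normal_cone (Pt t (X t), (2 * L t) *\<^sub>R (X t - Pt t (X t))) (gph (subdifferential (\<phi> t)))"
        unfolding e_def m_def
        by (rule t.local_minimizer_normal[OF \<phi>t ball \<tau>0 ne _ min, of "1 / 2"]; simp)+
      then have "(m t - e, m t /\<^sub>R (2 * L t)) \<in>
          limiting_normal_cone (Pt t (X t), (2 * L t) *\<^sub>R (X t - Pt t (X t))) (gph (subdifferential (\<phi> t)))"
        using regular_normal_cone_subset_limiting by blast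
      then have "m t - e \<in> second_subdifferential (\<phi> t) (x t) (y t) (y' t)"
        using D by (simp add: second_subdifferential_def coderivative_def x_def y_def y'_def)
      then have "ereal (norm (m t - e)) \<le> ereal (l t * norm (y' t))"
        using elim(1) by (meson SUP_upper order_trans)
      then have "norm (m t - e) \<le> l t * norm (y' t)" by simp
      also have "\<dots> \<le> L t * norm (y' t)" using lL[OF t] by (intro mult_right_mono) auto
      also have "norm (y' t) = norm (m t) / (2 * L t)"
        using D Lt norm_divideR_pos[of "2 * L t" "m t"] by (simp add: y'_def del: norm_scaleR)
      also have "L t * (norm (m t) / (2 * L t)) = norm (m t) / 2" using Lt by simp
      \<comment> \<open>The factor L t from the quasi-Lipschitzian bound cancels against the 2 L t
        of Minty's scaling and leaves 1/2, whatever the size of L t.\<close>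
      finally have "norm (m t - e) \<le> norm (m t) / 2" .
      then have "norm e \<le> norm (m t) + norm (m t) / 2"
        using norm_triangle_ineq4[of "m t" "m t - e"] by simp
      with e m[OF t] show False by simp
    qed
  qed
  with AE_space show ?thesis
  proof eventually_elim
    case (elim t)
    show ?case
    proof (intro impI)
      assume "norm (b - center t) < \<rho>" "norm (v - Pt t b) < \<rho>"
      then have "Pt t (X t) = v" using elim by (simp add: D_def \<tau>_def norm_minus_commute)
      then show "\<exists>x. Pt t x = v \<and> norm (x - b) \<le> 4 * norm (v - Pt t b)"
        using XD[OF elim(1)] by (auto simp: \<tau>_def norm_minus_commute)
    qed
  qed
qed

lemma subdifferential_single_valued:
  "AE t in M. \<exists>F. (\<forall>u\<in>ball a (\<rho> / 8). subd t u = {F u}) \<and>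
      (\<forall>u\<in>ball a (\<rho> / 8). \<forall>v\<in>ball a (\<rho> / 8). norm (F u - F v) \<le> 10 * L t * norm (u - v))"
proof -
  obtain D :: "'a set" where D: "countable D" "D \<subseteq> UNIV" "UNIV \<subseteq> closure D"
    by (rule separable)
  \<comment> \<open>There is one null set for each pair (b, v); countability of D merges them into
    one.\<close>
  have "AE t in M. \<forall>b\<in>D. \<forall>v\<in>D. norm (b - center t) < \<rho> \<longrightarrow> norm (v - Pt t b) < \<rho> \<longrightarrow>
     (\<exists>x. Pt t x = v \<and> norm (x - b) \<le> 4 * norm (v - Pt t b))"
    unfolding AE_ball_countable[OF D(1)] by (intro ballI covering_at)
  then show ?thesis
    using Pt_center AE_space
  proof eventually_elim
    case (elim t)
    interpret t: weakly_convex "g t" a r "L t" by (rule weakly_convex_at[OF elim(3)])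
    have "\<exists>x. t.P x = v \<and> norm (x - b) \<le> 4 * norm (v - t.P b)"
      if "norm (b - center t) < \<rho>" "norm (v - t.P b) < \<rho>" for b v
      by (rule t.covering_from_dense[of D]) (use D(3) elim(1) that in auto)
    from t.inverse_lipschitz[OF \<rho>(1) elim(2) this]
    obtain F where "\<And>u. u \<in> ball a (min r (\<rho> / 8)) \<Longrightarrow> t.prox_subdiff u = {F u}"
      "\<And>u v. u \<in> ball a (min r (\<rho> / 8)) \<Longrightarrow> v \<in> ball a (min r (\<rho> / 8)) \<Longrightarrow> norm (F u - F v) \<le> 10 * L t * norm (u - v)"
      by blast
    moreover have "min r (\<rho> / 8) = \<rho> / 8" using \<rho>(1,3) by simp
    ultimately show ?case by (intro exI[of _ F]) simp
  qed
qed

end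

end

section \<open>The second-order Leibniz rule\<close>

text \<open>One half of the scalarization of coderivatives: subgradients of y' \<bullet> f produce
  normals to the graph of f, because graph distances dominate distances of arguments.\<close>

lemma graph_regular_normalI:
  assumes d: "0 < d" and S: "\<And>v. norm (v - u) < d \<Longrightarrow> S v = {f v}"
    and le: "\<And>v. norm (v - u) < d \<Longrightarrow> y' \<bullet> f u + m \<bullet> (v - u) - C * (norm (v - u))\<^sup>2 \<le> y' \<bullet> f v"
  shows "(m, - y') \<in> regular_normal_cone (u, f u) (gph S)"
proof (rule regular_normal_coneI)
  show "(u, f u) \<in> gph S" using S[of u] d by (simp add: gph_def)
  fix \<epsilon> :: real assume \<epsilon>: "0 < \<epsilon>"
  define \<delta> where "\<delta> = min d (\<epsilon> / (\<bar>C\<bar> + 1))"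
  have \<delta>: "0 < \<delta>" "\<delta> \<le> d" "\<delta> \<le> \<epsilon> / (\<bar>C\<bar> + 1)" using d \<epsilon> by (auto simp: \<delta>_def)
  have "(m, - y') \<bullet> (z - (u, f u)) \<le> \<epsilon> * norm (z - (u, f u))"
    if z: "z \<in> gph S" "norm (z - (u, f u)) < \<delta>" for z
  proof -
    obtain v y where zv: "z = (v, y)" by (cases z)
    have n: "norm (v - u) \<le> norm (z - (u, f u))" by (simp add: zv norm_fst_le)
    then have nd: "norm (v - u) < \<delta>" using z(2) by simp
    have y: "y = f v" using z(1) S[of v] nd \<delta>(2) by (simp add: zv gph_def)
    have "C * (norm (v - u))\<^sup>2 \<le> \<epsilon> * norm (v - u)"
      by (rule quadratic_le_linear[OF \<epsilon>]) (use nd \<delta>(3) in auto)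
    also have "\<dots> \<le> \<epsilon> * norm (z - (u, f u))" using n \<epsilon> by (intro mult_left_mono) auto
    finally show ?thesis
      using le[of v] nd \<delta>(2) by (simp add: zv y inner_prod_def inner_diff_right)
  qed
  with \<delta>(1) show "\<exists>\<delta>>0. \<forall>z\<in>gph S. norm (z - (u, f u)) < \<delta> \<longrightarrow>
      (m, - y') \<bullet> (z - (u, f u)) \<le> \<epsilon> * norm (z - (u, f u))" by blast
qed

text \<open>The other half of the scalarization. The Lipschitz bound makes graph distances at most 1
  + K times distances of arguments.\<close>

lemma graph_regular_normalD:
  assumes n: "(m, - y') \<in> regular_normal_cone (u, y) (gph S)"
    and d: "0 < d" and S: "\<And>v. norm (v - u) < d \<Longrightarrow> S v = {f v}"
    and K: "0 \<le> K" and lip: "\<And>v. norm (v - u) < d \<Longrightarrow> norm (f v - f u) \<le> K * norm (v - u)" and \<epsilon>: "0 < \<epsilon>"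
  obtains \<delta> where "0 < \<delta>" "\<delta> \<le> d"
    "\<And>v. norm (v - u) < \<delta> \<Longrightarrow> y' \<bullet> f u + m \<bullet> (v - u) - \<epsilon> * norm (v - u) \<le> y' \<bullet> f v"
proof -
  have y: "y = f u" using regular_normal_coneD(1)[OF n] S[of u] d by (simp add: gph_def)
  have \<epsilon>': "0 < \<epsilon> / (1 + K)" using \<epsilon> K by simp
  obtain \<delta> where \<delta>: "0 < \<delta>" "\<And>z. z \<in> gph S \<Longrightarrow> norm (z - (u, f u)) < \<delta> \<Longrightarrow>
      (m, - y') \<bullet> (z - (u, f u)) \<le> \<epsilon> / (1 + K) * norm (z - (u, f u))"
    using regular_normal_coneD(2)[OF n \<epsilon>'] unfolding y by blast
  show ?thesis
  proof (rule that[of "min d (\<delta> / (1 + K))"])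
    show "0 < min d (\<delta> / (1 + K))" using d \<delta>(1) K by simp
    fix v assume v: "norm (v - u) < min d (\<delta> / (1 + K))"
    have "norm ((v, f v) - (u, f u)) \<le> norm (v - u) + norm (f v - f u)"
      using norm_Pair_le[of "v - u" "f v - f u"] by simp
    also have "\<dots> \<le> (1 + K) * norm (v - u)" using lip[of v] v by (simp add: algebra_simps)
    finally have nz: "norm ((v, f v) - (u, f u)) \<le> (1 + K) * norm (v - u)" .
    also have "\<dots> < (1 + K) * (\<delta> / (1 + K))" using v K by (intro mult_strict_left_mono) auto
    also have "\<dots> = \<delta>" using K by (simp add: add_nonneg_eq_0_iff)
    finally have "(m, - y') \<bullet> ((v, f v) - (u, f u)) \<le> \<epsilon> / (1 + K) * norm ((v, f v) - (u, f u))"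
      using S[of v] v by (intro \<delta>(2)) (simp_all add: gph_def)
    also have "\<dots> \<le> \<epsilon> / (1 + K) * ((1 + K) * norm (v - u))" using nz \<epsilon>' by (intro mult_left_mono) auto
    also have "\<dots> = \<epsilon> * norm (v - u)" using K by (simp add: add_nonneg_eq_0_iff)
    finally show "y' \<bullet> f u + m \<bullet> (v - u) - \<epsilon> * norm (v - u) \<le> y' \<bullet> f v"
      by (simp add: inner_prod_def inner_diff_right)
  qed simp
qed

section \<open>Gradients of the integrand and of its integral\<close>

context weakly_convex
begin

text \<open>The inequalities for y at u and for F (u + e) at u + e are added. The values of h
  cancel, and the Lipschitz bound leaves (F u - y) \<bullet> e \<ge> - (K + L) |e|^2, which forces y
  = F u.\<close>

lemma prox_subdiff_unique:
  assumes u: "u \<in> ball a R" and R: "R \<le> r"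
    and F: "\<And>v. v \<in> ball a R \<Longrightarrow> F v \<in> prox_subdiff v"
    and K: "0 \<le> K" "\<And>v. v \<in> ball a R \<Longrightarrow> norm (F v - F u) \<le> K * norm (v - u)"
  shows "prox_subdiff u = {F u}"
proof
  show "{F u} \<subseteq> prox_subdiff u" using F[OF u] by simp
  show "prox_subdiff u \<subseteq> {F u}"
  proof
    fix y assume y: "y \<in> prox_subdiff u"
    obtain d where d: "0 < d" "ball u d \<subseteq> ball a R" using openE[OF open_ball u] by blast
    have cb: "v \<in> cball a r" if "v \<in> ball a R" for v using that R by simp
    have "F u - y = 0"
    proof (rule first_order_condition[OF d(1)])
      fix e :: 'a assume e: "norm e < d"
      have v: "u + e \<in> ball a R" using e by (intro subsetD[OF d(2)]) (simp add: dist_norm)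
      have "h u + y \<bullet> e - L / 2 * (norm e)\<^sup>2 \<le> h (u + e)"
        using y cb[OF v] by (auto simp: prox_subdiff_def dest!: bspec[of _ _ "u + e"])
      moreover have "h (u + e) - F (u + e) \<bullet> e - L / 2 * (norm e)\<^sup>2 \<le> h u"
        using F[OF v] cb[OF u] by (auto simp: prox_subdiff_def dest!: bspec[of _ _ u])
      moreover have "(F (u + e) - F u) \<bullet> e \<le> K * (norm e)\<^sup>2"
      proof -
        have "norm (F (u + e) - F u) * norm e \<le> K * norm e * norm e"
          using K(2)[OF v] by (intro mult_right_mono) auto
        then show ?thesis using norm_cauchy_schwarz[of "F (u + e) - F u" e] by (simp add: power2_eq_square)
      qed
      ultimately show "0 \<le> (F u - y) \<bullet> e + (K + L) * (norm e)\<^sup>2"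
        by (simp add: inner_diff_left algebra_simps)
    qed
    then show "y \<in> {F u}" by simp
  qed
qed

end

lemma (in weakly_convex_integrand) mono_L:
  assumes L': "\<And>t. t \<in> space M \<Longrightarrow> L t \<le> L' t" "integrable M L'"
  shows "weakly_convex_integrand M g a r L'"
proof
  show "\<bar>g t x - g t y\<bar> \<le> L' t * norm (x - y)" if "t \<in> space M" "x \<in> cball a r" "y \<in> cball a r" for t x y
    using g_lipschitz[OF that] mult_right_mono[OF L'(1)[OF that(1)], of "norm (x - y)"] by simp
  show "0 < L' t" if "t \<in> space M" for t using L_pos[OF that] L'(1)[OF that] by simp
  fix t u v and s :: real
  assume *: "t \<in> space M" "u \<in> cball a r" "v \<in> cball a r" "0 \<le> s" "s \<le> 1"
  have "L t / 2 * (s * (1 - s)) * (norm (u - v))\<^sup>2 \<le> L' t / 2 * (s * (1 - s)) * (norm (u - v))\<^sup>2"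
    using L'(1)[OF *(1)] * by (intro mult_right_mono) auto
  with g_weakly_convex[OF *]
  show "g t ((1 - s) *\<^sub>R u + s *\<^sub>R v) \<le> (1 - s) * g t u + s * g t v + L' t / 2 * (s * (1 - s)) * (norm (u - v))\<^sup>2"
    by simp
qed (use r g_measurable L'(2) g_integrable_center in auto)

text \<open>Off the null set N, \<open>f t\<close> is the gradient of g t near a. The value 0 on N
  makes the Lipschitz bound hold for every t, as the Leibniz rule for y' \<bullet> f
  demands.\<close>

locale smooth_integrand = weakly_convex_integrand M g a r L
  for M :: "'t measure" and g :: "'t \<Rightarrow> 'a::euclidean_space \<Rightarrow> real" and a r L +
  fixes N :: "'t set" and f :: "'t \<Rightarrow> 'a \<Rightarrow> 'a" and R :: real and w :: "'t \<Rightarrow> 'a"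
  assumes N: "N \<in> null_sets M" and R: "0 < R" "R \<le> r"
    and f_N: "\<And>t u. t \<in> N \<Longrightarrow> f t u = 0"
    and f_subd: "\<And>t u. t \<in> space M \<Longrightarrow> t \<notin> N \<Longrightarrow> u \<in> ball a R \<Longrightarrow> subd t u = {f t u}"
    and f_lipschitz: "\<And>t u v. t \<in> space M \<Longrightarrow> t \<notin> N \<Longrightarrow> u \<in> ball a R \<Longrightarrow> v \<in> ball a R \<Longrightarrow>
        norm (f t u - f t v) \<le> 10 * L t * norm (u - v)"
    and w: "integrable M w" "AE t in M. w t \<in> subd t a"
begin

lemma N_sets[measurable]: "N \<in> sets M"
  using N by auto

lemma f_lip: "t \<in> space M \<Longrightarrow> u \<in> ball a R \<Longrightarrow> v \<in> ball a R \<Longrightarrow> norm (f t u - f t v) \<le> 10 * L t * norm (u - v)"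
  using f_lipschitz[of t u v] f_N[of t] L_pos[of t] by (cases "t \<in> N") auto

lemma f_prox:
  assumes "t \<in> space M" "t \<notin> N" "u \<in> ball a R" "v \<in> cball a r"
  shows "g t u + f t u \<bullet> (v - u) - L t / 2 * (norm (v - u))\<^sup>2 \<le> g t v"
proof -
  have "f t u \<in> subd t u" using f_subd[OF assms(1-3)] by simp
  then show ?thesis
    unfolding weakly_convex.prox_subdiff_def[OF weakly_convex_at[OF assms(1)]] using assms(4) by blast
qed

text \<open>This makes f t u measurable in t, as a limit of measurable quotients. The subgradient
  inequalities at both end points enclose the quotient; 11 bounds 10 from the Lipschitz constant
  plus 1/2 from the modulus.\<close>

lemma difference_quotient:
  assumes t: "t \<in> space M" "t \<notin> N" and u: "u \<in> ball a R" "u + s *\<^sub>R b \<in> ball a R" and s: "0 < s" and b: "norm b = 1"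
  shows "\<bar>(g t (u + s *\<^sub>R b) - g t u) / s - f t u \<bullet> b\<bar> \<le> 11 * L t * s"
proof -
  let ?v = "u + s *\<^sub>R b"
  have c: "v \<in> cball a r" if "v \<in> ball a R" for v using that R by simp
  have eq: "s * ((g t ?v - g t u) / s - X) = (g t ?v - g t u) - s * X" for X
    by (subst right_diff_distrib) (use s in simp)
  have p1: "g t u + s * (f t u \<bullet> b) - s * (L t / 2 * s) \<le> g t ?v"
    using f_prox[OF t u(1) c[OF u(2)]] s b by (simp add: power2_eq_square mult_ac)
  have p2: "g t ?v - s * (f t ?v \<bullet> b) - s * (L t / 2 * s) \<le> g t u"
    using f_prox[OF t u(2) c[OF u(1)]] s b by (simp add: power2_eq_square mult_ac)
  have "s * (- (L t / 2 * s)) \<le> s * ((g t ?v - g t u) / s - f t u \<bullet> b)"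
    unfolding eq using p1 by simp
  then have 1: "(g t ?v - g t u) / s - f t u \<bullet> b \<ge> - (L t / 2 * s)" by (rule mult_left_le_imp_le[OF _ s])
  have "s * ((g t ?v - g t u) / s - f t u \<bullet> b) \<le> s * ((f t ?v - f t u) \<bullet> b + L t / 2 * s)"
    unfolding eq using p2 by (simp add: inner_diff_left right_diff_distrib distrib_left)
  then have 2: "(g t ?v - g t u) / s - f t u \<bullet> b \<le> (f t ?v - f t u) \<bullet> b + L t / 2 * s" by (rule mult_left_le_imp_le[OF _ s])
  have "(f t ?v - f t u) \<bullet> b \<le> norm (f t ?v - f t u)" using norm_cauchy_schwarz[of "f t ?v - f t u" b] b by simp
  also have "\<dots> \<le> 10 * L t * s" using f_lip[OF t(1) u(2,1)] s b by simp
  finally have 3: "(f t ?v - f t u) \<bullet> b \<le> 10 * L t * s" .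
  have "0 < L t * s" using L_pos[OF t(1)] s by simp
  with 1 2 3 show ?thesis by (simp add: abs_le_iff)
qed

lemma f_measurable:
  assumes u: "u \<in> ball a R" shows "(\<lambda>t. f t u) \<in> borel_measurable M"
proof (subst borel_measurable_euclidean_space, rule ballI)
  fix b :: 'a assume b: "b \<in> Basis"
  obtain d where d: "0 < d" "ball u d \<subseteq> ball a R" using openE[OF open_ball u] by blast
  define s where "s n = d / 2 * inverse (real (Suc n))" for n
  have s: "0 < s n" "s n < d" for n
  proof -
    show "0 < s n" using d(1) by (simp add: s_def)
    have "s n \<le> d / 2 * 1" unfolding s_def
      using d(1) by (intro mult_left_mono) (simp_all add: inverse_le_1_iff)
    then show "s n < d" using d(1) by simp
  qed
  have ub: "u + s n *\<^sub>R b \<in> ball a R" for n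
    using s[of n] b by (intro subsetD[OF d(2)]) (simp add: dist_norm)
  have s0: "s \<longlonglongrightarrow> 0"
  proof -
    have "(\<lambda>n. d / 2 * inverse (real (Suc n))) \<longlonglongrightarrow> d / 2 * 0" by (intro tendsto_intros LIMSEQ_inverse_real_of_nat)
    then show ?thesis by (simp only: s_def[abs_def] mult_zero_right)
  qed
  have c: "v \<in> cball a r" if "v \<in> ball a R" for v using that R by simp
  show "(\<lambda>t. f t u \<bullet> b) \<in> borel_measurable M"
  proof (rule borel_measurable_LIMSEQ_metric)
    show "(\<lambda>t. if t \<in> N then 0 else (g t (u + s n *\<^sub>R b) - g t u) / s n) \<in> borel_measurable M" for n
      using g_measurable[OF c[OF u]] g_measurable[OF c[OF ub]] by measurable
    fix t assume t: "t \<in> space M"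
    show "(\<lambda>n. if t \<in> N then 0 else (g t (u + s n *\<^sub>R b) - g t u) / s n) \<longlonglongrightarrow> f t u \<bullet> b"
    proof (cases "t \<in> N")
      case False
      have "(\<lambda>n. (g t (u + s n *\<^sub>R b) - g t u) / s n - f t u \<bullet> b) \<longlonglongrightarrow> 0"
      proof (rule Lim_null_comparison)
        show "\<forall>\<^sub>F n in sequentially. norm ((g t (u + s n *\<^sub>R b) - g t u) / s n - f t u \<bullet> b) \<le> 11 * L t * s n"
          using difference_quotient[OF t False u ub s(1)] b by (intro always_eventually allI) simp
        show "(\<lambda>n. 11 * L t * s n) \<longlonglongrightarrow> 0" by (rule tendsto_mult_right_zero[OF s0])
      qed
      then show ?thesis using False by (simp add: LIM_zero_cancel)
    qed (simp add: f_N)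
  qed
qed

lemma w_eq: "AE t in M. w t = f t a"
  using w(2) AE_not_in[OF N] AE_space
proof eventually_elim
  case (elim t)
  then show ?case using f_subd[of t a] R(1) by simp
qed

lemma f_integrable:
  assumes u: "u \<in> ball a R" shows "integrable M (\<lambda>t. f t u)"
proof (rule Bochner_Integration.integrable_bound)
  show "integrable M (\<lambda>t. norm (w t) + 10 * L t * norm (u - a))" using w(1) L_int by auto
  show "AE t in M. norm (f t u) \<le> norm (norm (w t) + 10 * L t * norm (u - a))"
    using w_eq AE_space
  proof eventually_elim
    case (elim t)
    have "norm (f t u - f t a) \<le> 10 * L t * norm (u - a)" using f_lip[OF elim(2) u, of a] R(1) by simp
    then show ?case using norm_triangle_ineq2[of "f t u" "f t a"] elim(1) by simp
  qed
qed (rule f_measurable[OF u])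

definition F :: "'a \<Rightarrow> 'a" where "F u = (\<integral>t. f t u \<partial>M)"

lemma F_lipschitz:
  assumes u: "u \<in> ball a R" and v: "v \<in> ball a R"
  shows "norm (F u - F v) \<le> 10 * integral\<^sup>L M L * norm (u - v)"
proof -
  have "norm (F u - F v) = norm (\<integral>t. f t u - f t v \<partial>M)"
    unfolding F_def using f_integrable[OF u] f_integrable[OF v] by simp
  also have "\<dots> \<le> (\<integral>t. norm (f t u - f t v) \<partial>M)" by (rule integral_norm_bound)
  also have "\<dots> \<le> (\<integral>t. 10 * L t * norm (u - v) \<partial>M)"
    by (rule integral_mono) (use f_integrable[OF u] f_integrable[OF v] L_int f_lip[OF _ u v] in auto)
  finally show ?thesis by simp
qed

text \<open>Integrating the subgradient inequalities of f t shows that F is a selection of the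
  subdifferential of G; a Lipschitz selection leaves room for no other subgradient.\<close>

lemma F_subdiff:
  assumes u: "u \<in> ball a R"
  shows "weakly_convex.prox_subdiff G a r (integral\<^sup>L M L + 1) u = {F u}"
proof -
  interpret G: weakly_convex G a r "integral\<^sup>L M L + 1" by (rule weakly_convex_G)
  show ?thesis
  proof (rule G.prox_subdiff_unique[OF u R(2)])
    show "0 \<le> 10 * integral\<^sup>L M L" using integral_L_nonneg by simp
    show "norm (F v - F u) \<le> 10 * integral\<^sup>L M L * norm (v - u)" if "v \<in> ball a R" for v
      by (rule F_lipschitz[OF that u])
    fix u assume u: "u \<in> ball a R"
    then have uc: "u \<in> cball a r" using R by simp
    show "F u \<in> G.prox_subdiff u"
      unfolding G.prox_subdiff_def
    proof (rule CollectI, rule ballI)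
      fix v assume v: "v \<in> cball a r"
      define c where "c = (norm (v - u))\<^sup>2 / 2"
      have "(\<integral>t. g t u + f t u \<bullet> (v - u) - L t * c \<partial>M) \<le> G v"
        unfolding G_def
      proof (rule integral_mono_AE)
        show "AE t in M. g t u + f t u \<bullet> (v - u) - L t * c \<le> g t v"
          using AE_not_in[OF N] AE_space
          by eventually_elim (use f_prox[OF _ _ u v] in \<open>simp add: c_def\<close>)
      qed (use g_integrable[OF uc] g_integrable[OF v] f_integrable[OF u] L_int in auto)
      also have "(\<integral>t. g t u + f t u \<bullet> (v - u) - L t * c \<partial>M) = G u + F u \<bullet> (v - u) - integral\<^sup>L M L * c"
        unfolding G_def F_def using g_integrable[OF uc] f_integrable[OF u] L_int by simp
      finally have "G u + F u \<bullet> (v - u) - integral\<^sup>L M L * c \<le> G v" .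
      moreover have "integral\<^sup>L M L * c \<le> (integral\<^sup>L M L + 1) * c" by (intro mult_right_mono) (auto simp: c_def)
      ultimately show "G u + F u \<bullet> (v - u) - (integral\<^sup>L M L + 1) / 2 * (norm (v - u))\<^sup>2 \<le> G v"
        by (simp add: c_def)
    qed
  qed
qed

text \<open>Near a the graph of the subdifferential of E is the graph of the Lipschitz map F, so z
  becomes a limiting subgradient of y' \<bullet> F. This scalar function is the integral of the
  Lipschitz integrand y' \<bullet> f t, to which the first-order rule applies; the resulting
  subgradients are turned back into normals to the graphs at each t.\<close>

theorem coderivative_Leibniz:
  assumes \<phi>: "AE t in M. \<forall>x\<in>cball a r. \<phi> t x = ereal (g t x)"
    and E: "\<And>x. x \<in> cball a r \<Longrightarrow> E x = ereal (G x)"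
    and z: "z \<in> second_subdifferential E a y0 y'"
  shows "z \<in> aumann_integral M (\<lambda>t. second_subdifferential (\<phi> t) a (w t) y')"
proof -
  interpret G: weakly_convex G a r "integral\<^sup>L M L + 1" by (rule weakly_convex_G)
  have Rr: "u \<in> ball a r" "u \<in> cball a r" if "u \<in> ball a R" for u using that R by auto
  have E_sub: "subdifferential E u = {F u}" if "u \<in> ball a R" for u
    using G.subdifferential_eq_prox[OF E Rr(1)[OF that]] F_subdiff[OF that] by simp
  have "(z, - y') \<in> limiting_normal_cone (a, y0) (gph (subdifferential E))"
    using z by (simp add: second_subdifferential_def coderivative_def)
  then obtain p n where pn: "p \<longlonglongrightarrow> (a, y0)" "n \<longlonglongrightarrow> (z, - y')"
    "\<And>k. n k \<in> regular_normal_cone (p k) (gph (subdifferential E))"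
    unfolding limiting_normal_cone_def by blast
  have px: "(\<lambda>k. fst (p k)) \<longlonglongrightarrow> a" using tendsto_fst[OF pn(1)] by simp
  have nz: "(\<lambda>k. fst (n k)) \<longlonglongrightarrow> z" using tendsto_fst[OF pn(2)] by simp
  have ny: "(\<lambda>k. - snd (n k)) \<longlonglongrightarrow> y'" using tendsto_minus[OF tendsto_snd[OF pn(2)]] by simp
  \<comment> \<open>The summand 1 keeps the modulus positive when y' = 0.\<close>
  interpret s: lipschitz_integrand M "\<lambda>t x. y' \<bullet> f t x" a "R / 2" "\<lambda>t. (norm y' + 1) * (10 * L t)"
  proof
    have c: "x \<in> ball a R" if "x \<in> cball a (R / 2)" for x using that R(1) by simp
    show "(\<lambda>t. y' \<bullet> f t x) \<in> borel_measurable M" if "x \<in> cball a (R / 2)" for x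
      using f_measurable[OF c[OF that]] by measurable
    show "\<bar>y' \<bullet> f t x - y' \<bullet> f t y\<bar> \<le> (norm y' + 1) * (10 * L t) * norm (x - y)"
      if t: "t \<in> space M" and xy: "x \<in> cball a (R / 2)" "y \<in> cball a (R / 2)" for t x y
    proof -
      have "\<bar>y' \<bullet> f t x - y' \<bullet> f t y\<bar> \<le> norm y' * norm (f t x - f t y)"
        using Cauchy_Schwarz_ineq2[of y' "f t x - f t y"] by (simp add: inner_diff_right)
      also have "\<dots> \<le> (norm y' + 1) * (10 * L t * norm (x - y))"
        using f_lip[OF t c[OF xy(1)] c[OF xy(2)]] by (intro mult_mono) auto
      finally show ?thesis by (simp only: mult.assoc)
    qed
    show "0 < (norm y' + 1) * (10 * L t)" if "t \<in> space M" for t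
      using L_pos[OF that] by (intro mult_pos_pos) (auto simp: add_nonneg_pos)
    show "integrable M (\<lambda>t. y' \<bullet> f t a)" using f_integrable[of a] R(1) by simp
  qed (use R(1) L_int in auto)
  have sG: "s.G x = y' \<bullet> F x" if "x \<in> ball a R" for x
    unfolding s.G_def F_def using f_integrable[OF that] by simp
  define K where "K = 10 * integral\<^sup>L M L"
  have K: "0 \<le> K" using integral_L_nonneg by (simp add: K_def)
  have "\<exists>b z' \<delta>. 0 < \<delta> \<and> norm (b - a) < \<epsilon> \<and> norm (z' - z) < \<epsilon> \<and>
      (\<forall>x. norm (x - b) \<le> \<delta> \<longrightarrow> s.G b + z' \<bullet> (x - b) - \<epsilon> * norm (x - b) \<le> s.G x)" if \<epsilon>: "0 < \<epsilon>" for \<epsilon>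
  proof -
    have "\<forall>\<^sub>F k in sequentially. dist (fst (p k)) a < min \<epsilon> (R / 2)"
      by (rule tendstoD[OF px]) (use \<epsilon> R(1) in simp)
    moreover have "\<forall>\<^sub>F k in sequentially. dist (fst (n k)) z < \<epsilon>" by (rule tendstoD[OF nz \<epsilon>])
    moreover have "\<forall>\<^sub>F k in sequentially. dist (- snd (n k)) y' < \<epsilon> / (2 * (K + 1))"
      by (rule tendstoD[OF ny]) (use \<epsilon> K in simp)
    ultimately have "\<forall>\<^sub>F k in sequentially. dist (fst (p k)) a < min \<epsilon> (R / 2) \<and> dist (fst (n k)) z < \<epsilon> \<and>
        dist (- snd (n k)) y' < \<epsilon> / (2 * (K + 1))" by eventually_elim blast
    then obtain k where k: "norm (fst (p k) - a) < min \<epsilon> (R / 2)" "norm (fst (n k) - z) < \<epsilon>"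
        "norm (- snd (n k) - y') < \<epsilon> / (2 * (K + 1))"
      by (auto simp: eventually_sequentially dist_norm)
    define b z' y'' where "b = fst (p k)" and "z' = fst (n k)" and "y'' = - snd (n k)"
    have near: "v \<in> ball a R" if "norm (v - b) < R / 2" for v
      using that k(1) norm_triangle_ineq[of "v - b" "b - a"] by (simp add: b_def dist_norm norm_minus_commute[of a])
    have bR: "b \<in> ball a R" using near[of b] R(1) by simp
    have nk: "(z', - y'') \<in> regular_normal_cone (b, snd (p k)) (gph (subdifferential E))"
      using pn(3)[of k] by (simp add: b_def z'_def y''_def)
    obtain \<delta> where \<delta>: "0 < \<delta>" "\<delta> \<le> R / 2"
      "\<And>v. norm (v - b) < \<delta> \<Longrightarrow> y'' \<bullet> F b + z' \<bullet> (v - b) - \<epsilon> / 2 * norm (v - b) \<le> y'' \<bullet> F v"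
    proof (rule graph_regular_normalD[OF nk, of "R / 2" F K "\<epsilon> / 2"])
      show "norm (F v - F b) \<le> K * norm (v - b)" if "norm (v - b) < R / 2" for v
        unfolding K_def by (rule F_lipschitz[OF near[OF that] bR])
    qed (use R(1) E_sub near K \<epsilon> in auto)
    have "s.G b + z' \<bullet> (x - b) - \<epsilon> * norm (x - b) \<le> s.G x" if x: "norm (x - b) \<le> \<delta> / 2" for x
    proof -
      have x': "norm (x - b) < \<delta>" using x \<delta>(1) by simp
      have xR: "x \<in> ball a R" by (rule near) (use x' \<delta>(2) in simp)
      \<comment> \<open>The approximating normals carry a direction y'' close to y' but not equal to
        it. The Lipschitz bound for F turns the discrepancy into an error of at most \<epsilon> / 2
        times the distance.\<close>
      have "(y'' - y') \<bullet> (F x - F b) \<le> norm (y'' - y') * norm (F x - F b)" by (rule norm_cauchy_schwarz)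
      also have "\<dots> \<le> \<epsilon> / (2 * (K + 1)) * ((K + 1) * norm (x - b))"
      proof (rule mult_mono)
        show "norm (y'' - y') \<le> \<epsilon> / (2 * (K + 1))" using k(3) by (simp add: y''_def)
        have "K * norm (x - b) \<le> (K + 1) * norm (x - b)" by (intro mult_right_mono) auto
        then show "norm (F x - F b) \<le> (K + 1) * norm (x - b)" using F_lipschitz[OF xR bR] by (simp add: K_def)
        show "0 \<le> \<epsilon> / (2 * (K + 1))" using \<epsilon> K by simp
      qed simp
      also have "\<dots> = \<epsilon> / 2 * norm (x - b)" using K by (simp add: field_simps)
      finally show ?thesis
        using \<delta>(3)[OF x'] by (simp add: sG[OF bR] sG[OF xR] inner_diff_left inner_diff_right)
    qed
    then show ?thesis
      using \<delta>(1) k(1,2) by (intro exI[of _ b] exI[of _ z'] exI[of _ "\<delta> / 2"]) (simp add: b_def z'_def)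
  qed
  from s.Leibniz_rule[OF this] obtain \<zeta> where \<zeta>: "integrable M \<zeta>" "integral\<^sup>L M \<zeta> = z"
    "AE t in M. \<forall>e>0. \<exists>u m C d. norm (u - a) < e \<and> norm (m - \<zeta> t) < e \<and> 0 < d \<and>
       (\<forall>y. norm (y - u) < d \<longrightarrow> y' \<bullet> f t u + m \<bullet> (y - u) - C * (norm (y - u))\<^sup>2 \<le> y' \<bullet> f t y)" by blast
  have "AE t in M. \<zeta> t \<in> second_subdifferential (\<phi> t) a (w t) y'"
    using \<zeta>(3) \<phi> w_eq AE_not_in[OF N] AE_space
  proof eventually_elim
    case (elim t)
    interpret t: weakly_convex "g t" a r "L t" by (rule weakly_convex_at[OF elim(5)])
    have sub: "subdifferential (\<phi> t) u = {f t u}" if "u \<in> ball a R" for u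
      using subdifferential_eq_subd[OF elim(5,2) Rr(1)[OF that]] f_subd[OF elim(5,4) that] by simp
    have "\<exists>u m. norm (u - a) < e \<and> u \<in> ball a R \<and> norm (m - \<zeta> t) < e \<and>
        (m, - y') \<in> regular_normal_cone (u, f t u) (gph (subdifferential (\<phi> t)))" if e: "0 < e" for e
    proof -
      obtain u m C d where u: "norm (u - a) < min e R" "norm (m - \<zeta> t) < min e R" "0 < d"
        and le: "\<And>y. norm (y - u) < d \<Longrightarrow> y' \<bullet> f t u + m \<bullet> (y - u) - C * (norm (y - u))\<^sup>2 \<le> y' \<bullet> f t y"
        using elim(1)[rule_format, of "min e R"] e R(1) by auto
      have uR: "u \<in> ball a R" using u(1) by (simp add: dist_norm norm_minus_commute)
      obtain d' where d': "0 < d'" "ball u d' \<subseteq> ball a R" using openE[OF open_ball uR] by blast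
      have "(m, - y') \<in> regular_normal_cone (u, f t u) (gph (subdifferential (\<phi> t)))"
      proof (rule graph_regular_normalI[of "min d d'"])
        show "subdifferential (\<phi> t) v = {f t v}" if "norm (v - u) < min d d'" for v
          by (rule sub, rule subsetD[OF d'(2)]) (use that in \<open>simp add: dist_norm norm_minus_commute\<close>)
      qed (use u(3) d'(1) le in auto)
      with u uR show ?thesis by auto
    qed
    then have "\<exists>u m. norm (u - a) < 1 / Suc k \<and> u \<in> ball a R \<and> norm (m - \<zeta> t) < 1 / Suc k \<and>
        (m, - y') \<in> regular_normal_cone (u, f t u) (gph (subdifferential (\<phi> t)))" for k :: nat
      by (simp add: zero_less_divide_iff)
    then obtain u m where um: "\<And>k. norm (u k - a) < 1 / Suc k" "\<And>k. u k \<in> ball a R"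
      "\<And>k. norm (m k - \<zeta> t) < 1 / Suc k"
      "\<And>k. (m k, - y') \<in> regular_normal_cone (u k, f t (u k)) (gph (subdifferential (\<phi> t)))" by metis
    have ua: "u \<longlonglongrightarrow> a"
      by (rule LIM_zero_cancel, rule Lim_null_comparison[OF _ inverse_Suc_tendsto_zero])
        (use um(1) in \<open>auto intro!: always_eventually less_imp_le\<close>)
    have m\<zeta>: "m \<longlonglongrightarrow> \<zeta> t"
      by (rule LIM_zero_cancel, rule Lim_null_comparison[OF _ inverse_Suc_tendsto_zero])
        (use um(3) in \<open>auto intro!: always_eventually less_imp_le\<close>)
    have fu: "(\<lambda>k. f t (u k)) \<longlonglongrightarrow> f t a"
    proof (rule LIM_zero_cancel, rule Lim_null_comparison)
      show "\<forall>\<^sub>F k in sequentially. norm (f t (u k) - f t a) \<le> 10 * L t * norm (u k - a)"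
        by (intro always_eventually allI f_lip[OF elim(5) um(2)]) (use R(1) in simp)
      show "(\<lambda>k. 10 * L t * norm (u k - a)) \<longlonglongrightarrow> 0"
        by (intro tendsto_mult_right_zero tendsto_norm_zero LIM_zero ua)
    qed
    have "(\<zeta> t, - y') \<in> limiting_normal_cone (a, f t a) (gph (subdifferential (\<phi> t)))"
      unfolding limiting_normal_cone_def
      by (intro CollectI exI[of _ "\<lambda>k. (u k, f t (u k))"] exI[of _ "\<lambda>k. (m k, - y')"] conjI allI um(4)
          tendsto_Pair ua fu m\<zeta> tendsto_const)
    then show ?case by (simp add: second_subdifferential_def coderivative_def elim(3))
  qed
  with \<zeta>(1,2) show ?thesis unfolding aumann_integral_def by blast
qed

end

theorem (in weakly_convex_integrand) second_order_Leibniz: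
  assumes \<phi>: "AE t in M. \<forall>x\<in>cball a r. \<phi> t x = ereal (g t x)"
    and E: "\<And>x. x \<in> cball a r \<Longrightarrow> E x = ereal (G x)"
    and y0: "y0 \<in> subdifferential E a"
    and quasi: "\<And>v. v \<in> selections M \<phi> a y0 \<Longrightarrow> second_order_quasi_Lipschitzian M \<phi> a v"
  shows "second_subdifferential E a y0 y'
     \<subseteq> (\<Union>v\<in>selections M \<phi> a y0. aumann_integral M (\<lambda>t. second_subdifferential (\<phi> t) a (v t) y'))"
proof -
  interpret G: weakly_convex G a r "integral\<^sup>L M L + 1" by (rule weakly_convex_G)
  have ar: "a \<in> ball a r" using r by simp
  have "y0 \<in> G.prox_subdiff a" using y0 G.subdifferential_eq_prox[OF E ar] by simp
  then obtain w where w: "integrable M w" "integral\<^sup>L M w = y0" "AE t in M. w t \<in> subd t a"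
    by (rule subgradient_selection)
  have w_sub: "AE t in M. w t \<in> subdifferential (\<phi> t) a"
    using w(3) \<phi> AE_space
  proof eventually_elim
    case (elim t)
    then show ?case using subdifferential_eq_subd[OF elim(3,2) ar] by simp
  qed
  have sel: "w \<in> selections M \<phi> a y0" using w w_sub by (simp add: selections_def)
  obtain \<eta> l where \<eta>: "0 < \<eta>" and l: "integrable M l" "\<And>t. t \<in> space M \<Longrightarrow> 0 < l t"
    and Q: "\<And>x y y'. in_Linf M x \<Longrightarrow> Linf_norm M (\<lambda>t. x t - a) \<le> ereal \<eta> \<Longrightarrow>
           integrable M y \<Longrightarrow> L1_norm M (\<lambda>t. y t - w t) \<le> \<eta> \<Longrightarrow>
           (AE t in M. y t \<in> subdifferential (\<phi> t) (x t)) \<Longrightarrow> in_Linf M y' \<Longrightarrow>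
           (AE t in M. (SUP x'\<in>second_subdifferential (\<phi> t) (x t) (y t) (y' t). ereal (norm x'))
                         \<le> ereal (l t * norm (y' t)))"
    using quasi[OF sel] unfolding second_order_quasi_Lipschitzian_def by blast
  \<comment> \<open>The common modulus must dominate both L and the quasi-Lipschitzian modulus l,
    and it must be at least 1 so that the test direction in \<open>covering_at\<close> is
    bounded.\<close>
  define L' where "L' t = L t + l t + 1" for t
  have L': "integrable M L'" unfolding L'_def using L_int l(1) by auto
  have LL': "L t \<le> L' t" "1 \<le> L' t" "l t \<le> L' t" if "t \<in> space M" for t
    using L_pos[OF that] l(2)[OF that] by (auto simp: L'_def)
  interpret q: weakly_convex_integrand M g a r L' by (rule mono_L[OF LL'(1) L'])
  \<comment> \<open>\<open>subd\<close> is defined with the modulus, so membership has to be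
    restated for L'; the passage goes through \<open>subdifferential\<close>, which does not depend
    on it.\<close>
  have w_q: "AE t in M. w t \<in> q.subd t a"
    using w_sub \<phi> AE_space
  proof eventually_elim
    case (elim t)
    then show ?case using q.subdifferential_eq_subd[OF elim(3,2) ar] by simp
  qed
  \<comment> \<open>The last three terms provide the margins 10 \<rho> < r, 10 \<rho> \<le> \<eta>
    for the sup norm, and 30 \<rho> \<integral> L' \<le> \<eta> for the L1 norm; the added 1 avoids
    division by zero.\<close>
  define \<rho> where "\<rho> = min (1 / 8) (min (r / 20) (min (\<eta> / 10) (\<eta> / (30 * (integral\<^sup>L M L' + 1)))))"
  have \<rho>: "0 < \<rho>" "\<rho> \<le> 1 / 8" "\<rho> \<le> r / 20" "\<rho> \<le> \<eta> / 10" "\<rho> \<le> \<eta> / (30 * (integral\<^sup>L M L' + 1))"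
  proof -
    show "0 < \<rho>" unfolding \<rho>_def using r \<eta> q.integral_L_nonneg by simp
  qed (simp_all only: \<rho>_def min.cobounded1 min.cobounded2 min.coboundedI2)
  have \<rho>': "10 * \<rho> < r" "10 * \<rho> \<le> \<eta>" using \<rho> r by auto
  have "30 * \<rho> * integral\<^sup>L M L' \<le> 30 * \<rho> * (integral\<^sup>L M L' + 1)" using \<rho>(1) by simp
  also have "\<dots> \<le> \<eta>" using \<rho>(5) q.integral_L_nonneg by (simp add: pos_le_divide_eq mult_ac)
  finally have \<rho>'': "30 * \<rho> * integral\<^sup>L M L' \<le> \<eta>" .
  from q.subdifferential_single_valued[OF LL'(2,3) \<phi> w(1) w_q Q \<rho>(1,2) \<rho>' \<rho>'']
  have "AE t in M. \<exists>F. (\<forall>u\<in>ball a (\<rho> / 8). q.subd t u = {F u}) \<and>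
      (\<forall>u\<in>ball a (\<rho> / 8). \<forall>v\<in>ball a (\<rho> / 8). norm (F u - F v) \<le> 10 * L' t * norm (u - v))" .
  then obtain N where N: "N \<in> null_sets M"
    and ex: "\<And>t. t \<in> space M - N \<Longrightarrow> \<exists>F. (\<forall>u\<in>ball a (\<rho> / 8). q.subd t u = {F u}) \<and>
      (\<forall>u\<in>ball a (\<rho> / 8). \<forall>v\<in>ball a (\<rho> / 8). norm (F u - F v) \<le> 10 * L' t * norm (u - v))"
    by (rule AE_E3) (rule that)
  from ex obtain F where F: "\<And>t u. t \<in> space M - N \<Longrightarrow> u \<in> ball a (\<rho> / 8) \<Longrightarrow> q.subd t u = {F t u}"
    "\<And>t u v. t \<in> space M - N \<Longrightarrow> u \<in> ball a (\<rho> / 8) \<Longrightarrow> v \<in> ball a (\<rho> / 8) \<Longrightarrow>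
        norm (F t u - F t v) \<le> 10 * L' t * norm (u - v)"
    by metis
  interpret s: smooth_integrand M g a r L' N "\<lambda>t u. if t \<in> N then 0 else F t u" "\<rho> / 8" w
    by unfold_locales (use N \<rho> r F w(1) w_q in auto)
  show ?thesis
    using s.coderivative_Leibniz[OF \<phi> E] sel by blast
qed

section \<open>Maxima of functions with Lipschitz gradients\<close>

lemma has_gradient_unique:
  assumes "has_gradient f x g" "has_gradient f x g'"
  shows "g = g'"
proof -
  have "(\<lambda>h. h \<bullet> g) = (\<lambda>h. h \<bullet> g')"
    using assms has_derivative_unique unfolding has_gradient_def gderiv_def by blast
  then have "(g - g') \<bullet> g = (g - g') \<bullet> g'" by meson
  then have "(g - g') \<bullet> (g - g') = 0" by (simp only: inner_diff_right diff_self)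
  then show ?thesis by simp
qed

lemma has_gradient_finite: "has_gradient f x g \<Longrightarrow> \<bar>f x\<bar> \<noteq> \<infinity>"
  unfolding has_gradient_def by (elim conjE) (drule eventually_nhds_x_imp_x, simp)

text \<open>Along the segment, \<theta> is the function minus its linearization plus the quadratic
  correction. The Lipschitz bound on the gradient makes its derivative nonnegative.\<close>

lemma Lipschitz_gradient_lower_bound:
  fixes f :: "'a::euclidean_space \<Rightarrow> ereal"
  assumes S: "convex S" "u \<in> S" "v \<in> S"
    and grad: "\<And>x. x \<in> S \<Longrightarrow> has_gradient f x (\<gamma> x)"
    and lip: "\<And>x y. x \<in> S \<Longrightarrow> y \<in> S \<Longrightarrow> norm (\<gamma> x - \<gamma> y) \<le> l * norm (x - y)"
  shows "real_of_ereal (f u) + \<gamma> u \<bullet> (v - u) - l / 2 * (norm (v - u))\<^sup>2 \<le> real_of_ereal (f v)"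
proof -
  let ?d = "v - u"
  define \<theta> where "\<theta> s = real_of_ereal (f (u + s *\<^sub>R ?d)) - s * (\<gamma> u \<bullet> ?d) + l / 2 * s\<^sup>2 * (norm ?d)\<^sup>2" for s
  have "\<theta> 0 \<le> \<theta> 1"
  proof (rule DERIV_nonneg_imp_nondecreasing[of 0 1 \<theta>])
    fix s :: real assume s: "0 \<le> s" "s \<le> 1"
    let ?w = "u + s *\<^sub>R ?d"
    have "(1 - s) *\<^sub>R u + s *\<^sub>R v \<in> S" using S s unfolding convex_alt by blast
    then have w: "?w \<in> S" by (simp add: algebra_simps)
    have "((\<lambda>x. real_of_ereal (f x)) has_derivative (\<lambda>h. h \<bullet> \<gamma> ?w)) (at ?w)"
      using grad[OF w] by (simp add: has_gradient_def gderiv_def)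
    moreover have "((\<lambda>s. u + s *\<^sub>R ?d) has_derivative (\<lambda>h. h *\<^sub>R ?d)) (at s)"
      by (auto intro!: derivative_eq_intros)
    ultimately have "((\<lambda>s. real_of_ereal (f (u + s *\<^sub>R ?d))) has_derivative (\<lambda>h. (h *\<^sub>R ?d) \<bullet> \<gamma> ?w)) (at s)"
      by (rule has_derivative_compose[rotated])
    then have 1: "((\<lambda>s. real_of_ereal (f (u + s *\<^sub>R ?d))) has_real_derivative (?d \<bullet> \<gamma> ?w)) (at s)"
      by (simp add: has_field_derivative_def mult_commute_abs)
    have "(\<theta> has_real_derivative (?d \<bullet> \<gamma> ?w - \<gamma> u \<bullet> ?d + l * s * (norm ?d)\<^sup>2)) (at s)"
      unfolding \<theta>_def by (auto intro!: derivative_eq_intros 1)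
    moreover have "0 \<le> ?d \<bullet> \<gamma> ?w - \<gamma> u \<bullet> ?d + l * s * (norm ?d)\<^sup>2"
    proof -
      have "norm (\<gamma> ?w - \<gamma> u) \<le> l * (s * norm ?d)" using lip[OF w S(2)] s by simp
      then have "norm (\<gamma> ?w - \<gamma> u) * norm ?d \<le> l * (s * norm ?d) * norm ?d" by (rule mult_right_mono) simp
      moreover have "- (norm (\<gamma> ?w - \<gamma> u) * norm ?d) \<le> (\<gamma> ?w - \<gamma> u) \<bullet> ?d"
        using Cauchy_Schwarz_ineq2[of "\<gamma> ?w - \<gamma> u" ?d] by linarith
      moreover have "?d \<bullet> \<gamma> ?w - \<gamma> u \<bullet> ?d = (\<gamma> ?w - \<gamma> u) \<bullet> ?d"
        by (subst inner_diff_left) (simp only: inner_commute)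
      moreover have "l * s * (norm ?d)\<^sup>2 = l * (s * norm ?d) * norm ?d" by (simp only: power2_eq_square mult.assoc)
      ultimately show ?thesis by linarith
    qed
    ultimately show "\<exists>y. DERIV \<theta> s :> y \<and> 0 \<le> y" by blast
  qed simp
  then show ?thesis by (simp add: \<theta>_def)
qed

lemma Max_lipschitz:
  fixes p :: "'i \<Rightarrow> 'a \<Rightarrow> real"
  assumes I: "finite I" "I \<noteq> {}" and le: "\<And>i. i \<in> I \<Longrightarrow> \<bar>p i x - p i y\<bar> \<le> c"
  shows "\<bar>Max ((\<lambda>i. p i x) ` I) - Max ((\<lambda>i. p i y) ` I)\<bar> \<le> c"
proof -
  have 1: "Max ((\<lambda>i. p i x) ` I) \<le> Max ((\<lambda>i. p i y) ` I) + c"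
    if "\<And>i. i \<in> I \<Longrightarrow> p i x \<le> p i y + c" for x y
  proof (subst Max_le_iff)
    show "\<forall>a\<in>(\<lambda>i. p i x) ` I. a \<le> Max ((\<lambda>i. p i y) ` I) + c"
    proof safe
      fix i assume i: "i \<in> I"
      have "p i y \<le> Max ((\<lambda>i. p i y) ` I)" using I i by (intro Max_ge) auto
      then show "p i x \<le> Max ((\<lambda>i. p i y) ` I) + c" using that[OF i] by simp
    qed
  qed (use I in auto)
  have "p i x \<le> p i y + c" "p i y \<le> p i x + c" if "i \<in> I" for i using le[OF that] by (auto simp: abs_le_iff)
  from 1[of x y, OF this(1)] 1[of y x, OF this(2)] show ?thesis by (simp add: abs_le_iff)
qed

text \<open>An index active at the intermediate point supplies a quadratic minorant there that lies
  below the maximum at u and at v. In the convex combination the gradient terms cancel.\<close>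

lemma Max_weakly_convex:
  fixes p :: "'i \<Rightarrow> 'a::euclidean_space \<Rightarrow> real"
  assumes I: "finite I" "I \<noteq> {}" and S: "convex S" "u \<in> S" "v \<in> S" and s: "0 \<le> s" "s \<le> 1"
    and low: "\<And>i x y. i \<in> I \<Longrightarrow> x \<in> S \<Longrightarrow> y \<in> S \<Longrightarrow> p i x + \<gamma> i x \<bullet> (y - x) - l / 2 * (norm (y - x))\<^sup>2 \<le> p i y"
  defines "h \<equiv> \<lambda>x. Max ((\<lambda>i. p i x) ` I)"
  shows "h ((1 - s) *\<^sub>R u + s *\<^sub>R v) \<le> (1 - s) * h u + s * h v + l / 2 * (s * (1 - s)) * (norm (u - v))\<^sup>2"
proof -
  let ?w = "(1 - s) *\<^sub>R u + s *\<^sub>R v"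
  have w: "?w \<in> S" using S s unfolding convex_alt by blast
  have "h ?w \<in> (\<lambda>i. p i ?w) ` I" unfolding h_def using I by (intro Max_in) auto
  then obtain i where i: "i \<in> I" "h ?w = p i ?w" by blast
  let ?e = "u - v"
  have uw: "u - ?w = s *\<^sub>R ?e" and vw: "v - ?w = - ((1 - s) *\<^sub>R ?e)" by (simp_all add: algebra_simps)
  have "p i ?w + \<gamma> i ?w \<bullet> (u - ?w) - l / 2 * (norm (u - ?w))\<^sup>2 \<le> p i u" by (rule low[OF i(1) w S(2)])
  also have "p i u \<le> h u" unfolding h_def using I i by (intro Max_ge) auto
  finally have 1: "p i ?w + s * (\<gamma> i ?w \<bullet> ?e) - l / 2 * (s\<^sup>2 * (norm ?e)\<^sup>2) \<le> h u"
    unfolding uw by (simp add: power_mult_distrib)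
  have "p i ?w + \<gamma> i ?w \<bullet> (v - ?w) - l / 2 * (norm (v - ?w))\<^sup>2 \<le> p i v" by (rule low[OF i(1) w S(3)])
  also have "p i v \<le> h v" unfolding h_def using I i by (intro Max_ge) auto
  finally have 2: "p i ?w - (1 - s) * (\<gamma> i ?w \<bullet> ?e) - l / 2 * ((1 - s)\<^sup>2 * (norm ?e)\<^sup>2) \<le> h v"
    unfolding vw by (simp add: power_mult_distrib)
  define A B C where "A = p i ?w" and "B = \<gamma> i ?w \<bullet> ?e" and "C = (norm ?e)\<^sup>2"
  have "(1 - s) * (A + s * B - l / 2 * (s\<^sup>2 * C)) + s * (A - (1 - s) * B - l / 2 * ((1 - s)\<^sup>2 * C))
      \<le> (1 - s) * h u + s * h v"
    using 1 2 s by (intro add_mono mult_left_mono) (auto simp: A_def B_def C_def)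
  moreover have "(1 - s) * (A + s * B - l / 2 * (s\<^sup>2 * C)) + s * (A - (1 - s) * B - l / 2 * ((1 - s)\<^sup>2 * C))
      = A - l / 2 * (s * (1 - s)) * C" by (simp add: power2_eq_square field_simps)
  ultimately show ?thesis unfolding i(2) A_def C_def by simp
qed

section \<open>Integral functionals\<close>

text \<open>Under the convention \<infinity> - \<infinity> = \<infinity>, an infinite integral of
  either part makes the value infinite, so a finite value already means integrability.\<close>

lemma integral_functional_real:
  assumes k[measurable]: "k \<in> borel_measurable M" and \<phi>: "AE t in M. \<phi> t x = ereal (k t)"
  shows "\<bar>integral_functional M \<phi> x\<bar> \<noteq> \<infinity> \<Longrightarrow> integrable M k"
    and "integrable M k \<Longrightarrow> integral_functional M \<phi> x = ereal (integral\<^sup>L M k)"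
proof -
  have eq: "(\<integral>\<^sup>+t. e2ennreal (\<phi> t x) \<partial>M) = (\<integral>\<^sup>+t. ennreal (k t) \<partial>M)"
    "(\<integral>\<^sup>+t. e2ennreal (- \<phi> t x) \<partial>M) = (\<integral>\<^sup>+t. ennreal (- k t) \<partial>M)"
    using \<phi> by (auto intro!: nn_integral_cong_AE elim!: eventually_mono)
  show "integrable M k" if fin: "\<bar>integral_functional M \<phi> x\<bar> \<noteq> \<infinity>"
  proof -
    have "(\<integral>\<^sup>+t. ennreal (k t) \<partial>M) \<noteq> \<infinity>"
      using fin unfolding integral_functional_def eq by (auto simp: enn2ereal_top)
    moreover have "(\<integral>\<^sup>+t. ennreal (- k t) \<partial>M) \<noteq> \<infinity>"
    proof
      assume inf: "(\<integral>\<^sup>+t. ennreal (- k t) \<partial>M) = \<infinity>"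
      then have "integral_functional M \<phi> x = enn2ereal (\<integral>\<^sup>+t. ennreal (k t) \<partial>M) - \<infinity>"
        unfolding integral_functional_def eq by simp
      then show False using fin by (cases "enn2ereal (\<integral>\<^sup>+t. ennreal (k t) \<partial>M)") auto
    qed
    ultimately show ?thesis unfolding real_integrable_def by simp
  qed
  assume ik: "integrable M k"
  then have "(\<integral>\<^sup>+t. ennreal (k t) \<partial>M) \<noteq> \<infinity>" "(\<integral>\<^sup>+t. ennreal (- k t) \<partial>M) \<noteq> \<infinity>"
    unfolding real_integrable_def by auto
  moreover have "enn2ereal A = ereal (enn2real A)" if "A \<noteq> \<infinity>" for A
    using that by (cases A) (auto simp: enn2ereal_ennreal)
  ultimately have "enn2ereal (\<integral>\<^sup>+t. ennreal (k t) \<partial>M) = ereal (enn2real (\<integral>\<^sup>+t. ennreal (k t) \<partial>M))"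
    "enn2ereal (\<integral>\<^sup>+t. ennreal (- k t) \<partial>M) = ereal (enn2real (\<integral>\<^sup>+t. ennreal (- k t) \<partial>M))"
    by blast+
  then show "integral_functional M \<phi> x = ereal (integral\<^sup>L M k)"
    unfolding integral_functional_def eq real_lebesgue_integral_def[OF ik] by simp
qed

theorem corollary7p6:
  fixes M :: "'t measure"
    and s :: nat
    and \<psi> :: "nat \<Rightarrow> 't \<Rightarrow> real ^ 'n \<Rightarrow> ereal"
    and \<phi> :: "'t \<Rightarrow> real ^ 'n \<Rightarrow> ereal"
    and U :: "(real ^ 'n) set"
    and l :: "'t \<Rightarrow> real"
    and x0 y0 :: "real ^ 'n"
  assumes "complete_measure M" and "finite_measure M"
    and "s \<ge> 1"
    and "\<And>i. i \<in> {1..s} \<Longrightarrow> normal_integrand M (\<psi> i)"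
    and "\<And>i t. i \<in> {1..s} \<Longrightarrow> t \<in> space M \<Longrightarrow> proper_fun (\<psi> i t)"
    and "open U"
    and "\<And>x i. x \<in> U \<Longrightarrow> i \<in> {1..s} \<Longrightarrow>
           AE t in M. continuously_differentiable_around (\<psi> i t) x"
    and "integrable M l" and "\<And>t. t \<in> space M \<Longrightarrow> l t > 0"
    and "AE t in M. \<forall>i\<in>{1..s}. \<forall>u1\<in>U. \<forall>u2\<in>U.
           \<exists>g1 g2. has_gradient (\<psi> i t) u1 g1 \<and> has_gradient (\<psi> i t) u2 g2 \<and>
             \<bar>\<psi> i t u1 - \<psi> i t u2\<bar> + ereal (norm (g1 - g2)) \<le> ereal (l t * norm (u1 - u2))"
    and "\<phi> = (\<lambda>t x. Max ((\<lambda>i. \<psi> i t x) ` {1..s}))"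
    and "x0 \<in> U"
    and "y0 \<in> subdifferential (integral_functional M \<phi>) x0"
    and "inner_semicompact M (selections M \<phi>) x0 y0"
    and "\<And>v. v \<in> selections M \<phi> x0 y0 \<Longrightarrow> second_order_quasi_Lipschitzian M \<phi> x0 v"
  shows "\<forall>y'. second_subdifferential (integral_functional M \<phi>) x0 y0 y'
           \<subseteq> (\<Union>v\<in>selections M \<phi> x0 y0.
                aumann_integral M (\<lambda>t. second_subdifferential (\<phi> t) x0 (v t) y'))"
proof -
  interpret finite_measure M by fact
  let ?I = "{1..s}"
  let ?E = "integral_functional M \<phi>"
  have I: "finite ?I" "?I \<noteq> {}" using \<open>s \<ge> 1\<close> by auto
  obtain r where rU: "0 < r" "cball x0 r \<subseteq> U" using \<open>open U\<close> \<open>x0 \<in> U\<close> open_contains_cball by blast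
  obtain N where N: "N \<in> null_sets M"
    and reg: "\<And>t. t \<in> space M - N \<Longrightarrow> \<forall>i\<in>?I. \<forall>u1\<in>U. \<forall>u2\<in>U.
           \<exists>g1 g2. has_gradient (\<psi> i t) u1 g1 \<and> has_gradient (\<psi> i t) u2 g2 \<and>
             \<bar>\<psi> i t u1 - \<psi> i t u2\<bar> + ereal (norm (g1 - g2)) \<le> ereal (l t * norm (u1 - u2))"
    by (rule AE_E3[OF assms(10)]) (rule that)
  have [measurable]: "N \<in> sets M" using N by auto
  define p where "p t i x = real_of_ereal (\<psi> i t x)" for t i x
  \<comment> \<open>The locales require their estimates at every t. On the exceptional null set the
    zero function satisfies all of them, since l t is positive.\<close>
  define h where "h t x = (if t \<in> N then 0 else real_of_ereal (\<phi> t x))" for t x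
  \<comment> \<open>The hypothesis provides gradients for each pair of points separately. Uniqueness
    of gradients identifies them with this single choice, so that \<open>both\<close> holds for one
    gradient field.\<close>
  define \<gamma> where "\<gamma> t i x = (SOME g. has_gradient (\<psi> i t) x g)" for t i x
  have grad: "has_gradient (\<psi> i t) x (\<gamma> t i x)" if "t \<in> space M - N" "i \<in> ?I" "x \<in> U" for t i x
    unfolding \<gamma>_def using reg[OF that(1)] that by (intro someI_ex[of "has_gradient (\<psi> i t) x"]) blast
  have \<psi>: "\<psi> i t x = ereal (p t i x)" if "t \<in> space M - N" "i \<in> ?I" "x \<in> U" for t i x
    using has_gradient_finite[OF grad[OF that]] by (simp add: p_def ereal_real)
  have both: "\<bar>p t i x - p t i y\<bar> + norm (\<gamma> t i x - \<gamma> t i y) \<le> l t * norm (x - y)"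
    if t: "t \<in> space M - N" and i: "i \<in> ?I" and xy: "x \<in> U" "y \<in> U" for t i x y
  proof -
    obtain g1 g2 where g: "has_gradient (\<psi> i t) x g1" "has_gradient (\<psi> i t) y g2"
      "\<bar>\<psi> i t x - \<psi> i t y\<bar> + ereal (norm (g1 - g2)) \<le> ereal (l t * norm (x - y))"
      using reg[OF t] i xy by blast
    have "g1 = \<gamma> t i x" "g2 = \<gamma> t i y"
      using has_gradient_unique g(1,2) grad[OF t i] xy by blast+
    with g(3) show ?thesis using \<psi>[OF t i xy(1)] \<psi>[OF t i xy(2)] by simp
  qed
  have \<phi>_real: "\<phi> t x = ereal (Max ((\<lambda>i. p t i x) ` ?I))" if "t \<in> space M - N" "x \<in> U" for t x
  proof -
    have "\<phi> t x = Max (ereal ` (\<lambda>i. p t i x) ` ?I)"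
      unfolding \<open>\<phi> = _\<close> image_image by (intro arg_cong[of _ _ Max] image_cong refl \<psi> that)
    also have "\<dots> = ereal (Max ((\<lambda>i. p t i x) ` ?I))"
      by (rule mono_Max_commute[symmetric]) (use I in \<open>auto simp: mono_def\<close>)
    finally show ?thesis .
  qed
  then have h_Max: "h t x = Max ((\<lambda>i. p t i x) ` ?I)" if "t \<in> space M - N" "x \<in> U" for t x
    using that by (simp add: h_def)
  have \<phi>_h: "\<phi> t x = ereal (h t x)" if "t \<in> space M - N" "x \<in> U" for t x
    using \<phi>_real[OF that] h_Max[OF that] by simp
  have h_measurable: "(\<lambda>t. h t x) \<in> borel_measurable M" for x
  proof -
    have "(\<lambda>t. \<psi> i t x) \<in> borel_measurable M" if "i \<in> ?I" for i
    proof -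
      have "(\<lambda>(t, x). \<psi> i t x) \<in> borel_measurable (M \<Otimes>\<^sub>M borel)"
        using assms(4)[OF that] by (simp add: normal_integrand_def)
      from measurable_compose[OF _ this, of "\<lambda>t. (t, x)" M] show ?thesis by simp
    qed
    then have [measurable]: "(\<lambda>t. \<phi> t x) \<in> borel_measurable M"
      unfolding \<open>\<phi> = _\<close> using I(1) by (intro borel_measurable_Max)
    show ?thesis unfolding h_def by measurable
  qed
  have AE_h: "AE t in M. \<phi> t x = ereal (h t x)" if "x \<in> U" for x
    using AE_not_in[OF N] AE_space by eventually_elim (simp add: \<phi>_h that)
  \<comment> \<open>The existence of a subgradient y0 entails that the integral functional is finite
    at \<open>x0\<close>, and this is the source of integrability.\<close>
  have h_int0: "integrable M (\<lambda>t. h t x0)"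
  proof (rule integral_functional_real(1)[where \<phi>=\<phi> and x=x0, OF h_measurable AE_h[OF \<open>x0 \<in> U\<close>]])
    show "\<bar>?E x0\<bar> \<noteq> \<infinity>" using assms(13) by (auto simp: subdifferential_def split: if_splits)
  qed
  \<comment> \<open>The joint estimate \<open>both\<close> bounds values and gradients by the same
    l. Its first part is the Lipschitz bound; its second gives the quadratic minorants behind weak
    convexity with modulus l t.\<close>
  interpret weakly_convex_integrand M h x0 r l
  proof
    show "\<bar>h t x - h t y\<bar> \<le> l t * norm (x - y)"
      if t: "t \<in> space M" and xy: "x \<in> cball x0 r" "y \<in> cball x0 r" for t x y
    proof (cases "t \<in> N")
      case True
      then show ?thesis using assms(9)[OF t] by (simp add: h_def)
    next
      case False
      with t have t': "t \<in> space M - N" by simp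
      have U: "x \<in> U" "y \<in> U" using xy rU(2) by auto
      have "\<bar>p t i x - p t i y\<bar> \<le> l t * norm (x - y)" if "i \<in> ?I" for i
        using both[OF t' that U] norm_ge_zero[of "\<gamma> t i x - \<gamma> t i y"] by linarith
      then show ?thesis unfolding h_Max[OF t' U(1)] h_Max[OF t' U(2)] by (intro Max_lipschitz I)
    qed
    fix t u v and \<sigma> :: real
    assume t: "t \<in> space M" and uv: "u \<in> cball x0 r" "v \<in> cball x0 r" and \<sigma>: "0 \<le> \<sigma>" "\<sigma> \<le> 1"
    let ?w = "(1 - \<sigma>) *\<^sub>R u + \<sigma> *\<^sub>R v"
    have w: "?w \<in> cball x0 r" using uv \<sigma> convex_cball[of x0 r] unfolding convex_alt by blast
    show "h t ?w \<le> (1 - \<sigma>) * h t u + \<sigma> * h t v + l t / 2 * (\<sigma> * (1 - \<sigma>)) * (norm (u - v))\<^sup>2"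
    proof (cases "t \<in> N")
      case True
      then show ?thesis using assms(9)[OF t] \<sigma> by (simp add: h_def)
    next
      case False
      with t have t': "t \<in> space M - N" by simp
      have U: "u \<in> U" "v \<in> U" "?w \<in> U" using uv w rU(2) by blast+
      show ?thesis
        unfolding h_Max[OF t' U(1)] h_Max[OF t' U(2)] h_Max[OF t' U(3)]
      proof (rule Max_weakly_convex[OF I convex_cball uv \<sigma>, where \<gamma>="\<gamma> t"])
        fix i x y assume i: "i \<in> ?I" and xy: "x \<in> cball x0 r" "y \<in> cball x0 r"
        show "p t i x + \<gamma> t i x \<bullet> (y - x) - l t / 2 * (norm (y - x))\<^sup>2 \<le> p t i y"
          unfolding p_def
        proof (rule Lipschitz_gradient_lower_bound[OF convex_cball xy])
          show "has_gradient (\<psi> i t) z (\<gamma> t i z)" if "z \<in> cball x0 r" for z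
            using grad[OF t' i] that rU(2) by blast
          show "norm (\<gamma> t i y - \<gamma> t i z) \<le> l t * norm (y - z)" if "y \<in> cball x0 r" "z \<in> cball x0 r" for y z
            using both[OF t' i, of y z] that rU(2) abs_ge_zero[of "p t i y - p t i z"] by fastforce
        qed
      qed
    qed
  qed (use rU(1) h_measurable assms(8,9) h_int0 in auto)
  have E: "?E x = ereal (G x)" if x: "x \<in> cball x0 r" for x
    unfolding G_def
    by (rule integral_functional_real(2)[where \<phi>=\<phi> and x=x, OF h_measurable AE_h g_integrable[OF x]])
      (use x rU(2) in blast)
  have \<phi>_AE: "AE t in M. \<forall>x\<in>cball x0 r. \<phi> t x = ereal (h t x)"
    using AE_not_in[OF N] AE_space by eventually_elim (use \<phi>_h rU(2) in blast)
  show ?thesis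
    using second_order_Leibniz[OF \<phi>_AE E assms(13,15)] by blast
qed

end
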